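(* Let $n\ge 3$, $0<\sigma<1$, and let $\alpha_1,\alpha_2,\beta$ be positive constants. Let $u,v\in C^2(\mathbb{R}^n)\cap L_\sigma(\mathbb{R}^n)$, $u,v>0$, satisfy $$(-\Delta)^{\sigma}u=\alpha_1u^{\frac{n+2\sigma}{n-2\sigma}}+\beta u^{\frac{2\sigma}{n-2\sigma}}v^{\frac{n}{n-2\sigma}},\qquad (-\Delta)^{\sigma}v=\alpha_2v^{\frac{n+2\sigma}{n-2\sigma}}+\beta v^{\frac{2\sigma}{n-2\sigma}}u^{\frac{n}{n-2\sigma}}\qquad\text{in }\mathbb{R}^n .$$ Then $u$ and $v$ are radially symmetric with respect to the same point. In particular, $(u,v)=(k\widehat U,l\widehat U)$, where $k,l>0$ satisfy $$\alpha_1k^{\frac{4\sigma}{n-2\sigma}}+\beta k^{\frac{4\sigma-n}{n-2\sigma}}l^{\frac{n}{n-2\sigma}}=1,\qquad \alpha_2l^{\frac{4\sigma}{n-2\sigma}}+\beta l^{\frac{4\sigma-n}{n-2\sigma}}k^{\frac{n}{n-2\sigma}}=1,$$ and $\widehat U\in C^2(\mathbb{R}^n)\cap L_\sigma(\mathbb{R}^n)$ is a positive solution of $(-\Delta)^\sigma \widehat U=\widehat U^{\frac{n+2\sigma}{n-2\sigma}}$ in $\mathbb{R}^n$.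
   Context: $L_\sigma(\mathbb{R}^n)=\{u\in L^1_{\rm loc}(\mathbb{R}^n):\int_{\mathbb{R}^n}\frac{|u(x)|}{1+|x|^{n+2\sigma}}dx<\infty\}$. The fractional Laplacian is understood in the classical (pointwise) sense: $(-\Delta)^{\sigma}u(x)=C_{n,\sigma}\lim_{\varepsilon\to0^+}\int_{\mathbb{R}^n\setminus B_\varepsilon(x)}\frac{u(x)-u(y)}{|x-y|^{n+2\sigma}}dy$ with $C_{n,\sigma}=\frac{2^{2\sigma}\sigma\Gamma(\frac n2+\sigma)}{\pi^{n/2}\Gamma(1-\sigma)}$. *)

theory Defs
  imports "HOL-Analysis.Analysis"
begin

text \<open>The second derivative is the Frechet derivative of the first one, taken with respect to
  the operator norm on bounded linear maps.\<close>

definition C2 :: "(real ^ 'n \<Rightarrow> real) set" where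
  "C2 = {u. \<exists>(u' :: real ^ 'n \<Rightarrow> ((real ^ 'n) \<Rightarrow>\<^sub>L real))
            (u'' :: real ^ 'n \<Rightarrow> ((real ^ 'n) \<Rightarrow>\<^sub>L ((real ^ 'n) \<Rightarrow>\<^sub>L real))).
          (\<forall>x. (u has_derivative blinfun_apply (u' x)) (at x)) \<and>
          (\<forall>x. (u' has_derivative blinfun_apply (u'' x)) (at x)) \<and>
          continuous_on UNIV u''}"

definition L1_loc :: "(real ^ 'n \<Rightarrow> real) set" where
  "L1_loc = {u. \<forall>K. compact K \<longrightarrow> set_integrable lebesgue K u}"

definition L_space :: "real \<Rightarrow> (real ^ 'n \<Rightarrow> real) set" where
  "L_space \<sigma> = {u \<in> L1_loc.
     integrable lebesgue (\<lambda>x. \<bar>u x\<bar> / (1 + norm x powr (real CARD('n) + 2 * \<sigma>)))}"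

definition frac_const :: "nat \<Rightarrow> real \<Rightarrow> real" where
  "frac_const n \<sigma> = 2 powr (2 * \<sigma>) * \<sigma> * Gamma (real n / 2 + \<sigma>)
     / (pi powr (real n / 2) * Gamma (1 - \<sigma>))"

text \<open>\<open>has_frac_laplacian \<sigma> u x L\<close>: the pointwise \<open>(-\<Delta>)\<^sup>\<sigma> u(x)\<close> exists and equals \<open>L\<close>.
  The integrability conjunct keeps the totalised Bochner integral from silently being \<open>0\<close>;
  it is automatic for \<open>u \<in> L_space \<sigma>\<close> with \<open>\<sigma> > 0\<close>.\<close>

definition has_frac_laplacian ::
  "real \<Rightarrow> (real ^ 'n \<Rightarrow> real) \<Rightarrow> real ^ 'n \<Rightarrow> real \<Rightarrow> bool" where
  "has_frac_laplacian \<sigma> u x L \<longleftrightarrow>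
     (\<forall>\<epsilon>>0. set_integrable lebesgue (UNIV - ball x \<epsilon>)
        (\<lambda>y. (u x - u y) / norm (x - y) powr (real CARD('n) + 2 * \<sigma>))) \<and>
     ((\<lambda>\<epsilon>. frac_const CARD('n) \<sigma> *
        (LINT y : (UNIV - ball x \<epsilon>) | lebesgue.
           (u x - u y) / norm (x - y) powr (real CARD('n) + 2 * \<sigma>))) \<longlongrightarrow> L) (at_right 0)"

definition radial_about :: "real ^ 'n \<Rightarrow> (real ^ 'n \<Rightarrow> real) \<Rightarrow> bool" where
  "radial_about p u \<longleftrightarrow> (\<forall>x y. norm (x - p) = norm (y - p) \<longrightarrow> u x = u y)"

end

theory Submission
  imports Defs "HOL-Real_Asymp.Real_Asymp"
begin

text \<open>The proof is the direct method of moving spheres. Write \<open>a = n - 2\<sigma>\<close> and let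
  \<open>u\<^sub>l y = (l / norm y) powr a * u (l\<^sup>2 y / (norm y)\<^sup>2)\<close> be the Kelvin transform. The operator is conformally covariant,
  so \<open>u - u\<^sub>l\<close> and \<open>v - v\<^sub>l\<close> are antisymmetric under inversion and, where they are nonnegative outside the ball,
  supersolutions there. For small \<open>l\<close> both are nonnegative outside the ball, because \<open>u\<close> and \<open>v\<close> are
  superharmonic and hence at least of order \<open>norm y powr - a\<close> at infinity. Let \<open>l\<close> grow to the first radius that
  cannot be passed. Unless both differences vanish there, they are positive outside the ball, again of order at
  least \<open>norm y powr - a\<close> at infinity, and a maximum principle in thin annuli lets the sphere move further. So around
  each centre either every radius is admissible or \<open>u\<close> and \<open>v\<close> are symmetric under one inversion. If every radius is
  admissible for every centre, \<open>u\<close> is constant, which contradicts the equation; otherwise, comparing the decay at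
  infinity, every centre \<open>x\<close> has a sphere of symmetry, of radius \<open>l x\<close>, and \<open>l x powr a * u x\<close> and \<open>l x powr a * v x\<close>
  do not depend on \<open>x\<close>. Hence \<open>v / u\<close> is constant, and the next term of the expansion at infinity gives
  \<open>(l x)\<^sup>2 = (norm (x - p))\<^sup>2 + const\<close>.\<close>

section \<open>Inversion as a change of variables\<close>

text \<open>The weights fit because \<open>ea + eb\<close> is twice the dimension, the exponent in
  the Jacobian of an inversion, and because the nonlinearity is homogeneous of degree
  \<open>eb / ea\<close>. The delicate point of conformal covariance is the principal value: an
  inversion does not map balls about \<open>x\<close> to balls about the image of \<open>x\<close>.
  For a function that is Lipschitz at the point the resulting error is of order
  \<open>\<epsilon> powr (2 - 2 * \<sigma>)\<close> and vanishes in the limit. A nonlocal comparison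
  of \<open>u\<close> with its Kelvin transform sees the inside of the sphere as well, where the
  sign is the wrong one; antisymmetry allows the inside to be folded outward, and the folded kernel
  is still positive. The exponent \<open>2 * \<sigma> / ea\<close> may be below 1, so the
  nonlinearity is Lipschitz only away from zero, and the thin annuli are kept in a region with
  positive lower bounds. Both right-hand sides increase in both unknowns, so the smaller of the two
  differences can be treated like the difference for a scalar equation. The profile is never
  computed: it is a multiple of \<open>u\<close>.\<close>

definition inversion :: "real \<Rightarrow> 'a::real_inner \<Rightarrow> 'a" where
  "inversion l z = (l / norm z)\<^sup>2 *\<^sub>R z"

lemma norm_inversion: "norm (inversion l z) = l\<^sup>2 / norm z"
  by (simp add: inversion_def power2_eq_square)

lemma inversion_inversion: "l \<noteq> 0 \<Longrightarrow> z \<noteq> 0 \<Longrightarrow> inversion l (inversion l z) = z"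
  by (simp add: inversion_def norm_power field_simps power2_eq_square)

lemma inversion_eq_0_iff: "l \<noteq> 0 \<Longrightarrow> inversion l z = 0 \<longleftrightarrow> z = 0"
  by (simp add: inversion_def)

text \<open>The distortion of distances splits into one factor for each point. This is what turns
  the kernel of the operator into weights that a Kelvin transform can absorb.\<close>

lemma norm_inversion_diff:
  assumes "x \<noteq> 0" "z \<noteq> 0"
  shows "norm (inversion l x - inversion l z) = l\<^sup>2 * norm (x - z) / (norm x * norm z)"
proof (rule power2_eq_imp_eq)
  have e: "norm (x - z) ^ 2 = norm x ^ 2 - 2 * (x \<bullet> z) + norm z ^ 2"
    by (simp add: power2_norm_eq_inner inner_diff inner_commute algebra_simps)
  have f: "norm (inversion l x - inversion l z) ^ 2
      = (l / norm x) ^ 4 * norm x ^ 2 - 2 * ((l / norm x)^2 * (l / norm z)^2 * (x \<bullet> z)) + (l / norm z) ^ 4 * norm z ^ 2"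
    by (simp add: power2_norm_eq_inner inversion_def inner_diff inner_commute algebra_simps)
  have alg: "(l / X) ^ 4 * X\<^sup>2 - 2 * ((l / X)\<^sup>2 * (l / Z)\<^sup>2 * P) + (l / Z) ^ 4 * Z\<^sup>2
      = ((l\<^sup>2)\<^sup>2 * (X\<^sup>2 - 2 * P + Z\<^sup>2)) / (X\<^sup>2 * Z\<^sup>2)" if "X \<noteq> 0" "Z \<noteq> 0" for X Z P :: real
    using that by (simp add: field_simps eval_nat_numeral)
  show "(norm (inversion l x - inversion l z))\<^sup>2 = (l\<^sup>2 * norm (x - z) / (norm x * norm z))\<^sup>2"
    unfolding power_divide[of "_ * _"] power_mult_distrib e f by (rule alg) (use assms in auto)
qed auto

text \<open>The derivative is a homothety composed with the reflection in the hyperplane orthogonal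
  to \<open>z\<close>; hence the Jacobian is a pure power of \<open>l / norm z\<close>.\<close>

lemma has_derivative_inversion:
  fixes z :: "'a::real_inner"
  assumes "z \<noteq> 0"
  shows "(inversion l has_derivative (\<lambda>h. (l / norm z)\<^sup>2 *\<^sub>R (h - (2 * (z \<bullet> h) / (norm z)\<^sup>2) *\<^sub>R z))) (at z within S)"
proof -
  have n: "z \<bullet> z \<noteq> 0" using assms by simp
  have id: "((\<lambda>z. z) has_derivative (\<lambda>h. h)) (at z within S)" by (rule has_derivative_ident)
  have "((\<lambda>z. (l\<^sup>2 / (z \<bullet> z)) *\<^sub>R z) has_derivative
      (\<lambda>h. (l / norm z)\<^sup>2 *\<^sub>R (h - (2 * (z \<bullet> h) / (norm z)\<^sup>2) *\<^sub>R z))) (at z within S)"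
    by (rule has_derivative_eq_rhs[OF has_derivative_scaleR[OF has_derivative_divide[OF has_derivative_const
      has_derivative_inner[OF id id] n] id]])
      (use n in \<open>simp add: fun_eq_iff power_divide scaleR_diff_right inner_commute inverse_eq_divide
        flip: power2_norm_eq_inner\<close>)
  then show ?thesis
    by (simp add: inversion_def[abs_def] power_divide power2_norm_eq_inner)
qed

lemma reflection_orthogonal:
  fixes z :: "'a::euclidean_space"
  assumes "z \<noteq> 0"
  shows "orthogonal_transformation (\<lambda>h. h - (2 * (z \<bullet> h) / (norm z)\<^sup>2) *\<^sub>R z)"
  unfolding orthogonal_transformation_def
proof (intro conjI allI)
  show "linear (\<lambda>h. h - (2 * (z \<bullet> h) / (norm z)\<^sup>2) *\<^sub>R z)"
    by (intro linearI) (auto simp: algebra_simps add_divide_distrib)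
  show "(v - (2 * (z \<bullet> v) / (norm z)\<^sup>2) *\<^sub>R z) \<bullet> (w - (2 * (z \<bullet> w) / (norm z)\<^sup>2) *\<^sub>R z) = v \<bullet> w" for v w
  proof -
    define c d where "c = 2 * (z \<bullet> v) / (norm z)\<^sup>2" and "d = 2 * (z \<bullet> w) / (norm z)\<^sup>2"
    have "c * (z \<bullet> z) = 2 * (z \<bullet> v)" "d * (z \<bullet> z) = 2 * (z \<bullet> w)"
      using assms by (auto simp: c_def d_def power2_norm_eq_inner)
    then have "c * (d * (z \<bullet> z)) = 2 * (c * (z \<bullet> w))" "d * (c * (z \<bullet> z)) = 2 * (d * (z \<bullet> v))"
      by simp_all
    then have "c * (d * (z \<bullet> z)) = c * (z \<bullet> w) + d * (z \<bullet> v)"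
      by (simp only: mult.left_commute[of d c])
    then show ?thesis
      using mult.left_commute[of d c "z \<bullet> z"]
      unfolding c_def[symmetric] d_def[symmetric]
      by (simp add: inner_diff_left inner_diff_right inner_commute[of v z] right_diff_distrib)
  qed
qed

lemma det_inversion:
  fixes z :: "real ^ 'n"
  assumes "z \<noteq> 0"
  shows "\<bar>det (matrix (\<lambda>h. (l / norm z)\<^sup>2 *\<^sub>R (h - (2 * (z \<bullet> h) / (norm z)\<^sup>2) *\<^sub>R z)))\<bar>
    = (l / norm z) ^ (2 * CARD('n))"
proof -
  let ?R = "\<lambda>h. h - (2 * (z \<bullet> h) / (norm z)\<^sup>2) *\<^sub>R z"
  have R: "orthogonal_transformation ?R" using assms by (rule reflection_orthogonal)
  then have lin: "linear ?R" by (simp add: orthogonal_transformation_def)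
  have "matrix (\<lambda>h. (l / norm z)\<^sup>2 *\<^sub>R ?R h) = matrix (\<lambda>h. (l / norm z)\<^sup>2 *\<^sub>R h) ** matrix ?R"
    using matrix_compose[OF lin, of "\<lambda>h. (l / norm z)\<^sup>2 *\<^sub>R h"] by (simp add: o_def linear_scaleR)
  moreover have "\<bar>det (matrix ?R)\<bar> = 1" using R orthogonal_transformation_det by blast
  moreover have "det (matrix (\<lambda>h::real^'n. (l / norm z)\<^sup>2 *\<^sub>R h)) = (l / norm z) ^ (2 * CARD('n))"
    by (simp add: power_mult det_matrix_scaleR)
  ultimately show ?thesis
    by (simp add: det_mul abs_mult power_mult)
qed

text \<open>Off the origin the inversion is an involution, so \<open>S\<close> is the image of its
  own image, and the measure of an image is the integral of the Jacobian. The origin has to be left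
  out because \<open>inversion l 0 = 0\<close>.\<close>

lemma emeasure_inversion_wellorder:
  fixes S :: "(real ^ 'm::{finite,wellorder}) set"
  assumes l: "l > 0" and S: "S \<in> sets borel" "0 \<notin> S" "emeasure lborel S < \<infinity>"
  shows "(\<integral>\<^sup>+ z. ennreal ((l / norm z) ^ (2 * CARD('m))) * indicator S (inversion l z) \<partial>lborel) = emeasure lborel S"
proof -
  have ii: "inversion l (inversion l x) = x" "inversion l x \<noteq> 0" if "x \<noteq> 0" for x :: "real^'m::{finite,wellorder}"
    using l that by (simp_all add: inversion_inversion inversion_eq_0_iff)
  have S0: "x \<noteq> 0" if "x \<in> S" for x using S that by auto
  have inv: "inversion l ` inversion l ` S = S"
    by (simp add: image_image ii S0 cong: image_cong_simp)
  have im: "inversion l ` S = inversion l -` S \<inter> (- {0})"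
  proof (intro set_eqI iffI)
    fix y assume "y \<in> inversion l ` S"
    then show "y \<in> inversion l -` S \<inter> (- {0})" using ii S0 by auto
  next
    fix x assume "x \<in> inversion l -` S \<inter> (- {0})"
    then show "x \<in> inversion l ` S" using ii(1)[of x] by (metis IntD1 IntD2 ComplD imageI singletonI vimageD)
  qed
  have meas: "inversion l \<in> borel_measurable (borel :: (real^'m::{finite,wellorder}) measure)"
    unfolding inversion_def[abs_def] by measurable
  have Sb: "inversion l ` S \<in> sets borel"
    unfolding im using measurable_sets[OF meas S(1)] by auto
  have z: "x \<noteq> 0" if "x \<in> inversion l ` S" for x using that unfolding im by simp
  have "inversion l ` inversion l ` S \<in> lmeasurable \<and> measure lebesgue (inversion l ` inversion l ` S) = measure lebesgue S"
    using S unfolding inv by (simp add: fmeasurable_def)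
  then have hi: "((\<lambda>z. (l / norm z) ^ (2 * CARD('m))) has_integral (measure lebesgue S)) (inversion l ` S)"
  proof (subst (asm) has_measure_differentiable_image)
    show "inversion l ` S \<in> sets lebesgue" using Sb by simp
    show "inj_on (inversion l) (inversion l ` S)"
      by (rule inj_on_inverseI[of _ "inversion l"]) (simp add: ii z)
    fix x assume "x \<in> inversion l ` S"
    then show "(inversion l has_derivative (\<lambda>h. (l / norm x)\<^sup>2 *\<^sub>R (h - (2 * (x \<bullet> h) / (norm x)\<^sup>2) *\<^sub>R x))) (at x within inversion l ` S)"
      by (intro has_derivative_inversion z)
  next
    assume A: "((\<lambda>x. \<bar>det (matrix (\<lambda>h. (l / norm x)\<^sup>2 *\<^sub>R (h - (2 * (x \<bullet> h) / (norm x)\<^sup>2) *\<^sub>R x)))\<bar>)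
      has_integral measure lebesgue S) (inversion l ` S)"
    show ?thesis
      by (rule has_integral_eq[OF _ A]) (simp add: det_inversion z)
  qed
  have "(\<integral>\<^sup>+ z. ennreal ((l / norm z) ^ (2 * CARD('m))) * indicator (inversion l ` S) z \<partial>lborel) = ennreal (measure lebesgue S)"
    using l by (intro nn_integral_has_integral_lebesgue'[OF _ hi]) auto
  moreover have "ennreal (measure lebesgue S) = emeasure lborel S"
    using S by (simp add: emeasure_eq_ennreal_measure)
  moreover have "indicator (inversion l ` S) z = (indicator S (inversion l z) :: ennreal)" for z
    using S(2) unfolding im by (auto simp: indicator_def inversion_def)
  ultimately show ?thesis
    by simp
qed

text \<open>The library's change of variables theorem needs a well-ordered index type. Coordinates indexed by an
  arbitrary finite type are therefore renamed to coordinates indexed by an initial segment of the naturals.\<close>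

typedef (overloaded) ('n::finite) idx = "{..<CARD('n)}"
  by (rule exI[of _ 0]) simp

lemma bij_Abs_idx: "bij_betw (Abs_idx :: nat \<Rightarrow> 'n::finite idx) {..<CARD('n)} UNIV"
  by (rule bij_betw_byWitness[of _ Rep_idx]) (use Rep_idx in \<open>auto simp: Rep_idx_inverse Abs_idx_inverse\<close>)

instance idx :: (finite) finite
  by standard (use bij_betw_finite[OF bij_Abs_idx] in simp)

instantiation idx :: (finite) linorder
begin
definition less_eq_idx :: "'a idx \<Rightarrow> 'a idx \<Rightarrow> bool" where "x \<le> y \<longleftrightarrow> Rep_idx x \<le> Rep_idx y"
definition less_idx :: "'a idx \<Rightarrow> 'a idx \<Rightarrow> bool" where "x < y \<longleftrightarrow> Rep_idx x < Rep_idx y"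
instance
  by standard (auto simp: less_eq_idx_def less_idx_def Rep_idx_inject)
end

instance idx :: (finite) wellorder
proof
  fix P :: "'a idx \<Rightarrow> bool" and a
  assume step: "\<And>x. (\<And>y. y < x \<Longrightarrow> P y) \<Longrightarrow> P x"
  show "P a"
    by (induction a rule: measure_induct_rule[of Rep_idx]) (rule step, simp add: less_idx_def)
qed

lemma card_idx: "CARD('n::finite idx) = CARD('n)"
  using bij_betw_same_card[OF bij_Abs_idx[where 'n = 'n]] by simp

lemma lborel_reindex:
  fixes e :: "'m::finite \<Rightarrow> 'n::finite"
  assumes e: "bij e"
  shows "distr lborel borel (\<lambda>x::real^'n. \<chi> i. x $ e i) = (lborel :: (real^'m) measure)"
proof (rule lborel_eqI[symmetric])
  let ?T = "\<lambda>x::real^'n. (\<chi> i. x $ e i) :: real^'m" and ?T' = "\<lambda>x::real^'m. (\<chi> i. x $ inv e i) :: real^'n"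
  have [measurable]: "?T \<in> borel_measurable borel"
    by (intro borel_measurable_continuous_onI continuous_intros)
  fix l u :: "real^'m" assume le: "\<And>b. b \<in> Basis \<Longrightarrow> l \<bullet> b \<le> u \<bullet> b"
  have le': "l $ i \<le> u $ i" for i using le[of "axis i 1"] by (simp add: inner_axis axis_in_Basis_iff)
  have ei: "inv e (e i) = i" for i using e by (simp add: bij_is_inj)
  have ie: "e (inv e i) = i" for i using e by (simp add: bij_is_surj surj_f_inv_f)
  have vim: "?T -` box l u = box (?T' l) (?T' u)"
    by (auto simp: mem_box_cart; metis ei ie)
  have prod_cart: "(\<Prod>b\<in>Basis. x \<bullet> b) = (\<Prod>i\<in>UNIV. x $ i)" for x :: "real^'k"
    unfolding Basis_vec_def by (simp add: UNION_singleton_eq_range prod.reindex inj_on_def axis_eq_axis inner_axis)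
  have "emeasure (distr lborel borel ?T) (box l u) = emeasure lborel (?T -` box l u)"
    by (simp add: emeasure_distr)
  also have "\<dots> = ennreal (\<Prod>b\<in>Basis. (?T' u - ?T' l) \<bullet> b)"
    unfolding vim by (rule emeasure_lborel_box) (auto simp: Basis_vec_def inner_axis le')
  also have "(\<Prod>b\<in>Basis. (?T' u - ?T' l) \<bullet> b) = (\<Prod>i\<in>UNIV. (u - l) $ inv e i)"
    unfolding prod_cart by simp
  also have "\<dots> = (\<Prod>i\<in>UNIV. (u - l) $ i)"
    by (rule prod.reindex_bij_betw) (rule bij_imp_bij_inv[OF e])
  also have "\<dots> = (\<Prod>b\<in>Basis. (u - l) \<bullet> b)" unfolding prod_cart ..
  finally show "emeasure (distr lborel borel ?T) (box l u) = (\<Prod>b\<in>Basis. (u - l) \<bullet> b)" .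
qed simp

lemma borel_measurable_inversion [measurable]:
  "inversion l \<in> borel_measurable (borel :: 'a::euclidean_space measure)"
  unfolding inversion_def[abs_def] by measurable

text \<open>It suffices to compare the two measures on boxes. Renaming coordinates preserves norms
  and commutes with inversion, and removing the origin from a box changes it by a null set.\<close>

theorem lborel_inversion:
  assumes l: "l > 0"
  shows "distr (density lborel (\<lambda>z::real^'n. ennreal ((l / norm z) ^ (2 * CARD('n))))) borel (inversion l) = lborel"
proof (rule lborel_eqI[symmetric])
  let ?J = "\<lambda>z::real^'n. ennreal ((l / norm z) ^ (2 * CARD('n)))"
  obtain e :: "'n \<Rightarrow> 'n idx" where e: "bij e"
    using finite_same_card_bij[of "UNIV :: 'n set" "UNIV :: 'n idx set"] by (auto simp: card_idx)
  define T :: "real^'n idx \<Rightarrow> real^'n" where "T x = (\<chi> i. x $ e i)" for x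
  have T: "distr lborel borel T = lborel"
    unfolding T_def by (rule lborel_reindex[OF e])
  have [measurable]: "T \<in> borel_measurable borel"
    unfolding T_def by (intro borel_measurable_continuous_onI continuous_intros)
  have nT: "norm (T x) = norm x" for x
    unfolding norm_vec_def T_def L2_set_def using sum.reindex_bij_betw[OF e, of "\<lambda>i. (norm (x $ i))\<^sup>2"] by simp
  have JT: "inversion l (T x) = T (inversion l x)" for x
    unfolding inversion_def nT by (simp add: T_def vec_eq_iff)
  have T0: "T x = 0 \<longleftrightarrow> x = 0" for x using nT[of x] by (metis norm_eq_zero)
  fix a b :: "real^'n" assume le: "\<And>k. k \<in> Basis \<Longrightarrow> a \<bullet> k \<le> b \<bullet> k"
  define S where "S = box a b - {0}"
  have [measurable]: "S \<in> sets borel" unfolding S_def by simp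
  have Sf: "emeasure lborel S < \<infinity>"
    using emeasure_mono[of S "box a b" lborel] emeasure_lborel_box_finite[of a b] unfolding S_def
    by (simp add: order_le_less_trans)
  have TS: "emeasure lborel (T -` S) = emeasure lborel S"
    by (subst T[symmetric], subst emeasure_distr) simp_all
  have "emeasure (distr (density lborel ?J) borel (inversion l)) (box a b)
      = (\<integral>\<^sup>+ z. ?J z * indicator (box a b) (inversion l z) \<partial>lborel)"
    by (simp add: emeasure_distr emeasure_density indicator_vimage[symmetric] vimage_def indicator_def if_distrib cong: if_cong)
  also have "\<dots> = (\<integral>\<^sup>+ z. ?J z * indicator S (inversion l z) \<partial>lborel)"
  proof (rule nn_integral_cong_AE)
    have "AE z::real^'n in lborel. z \<noteq> 0" by (rule AE_lborel_singleton)
    then show "AE z in lborel. ?J z * indicator (box a b) (inversion l z) = ?J z * indicator S (inversion l z)"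
      by eventually_elim (use l in \<open>simp add: S_def indicator_def inversion_eq_0_iff\<close>)
  qed
  also have "\<dots> = (\<integral>\<^sup>+ z. ?J (T z) * indicator S (inversion l (T z)) \<partial>lborel)"
    by (subst T[symmetric]) (simp add: nn_integral_distr)
  also have "\<dots> = (\<integral>\<^sup>+ z. ennreal ((l / norm z) ^ (2 * CARD('n idx))) * indicator (T -` S) (inversion l z) \<partial>lborel)"
    by (simp add: nT JT card_idx indicator_vimage[symmetric] indicator_def)
  also have "\<dots> = emeasure lborel (T -` S)"
  proof (rule emeasure_inversion_wellorder[OF l])
    show "T -` S \<in> sets borel" using measurable_sets[of T borel borel S] by simp
    show "0 \<notin> T -` S" by (simp add: S_def T0)
    show "emeasure lborel (T -` S) < \<infinity>" using Sf TS by simp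
  qed
  also have "\<dots> = emeasure lborel (box a b)"
    unfolding TS by (unfold S_def, rule emeasure_Diff_null_set) auto
  finally show "emeasure (distr (density lborel ?J) borel (inversion l)) (box a b) = (\<Prod>k\<in>Basis. (b - a) \<bullet> k)"
    using le by simp
qed simp

lemma integrable_inversion_iff:
  fixes f :: "real ^ 'n \<Rightarrow> real"
  assumes l: "l > 0" and [measurable]: "f \<in> borel_measurable borel"
  shows "integrable lborel (\<lambda>z. (l / norm z) ^ (2 * CARD('n)) * f (inversion l z)) \<longleftrightarrow> integrable lborel f"
  by (subst (2) lborel_inversion[OF l, symmetric])
    (use l in \<open>simp add: integrable_distr_eq integrable_density\<close>)

lemma integral_inversion:
  fixes f :: "real ^ 'n \<Rightarrow> real"
  assumes l: "l > 0" and [measurable]: "f \<in> borel_measurable borel"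
  shows "(\<integral>z. (l / norm z) ^ (2 * CARD('n)) * f (inversion l z) \<partial>lborel) = integral\<^sup>L lborel f"
  by (subst (2) lborel_inversion[OF l, symmetric])
    (use l in \<open>simp add: integral_distr integral_density\<close>)

section \<open>Principal value integrals\<close>

abbreviation integrable_over :: "'a::euclidean_space set \<Rightarrow> ('a \<Rightarrow> real) \<Rightarrow> bool" where
  "integrable_over S g \<equiv> integrable lborel (\<lambda>y. indicator S y * g y)"

abbreviation integral_over :: "'a::euclidean_space set \<Rightarrow> ('a \<Rightarrow> real) \<Rightarrow> real" where
  "integral_over S g \<equiv> \<integral>y. indicator S y * g y \<partial>lborel"

text \<open>The integrand is arbitrary, not a difference quotient, because folded and transported
  integrands need principal values too.\<close>

definition pv_int :: "('a::euclidean_space \<Rightarrow> real) \<Rightarrow> 'a \<Rightarrow> real \<Rightarrow> bool" where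
  "pv_int g x L \<longleftrightarrow>
    (\<forall>\<epsilon>>0. integrable_over (- ball x \<epsilon>) g) \<and>
    ((\<lambda>\<epsilon>. integral_over (- ball x \<epsilon>) g) \<longlongrightarrow> L) (at_right 0)"

lemma pv_int_add:
  assumes "pv_int f x A" "pv_int g x B"
  shows "pv_int (\<lambda>y. f y + g y) x (A + B)"
proof -
  have f: "integrable_over (- ball x \<epsilon>) f"
    and g: "integrable_over (- ball x \<epsilon>) g" if "\<epsilon> > 0" for \<epsilon>
    using assms that by (auto simp: pv_int_def)
  show ?thesis unfolding pv_int_def
  proof (intro conjI allI impI)
    fix \<epsilon> :: real assume "\<epsilon> > 0"
    then show "integrable lborel (\<lambda>y. indicator (- ball x \<epsilon>) y * (f y + g y))"
      using f g by (simp add: distrib_left)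
  next
    have "((\<lambda>\<epsilon>. integral_over (- ball x \<epsilon>) f + integral_over (- ball x \<epsilon>) g)
      \<longlongrightarrow> A + B) (at_right 0)"
      using assms by (intro tendsto_add) (auto simp: pv_int_def)
    then show "((\<lambda>\<epsilon>. \<integral>y. indicator (- ball x \<epsilon>) y * (f y + g y) \<partial>lborel) \<longlongrightarrow> A + B) (at_right 0)"
      by (rule Lim_transform_eventually)
        (use f g in \<open>auto simp: eventually_at_right_field distrib_left intro!: exI[of _ 1]\<close>)
  qed
qed

lemma pv_int_cmult:
  assumes "pv_int f x A"
  shows "pv_int (\<lambda>y. c * f y) x (c * A)"
  using assms unfolding pv_int_def
  by (auto simp: mult.left_commute[of _ c] intro!: tendsto_mult)

lemma pv_int_cong:
  assumes "pv_int f x A" "\<And>y. y \<noteq> x \<Longrightarrow> f y = g y"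
  shows "pv_int g x A"
proof -
  have "(\<lambda>y. indicator (- ball x \<epsilon>) y * g y) = (\<lambda>y. indicator (- ball x \<epsilon>) y * f y)" if "\<epsilon> > 0" for \<epsilon>
  proof
    fix y show "indicator (- ball x \<epsilon>) y * g y = indicator (- ball x \<epsilon>) y * f y"
      using assms(2)[of y] that by (cases "y = x") auto
  qed
  then show ?thesis
    using assms(1) unfolding pv_int_def
    by (auto elim!: Lim_transform_eventually simp: eventually_at_right_field intro!: exI[of _ 1])
qed

locale fractional =
  fixes \<sigma> :: real and dim_type :: "'n::finite itself"
  assumes \<sigma>: "0 < \<sigma>" "\<sigma> < 1" and dim: "CARD('n) \<ge> 2"
begin

text \<open>\<open>ea\<close> is the decay exponent of the fundamental solution and of the Kelvin
  weight, \<open>eb\<close> the exponent of the singular kernel.\<close>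

definition ea :: real where "ea = real CARD('n) - 2 * \<sigma>"
definition eb :: real where "eb = real CARD('n) + 2 * \<sigma>"

lemma ea_pos: "ea > 0" and eb_pos: "eb > 0" and eb_gt_1: "eb > 1" and ea_eb: "ea + eb = 2 * real CARD('n)"
  using \<sigma> dim by (auto simp: ea_def eb_def)

text \<open>The two domains differ inside a shell of volume of order
  \<open>\<epsilon> ^ (n + 1)\<close>, with \<open>n\<close> the dimension, on which the integrand
  is at most of order \<open>\<epsilon> powr (1 - eb)\<close>. The product is of order
  \<open>\<epsilon> powr (2 - 2 * \<sigma>)\<close>, which tends to 0 because \<sigma> < 1.\<close>

lemma pv_domain_difference:
  fixes g :: "real^'n \<Rightarrow> real"
  assumes int: "\<And>\<epsilon>. \<epsilon> > 0 \<Longrightarrow> integrable_over (- ball x \<epsilon>) g"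
    and near: "d > 0" "\<And>y. y \<noteq> x \<Longrightarrow> dist x y < d \<Longrightarrow> \<bar>g y\<bar> \<le> M * dist x y powr (1 - eb)"
    and C: "C > 0" "\<rho> > 0" "e0 > 0"
    and E: "\<And>\<epsilon>. 0 < \<epsilon> \<Longrightarrow> \<epsilon> < e0 \<Longrightarrow> E \<epsilon> \<in> sets borel \<and>
      ball x (\<rho> * \<epsilon> * (1 - C * \<epsilon>)) \<subseteq> E \<epsilon> \<and> E \<epsilon> \<subseteq> ball x (\<rho> * \<epsilon> * (1 + C * \<epsilon>))"
  shows "((\<lambda>\<epsilon>. integral_over (- E \<epsilon>) g
      - integral_over (- ball x (\<rho> * \<epsilon> * (1 - C * \<epsilon>))) g) \<longlongrightarrow> 0) (at_right 0)"
proof (rule Lim_null_comparison)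
  let ?n = "CARD('n)"
  define r1 r2 where "r1 \<epsilon> = \<rho> * \<epsilon> * (1 - C * \<epsilon>)" and "r2 \<epsilon> = \<rho> * \<epsilon> * (1 + C * \<epsilon>)" for \<epsilon>
  define V where "V = unit_ball_vol (real ?n)"
  define B where "B \<epsilon> = \<bar>M\<bar> * r1 \<epsilon> powr (1 - eb) * (V * r2 \<epsilon> ^ ?n - V * r1 \<epsilon> ^ ?n)" for \<epsilon>
  have V: "V \<ge> 0" unfolding V_def by simp
  show "\<forall>\<^sub>F \<epsilon> in at_right 0. norm (integral_over (- E \<epsilon>) g
      - integral_over (- ball x (\<rho> * \<epsilon> * (1 - C * \<epsilon>))) g) \<le> B \<epsilon>"
    unfolding eventually_at_right_field
  proof (intro exI[of _ "min e0 (min (1 / C) (d / (2 * \<rho>)))"] conjI allI impI)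
    show "min e0 (min (1 / C) (d / (2 * \<rho>))) > 0" using C near by auto
    fix \<epsilon> :: real assume e: "0 < \<epsilon>" "\<epsilon> < min e0 (min (1 / C) (d / (2 * \<rho>)))"
    then have Ce: "C * \<epsilon> < 1" and re: "2 * \<rho> * \<epsilon> < d" using C by (auto simp: field_simps)
    have r1: "r1 \<epsilon> > 0" using e C Ce by (simp add: r1_def)
    have r12: "r1 \<epsilon> \<le> r2 \<epsilon>" using e C by (simp add: r1_def r2_def)
    have "r2 \<epsilon> \<le> \<rho> * \<epsilon> * 2" unfolding r2_def using e C Ce by (intro mult_left_mono) auto
    with re have r2: "r2 \<epsilon> < d" by simp
    have [measurable]: "E \<epsilon> \<in> sets borel" and E1: "ball x (r1 \<epsilon>) \<subseteq> E \<epsilon>" and E2: "E \<epsilon> \<subseteq> ball x (r2 \<epsilon>)"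
      using E[of \<epsilon>] e by (auto simp: r1_def r2_def)
    let ?b = "\<lambda>y. indicator (- ball x (r1 \<epsilon>)) y * g y"
    have ib: "integrable lborel ?b" using int r1 by simp
    have iE: "integrable_over (- E \<epsilon>) g"
    proof (rule Bochner_Integration.integrable_bound[OF ib])
      have "(\<lambda>y. indicator (- E \<epsilon>) y * ?b y) \<in> borel_measurable lborel"
        using ib by measurable
      moreover have "(\<lambda>y. indicator (- E \<epsilon>) y * ?b y) = (\<lambda>y. indicator (- E \<epsilon>) y * g y)"
        using E1 by (auto simp: fun_eq_iff indicator_def)
      ultimately show "(\<lambda>y. indicator (- E \<epsilon>) y * g y) \<in> borel_measurable lborel" by simp
    qed (use E1 in \<open>auto simp: indicator_def subset_eq\<close>)
    let ?A = "ball x (r2 \<epsilon>) - ball x (r1 \<epsilon>)"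
    have "norm (integral_over (- E \<epsilon>) g - (\<integral>y. ?b y \<partial>lborel))
        = norm (\<integral>y. indicator (- E \<epsilon>) y * g y - ?b y \<partial>lborel)"
      using ib iE by simp
    also have "\<dots> \<le> (\<integral>y. \<bar>M\<bar> * r1 \<epsilon> powr (1 - eb) * indicator ?A y \<partial>lborel)"
    proof (rule Bochner_Integration.integral_norm_bound_integral)
      show "integrable lborel (\<lambda>y. indicator (- E \<epsilon>) y * g y - ?b y)" using ib iE by simp
      have "emeasure lborel ?A < \<infinity>"
        using emeasure_mono[of ?A "ball x (r2 \<epsilon>)" lborel] emeasure_lborel_ball_finite[of x "r2 \<epsilon>"]
        by (simp add: order_le_less_trans)
      then show "integrable lborel (\<lambda>y. \<bar>M\<bar> * r1 \<epsilon> powr (1 - eb) * indicator ?A y)"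
        by (intro integrable_mult_right integrable_real_indicator) auto
      fix y
      show "norm (indicator (- E \<epsilon>) y * g y - ?b y) \<le> \<bar>M\<bar> * r1 \<epsilon> powr (1 - eb) * indicator ?A y"
      proof (cases "y \<in> E \<epsilon> - ball x (r1 \<epsilon>)")
        case True
        then have y: "r1 \<epsilon> \<le> dist x y" "dist x y < r2 \<epsilon>" using E2 by auto
        have "\<bar>g y\<bar> \<le> M * dist x y powr (1 - eb)"
          by (rule near) (use y r1 r2 in auto)
        also have "\<dots> \<le> \<bar>M\<bar> * dist x y powr (1 - eb)" by (intro mult_right_mono) auto
        also have "\<dots> \<le> \<bar>M\<bar> * r1 \<epsilon> powr (1 - eb)"
          using eb_gt_1 r1 y by (intro mult_left_mono powr_mono2') auto
        finally show ?thesis using True y by (auto simp: indicator_def)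
      next
        case False
        then have "indicator (- E \<epsilon>) y * g y - ?b y = 0" using E1 by (auto simp: indicator_def)
        then show ?thesis by (simp only: norm_zero) auto
      qed
    qed
    also have "\<dots> = \<bar>M\<bar> * r1 \<epsilon> powr (1 - eb) * measure lborel ?A" by simp
    also have "measure lborel ?A = V * r2 \<epsilon> ^ ?n - V * r1 \<epsilon> ^ ?n"
      using r1 r12 emeasure_lborel_ball_finite[of x "r2 \<epsilon>"]
      by (subst measure_Diff) (auto simp: content_ball V_def)
    finally show "norm (integral_over (- E \<epsilon>) g
      - integral_over (- ball x (\<rho> * \<epsilon> * (1 - C * \<epsilon>))) g) \<le> B \<epsilon>"
      unfolding B_def r1_def .
  qed
  \<comment> \<open>\<open>Q\<close> is the normalised volume of the shell. It vanishes at 0, so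
    \<open>Q \<epsilon> / \<epsilon>\<close> tends to its derivative there; this is the gain of one
    power.\<close>
  define Q where "Q \<epsilon> = (1 + C * \<epsilon>) ^ ?n - (1 - C * \<epsilon>) ^ ?n" for \<epsilon>
  have "(Q has_real_derivative real ?n * (1 + C * 0) ^ (?n - 1) * C - real ?n * (1 - C * 0) ^ (?n - 1) * (- C)) (at 0)"
    unfolding Q_def by (auto intro!: derivative_eq_intros)
  then have "((\<lambda>\<epsilon>. (Q (0 + \<epsilon>) - Q 0) / \<epsilon>) \<longlongrightarrow>
      real ?n * (1 + C * 0) ^ (?n - 1) * C - real ?n * (1 - C * 0) ^ (?n - 1) * (- C)) (at 0)"
    unfolding DERIV_def .
  then have "((\<lambda>\<epsilon>. Q \<epsilon> / \<epsilon>) \<longlongrightarrow> 2 * real ?n * C) (at 0)"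
    by (simp add: Q_def mult_ac)
  then have Q: "((\<lambda>\<epsilon>. Q \<epsilon> / \<epsilon>) \<longlongrightarrow> 2 * real ?n * C) (at_right 0)"
    by (rule filterlim_mono) (auto intro: at_le)
  have P: "((\<lambda>\<epsilon>::real. \<epsilon> powr (2 - 2 * \<sigma>)) \<longlongrightarrow> 0) (at_right 0)"
    using \<sigma> by real_asymp
  have R: "((\<lambda>\<epsilon>. (1 - C * \<epsilon>) powr (1 - eb)) \<longlongrightarrow> (1 - C * 0) powr (1 - eb)) (at_right 0)"
    by (intro tendsto_intros) auto
  have "((\<lambda>\<epsilon>. (\<bar>M\<bar> * V * \<rho> powr (1 - 2 * \<sigma>)) * ((1 - C * \<epsilon>) powr (1 - eb) * (Q \<epsilon> / \<epsilon>) * \<epsilon> powr (2 - 2 * \<sigma>)))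
      \<longlongrightarrow> (\<bar>M\<bar> * V * \<rho> powr (1 - 2 * \<sigma>)) * ((1 - C * 0) powr (1 - eb) * (2 * real ?n * C) * 0)) (at_right 0)"
    by (intro tendsto_mult tendsto_const Q P R)
  then have "((\<lambda>\<epsilon>. (\<bar>M\<bar> * V * \<rho> powr (1 - 2 * \<sigma>)) * ((1 - C * \<epsilon>) powr (1 - eb) * (Q \<epsilon> / \<epsilon>) * \<epsilon> powr (2 - 2 * \<sigma>)))
      \<longlongrightarrow> 0) (at_right 0)" by simp
  then show "(B \<longlongrightarrow> 0) (at_right 0)"
  proof (rule Lim_transform_eventually)
    show "\<forall>\<^sub>F \<epsilon> in at_right 0. (\<bar>M\<bar> * V * \<rho> powr (1 - 2 * \<sigma>)) * ((1 - C * \<epsilon>) powr (1 - eb) * (Q \<epsilon> / \<epsilon>) * \<epsilon> powr (2 - 2 * \<sigma>)) = B \<epsilon>"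
      unfolding eventually_at_right_field
    proof (intro exI[of _ "1 / C"] conjI allI impI)
      show "1 / C > 0" using C by simp
      fix \<epsilon> :: real assume e: "0 < \<epsilon>" "\<epsilon> < 1 / C"
      then have Ce: "C * \<epsilon> < 1" using C by (auto simp: field_simps)
      have p: "(\<rho> * \<epsilon>) powr (1 - eb) * (\<rho> * \<epsilon>) ^ ?n = \<rho> powr (1 - 2 * \<sigma>) * \<epsilon> powr (2 - 2 * \<sigma>) / \<epsilon>"
      proof -
        have "(\<rho> * \<epsilon>) powr (1 - eb) * (\<rho> * \<epsilon>) ^ ?n = (\<rho> * \<epsilon>) powr (1 - 2 * \<sigma>)"
          using C e by (simp add: powr_realpow[symmetric] powr_add[symmetric] eb_def)
        also have "\<dots> = \<rho> powr (1 - 2 * \<sigma>) * \<epsilon> powr ((2 - 2 * \<sigma>) - 1)"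
          using C e by (simp add: powr_mult)
        also have "\<epsilon> powr ((2 - 2 * \<sigma>) - 1) = \<epsilon> powr (2 - 2 * \<sigma>) / \<epsilon>"
          using e by (subst powr_diff) simp
        finally show ?thesis by simp
      qed
      have "B \<epsilon> = \<bar>M\<bar> * V * ((\<rho> * \<epsilon>) powr (1 - eb) * (\<rho> * \<epsilon>) ^ ?n) * ((1 - C * \<epsilon>) powr (1 - eb) * Q \<epsilon>)"
      proof -
        have pm: "(\<rho> * \<epsilon> * (1 - C * \<epsilon>)) powr (1 - eb) = (\<rho> * \<epsilon>) powr (1 - eb) * (1 - C * \<epsilon>) powr (1 - eb)"
          by (rule powr_mult)
        show ?thesis
          unfolding B_def r1_def r2_def Q_def power_mult_distrib[of "\<rho> * \<epsilon>"] pm by algebra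
      qed
      also have "\<dots> = (\<bar>M\<bar> * V * \<rho> powr (1 - 2 * \<sigma>)) * ((1 - C * \<epsilon>) powr (1 - eb) * (Q \<epsilon> / \<epsilon>) * \<epsilon> powr (2 - 2 * \<sigma>))"
        unfolding p by simp
      finally show "(\<bar>M\<bar> * V * \<rho> powr (1 - 2 * \<sigma>)) * ((1 - C * \<epsilon>) powr (1 - eb) * (Q \<epsilon> / \<epsilon>) * \<epsilon> powr (2 - 2 * \<sigma>)) = B \<epsilon>" ..
    qed
  qed
qed

end

text \<open>The preimage is a ball, but not centred at \<open>inversion l x\<close>. To first order
  its radius is \<epsilon> times the conformal factor \<rho> at \<open>x\<close>, and the constant
  \<open>C\<close> bounds the relative error.\<close>

lemma inversion_vimage_ball:
  fixes x :: "'a::euclidean_space"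
  assumes l: "l > 0" and x: "x \<noteq> 0" and e: "0 < \<epsilon>" "\<epsilon> < norm x / 2"
  defines "\<rho> \<equiv> (l / norm x)\<^sup>2" and "C \<equiv> 2 / norm x"
  shows "ball (inversion l x) (\<rho> * \<epsilon> * (1 - C * \<epsilon>)) \<subseteq> inversion l -` ball x \<epsilon>"
    and "inversion l -` ball x \<epsilon> \<subseteq> ball (inversion l x) (\<rho> * \<epsilon> * (1 + C * \<epsilon>))"
proof -
  let ?m = "norm x" and ?X = "inversion l x"
  have m: "?m > 0" using x by simp
  have rho: "\<rho> > 0" using l m by (simp add: \<rho>_def)
  have X0: "?X \<noteq> 0" using l x by (simp add: inversion_eq_0_iff)
  have nX: "norm ?X = \<rho> * ?m" using m by (simp add: norm_inversion \<rho>_def power2_eq_square)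
  show "ball ?X (\<rho> * \<epsilon> * (1 - C * \<epsilon>)) \<subseteq> inversion l -` ball x \<epsilon>"
  proof
    fix z assume "z \<in> ball ?X (\<rho> * \<epsilon> * (1 - C * \<epsilon>))"
    then have d: "norm (?X - z) < \<rho> * \<epsilon> * (1 - C * \<epsilon>)" by (simp add: dist_norm)
    have e1: "\<epsilon> * (1 - C * \<epsilon>) * (?m + \<epsilon>) \<le> \<epsilon> * ?m"
    proof -
      have "(1 - C * \<epsilon>) * (?m + \<epsilon>) = ?m - \<epsilon> - 2 * \<epsilon>\<^sup>2 / ?m"
        using m by (simp add: C_def field_simps power2_eq_square)
      also have "\<dots> \<le> ?m"
        using e divide_nonneg_nonneg[of "2 * \<epsilon>\<^sup>2" ?m]
        by (simp only: diff_le_eq) (simp add: add_increasing2)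
      finally show ?thesis using e by (simp add: mult.assoc)
    qed
    have "norm (?X - z) * (?m + \<epsilon>) < \<rho> * \<epsilon> * (1 - C * \<epsilon>) * (?m + \<epsilon>)"
      using d m e by (intro mult_strict_right_mono) auto
    also have "\<dots> \<le> \<rho> * (\<epsilon> * ?m)" using e1 rho by (simp add: mult.assoc)
    finally have d2: "norm (?X - z) * ?m < \<epsilon> * (\<rho> * ?m - norm (?X - z))" by (simp add: algebra_simps)
    have nz: "\<rho> * ?m - norm (?X - z) \<le> norm z" using norm_triangle_ineq2[of ?X z] nX
      by (smt (verit) norm_triangle_ineq3)
    have "0 \<le> norm (?X - z) * ?m" by simp
    with d2 have "0 < \<epsilon> * (\<rho> * ?m - norm (?X - z))" by linarith
    then have nz0: "0 < \<rho> * ?m - norm (?X - z)" using e by (simp add: zero_less_mult_iff)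
    then have z0: "z \<noteq> 0" using nz by auto
    have "norm (x - inversion l z) = norm (inversion l ?X - inversion l z)"
      using l x by (simp add: inversion_inversion)
    also have "\<dots> = l\<^sup>2 * norm (?X - z) / (norm ?X * norm z)" by (rule norm_inversion_diff[OF X0 z0])
    also have "\<dots> = ?m * norm (?X - z) / norm z"
      unfolding nX using l m by (simp add: \<rho>_def power2_eq_square)
    also have "\<dots> \<le> ?m * norm (?X - z) / (\<rho> * ?m - norm (?X - z))"
      using nz nz0 z0 by (intro divide_left_mono) auto
    also have "\<dots> < \<epsilon>" using d2 nz0 by (simp add: field_simps)
    finally show "z \<in> inversion l -` ball x \<epsilon>" by (simp add: dist_norm)
  qed
  show "inversion l -` ball x \<epsilon> \<subseteq> ball ?X (\<rho> * \<epsilon> * (1 + C * \<epsilon>))"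
  proof
    fix z assume "z \<in> inversion l -` ball x \<epsilon>"
    then have s: "norm (x - inversion l z) < \<epsilon>" by (simp add: dist_norm)
    define y where "y = inversion l z"
    have ny: "?m - \<epsilon> < norm y" using s norm_triangle_ineq2[of x y] by (simp add: y_def)
    then have y0: "y \<noteq> 0" using e by auto
    then have z0: "z \<noteq> 0" by (auto simp: y_def inversion_def)
    have z: "z = inversion l y" using l z0 by (simp add: y_def inversion_inversion)
    have "norm (?X - z) = l\<^sup>2 * norm (x - y) / (?m * norm y)"
      unfolding z by (rule norm_inversion_diff[OF x y0])
    also have "\<dots> \<le> l\<^sup>2 * norm (x - y) / (?m * (?m - \<epsilon>))"
      using ny m e by (intro divide_left_mono mult_left_mono mult_pos_pos) auto
    also have "\<dots> < l\<^sup>2 * \<epsilon> / (?m * (?m - \<epsilon>))"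
      using s m e l by (intro divide_strict_right_mono mult_strict_left_mono) (auto simp: y_def)
    also have "\<dots> \<le> \<rho> * \<epsilon> * (1 + C * \<epsilon>)"
    proof -
      have "?m * ?m \<le> (?m + 2 * \<epsilon>) * (?m - \<epsilon>)"
        using mult_left_mono[of "2 * \<epsilon>" ?m \<epsilon>] e by (simp add: algebra_simps)
      then have "1 / (?m * (?m - \<epsilon>)) \<le> (1 + C * \<epsilon>) / ?m\<^sup>2"
        using m e by (simp add: C_def field_simps power2_eq_square)
      from mult_left_mono[OF this, of "l\<^sup>2 * \<epsilon>"] show ?thesis
        using l e by (simp add: \<rho>_def power_divide mult_ac)
    qed
    finally show "z \<in> ball ?X (\<rho> * \<epsilon> * (1 + C * \<epsilon>))" by (simp add: dist_norm)
  qed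
qed

section \<open>The Riesz kernel and the Kelvin transform\<close>

lemma lborel_translation: "distr lborel borel (\<lambda>y. x + y) = (lborel :: 'a::euclidean_space measure)"
  using lborel_affine[of 1 x] by (simp add: density_1)

lemma integrable_translation_iff:
  fixes f :: "'a::euclidean_space \<Rightarrow> real"
  assumes [measurable]: "f \<in> borel_measurable borel"
  shows "integrable lborel (\<lambda>y. f (x + y)) \<longleftrightarrow> integrable lborel f"
  by (subst (2) lborel_translation[of x, symmetric]) (simp add: integrable_distr_eq)

lemma integral_translation:
  fixes f :: "'a::euclidean_space \<Rightarrow> real"
  assumes [measurable]: "f \<in> borel_measurable borel"
  shows "(\<integral>y. f (x + y) \<partial>lborel) = integral\<^sup>L lborel f"
  by (subst (2) lborel_translation[of x, symmetric]) (simp add: integral_distr)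

definition lip_at :: "('a::metric_space \<Rightarrow> real) \<Rightarrow> 'a \<Rightarrow> bool" where
  "lip_at w x \<longleftrightarrow> (\<exists>M d. d > 0 \<and> (\<forall>y. dist x y < d \<longrightarrow> \<bar>w x - w y\<bar> \<le> M * dist x y))"

lemma lip_at_add:
  assumes "lip_at f x" "lip_at g x"
  shows "lip_at (\<lambda>y. f y + g y) x"
proof -
  obtain M d where d: "d > 0" and f: "\<And>y. dist x y < d \<Longrightarrow> \<bar>f x - f y\<bar> \<le> M * dist x y"
    using assms(1) unfolding lip_at_def by blast
  obtain N e where e: "e > 0" and g: "\<And>y. dist x y < e \<Longrightarrow> \<bar>g x - g y\<bar> \<le> N * dist x y"
    using assms(2) unfolding lip_at_def by blast
  have "\<bar>f x + g x - (f y + g y)\<bar> \<le> (M + N) * dist x y" if "dist x y < min d e" for y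
    using f[of y] g[of y] that by (simp add: distrib_right)
  then show ?thesis
    unfolding lip_at_def using d e by (metis min_less_iff_conj)
qed

lemma lip_at_cmult:
  assumes "lip_at f x"
  shows "lip_at (\<lambda>y. c * f y) x"
proof -
  obtain M d where d: "d > 0" and f: "\<And>y. dist x y < d \<Longrightarrow> \<bar>f x - f y\<bar> \<le> M * dist x y"
    using assms(1) unfolding lip_at_def by blast
  have "\<bar>c * f x - c * f y\<bar> \<le> \<bar>c\<bar> * M * dist x y" if "dist x y < d" for y
    using mult_left_mono[OF f[OF that], of "\<bar>c\<bar>"] by (simp add: abs_mult mult.assoc flip: right_diff_distrib)
  then show ?thesis unfolding lip_at_def using d by blast
qed

lemma has_derivative_imp_lip_at:
  fixes f :: "'a::real_normed_vector \<Rightarrow> real"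
  assumes "(f has_derivative f') (at x)"
  shows "lip_at f x"
proof -
  have bl: "bounded_linear f'" using assms by (rule has_derivative_bounded_linear)
  then obtain B where B: "\<And>h. norm (f' h) \<le> norm h * B" using bounded_linear.bounded by blast
  obtain d where d: "d > 0" "\<And>y. norm (y - x) < d \<Longrightarrow> norm (f y - f x - f' (y - x)) \<le> 1 * norm (y - x)"
    using assms unfolding has_derivative_at_alt by (metis zero_less_one)
  show ?thesis unfolding lip_at_def
  proof (rule exI[of _ "B + 1"], rule exI[of _ d], intro conjI allI impI)
    fix y assume "dist x y < d"
    then have "norm (f y - f x - f' (y - x)) \<le> norm (y - x)" using d(2)[of y] by (simp add: dist_norm norm_minus_commute)
    moreover have "norm (f' (y - x)) \<le> norm (y - x) * B" by (rule B)
    ultimately have "\<bar>f x - f y\<bar> \<le> norm (y - x) + norm (y - x) * B" unfolding real_norm_def by linarith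
    then show "\<bar>f x - f y\<bar> \<le> (B + 1) * dist x y"
      by (simp add: dist_norm norm_minus_commute[of x y] algebra_simps)
  qed fact
qed

context fractional
begin

text \<open>On the dyadic shell of radii \<open>r * 2 ^ k\<close> to \<open>r * 2 ^ Suc k\<close>
  the kernel is at most \<open>c k\<close>, and the enclosing ball has a volume proportional to
  \<open>(r * 2 ^ k) ^ CARD('n)\<close>. The bounds form a geometric series of ratio
  \<open>2 powr (- 2 * \<sigma>)\<close>.\<close>

lemma integrable_powr_tail_0:
  assumes r: "r > 0"
  shows "integrable lborel (\<lambda>z::real^'n. indicator (- ball 0 r) z / norm z powr eb)"
proof (rule integrableI_bounded)
  let ?n = "CARD('n)"
  define V where "V = unit_ball_vol (real ?n)"
  have V: "V \<ge> 0" unfolding V_def by simp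
  define c where "c k = (r * 2 ^ k) powr - eb" for k :: nat
  have c0: "c k \<ge> 0" for k by (simp add: c_def)
  have "(\<integral>\<^sup>+ (z::real^'n). ennreal (norm (indicator (- ball 0 r) z / norm z powr eb)) \<partial>lborel)
      \<le> (\<integral>\<^sup>+ z. (\<Sum>k. ennreal (c k) * indicator (ball (0::real^'n) (r * 2 ^ Suc k)) z) \<partial>lborel)"
  proof (rule nn_integral_mono)
    fix z :: "real^'n"
    show "ennreal (norm (indicator (- ball 0 r) z / norm z powr eb))
        \<le> (\<Sum>k. ennreal (c k) * indicator (ball (0::real^'n) (r * 2 ^ Suc k)) z)"
    proof (cases "norm z < r")
      case False
      then have z: "1 \<le> norm z / r" using r by simp
      define k where "k = nat \<lfloor>log 2 (norm z / r)\<rfloor>"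
      have lg: "log 2 (norm z / r) \<ge> 0" using z by simp
      have k1: "real k \<le> log 2 (norm z / r)" and k2: "log 2 (norm z / r) < real k + 1"
        using lg by (auto simp: k_def)
      have p1: "2 ^ k \<le> norm z / r"
        using k1 z powr_le_cancel_iff[of 2 "real k" "log 2 (norm z / r)"] by (simp add: powr_realpow)
      have p2: "norm z / r < 2 ^ Suc k"
        using k2 z powr_less_cancel_iff[of 2 "log 2 (norm z / r)" "real (Suc k)"]
        by (simp add: powr_realpow[symmetric] del: power_Suc powr_less_cancel_iff)
      have "1 / norm z powr eb = norm z powr - eb" by (simp add: powr_minus_divide)
      also have "\<dots> \<le> c k" unfolding c_def
        using p1 r eb_pos by (intro powr_mono2') (auto simp: field_simps)
      finally have "ennreal (norm (indicator (- ball 0 r) z / norm z powr eb)) \<le> ennreal (c k)"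
        using False by (intro ennreal_leI) (simp add: indicator_def)
      also have "\<dots> = ennreal (c k) * indicator (ball (0::real^'n) (r * 2 ^ Suc k)) z"
        using p2 r by (simp add: indicator_def field_simps)
      also have "\<dots> = (\<Sum>j\<in>{k}. ennreal (c j) * indicator (ball (0::real^'n) (r * 2 ^ Suc j)) z)"
        by (subst sum.insert) (simp_all only: finite.emptyI empty_iff not_False_eq_True sum.empty add_0_right)
      also have "\<dots> \<le> (\<Sum>j. ennreal (c j) * indicator (ball (0::real^'n) (r * 2 ^ Suc j)) z)"
        by (rule sum_le_suminf) auto
      finally show ?thesis .
    qed (auto simp: indicator_def)
  qed
  also have "\<dots> = (\<Sum>k. \<integral>\<^sup>+ z. ennreal (c k) * indicator (ball (0::real^'n) (r * 2 ^ Suc k)) z \<partial>lborel)"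
    by (rule nn_integral_suminf) (auto intro!: borel_measurable_times_ennreal borel_measurable_indicator)
  also have "\<dots> = (\<Sum>k. ennreal (V * 2 ^ ?n * r powr (- 2 * \<sigma>) * (2 powr (- 2 * \<sigma>)) ^ k))"
  proof (rule suminf_cong)
    fix k
    have "(\<integral>\<^sup>+ z. ennreal (c k) * indicator (ball (0::real^'n) (r * 2 ^ Suc k)) z \<partial>lborel)
        = ennreal (c k) * emeasure lborel (ball (0::real^'n) (r * 2 ^ Suc k))"
      by (rule nn_integral_cmult_indicator) simp
    also have "\<dots> = ennreal (c k * (V * (r * 2 ^ Suc k) ^ ?n))"
      using r V c0 by (subst emeasure_ball) (auto simp: V_def ennreal_mult)
    also have "c k * (V * (r * 2 ^ Suc k) ^ ?n) = V * 2 ^ ?n * (c k * (r * 2 ^ k) ^ ?n)"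
      by (simp add: power_mult_distrib mult_ac)
    also have "c k * (r * 2 ^ k) ^ ?n = (r * 2 ^ k) powr (- 2 * \<sigma>)"
      unfolding c_def using r by (subst powr_realpow[symmetric]) (auto simp: powr_add[symmetric] eb_def)
    also have "\<dots> = r powr (- 2 * \<sigma>) * (2 powr (- 2 * \<sigma>)) ^ k"
      using r by (simp add: powr_mult powr_realpow[symmetric] powr_powr mult.commute)
    finally show "(\<integral>\<^sup>+ z. ennreal (c k) * indicator (ball (0::real^'n) (r * 2 ^ Suc k)) z \<partial>lborel)
        = ennreal (V * 2 ^ ?n * r powr (- 2 * \<sigma>) * (2 powr (- 2 * \<sigma>)) ^ k)" by (simp add: mult.assoc)
  qed
  also have "\<dots> < \<infinity>"
  proof -
    have "2 powr (- 2 * \<sigma>) < 2 powr 0" using \<sigma> by (intro powr_less_mono) auto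
    then have "summable (\<lambda>k. V * 2 ^ ?n * r powr (- 2 * \<sigma>) * (2 powr (- 2 * \<sigma>)) ^ k)"
      by (intro summable_mult summable_geometric) auto
    then show ?thesis using V by (subst suminf_ennreal2) auto
  qed
  finally show "(\<integral>\<^sup>+ (z::real^'n). ennreal (norm (indicator (- ball 0 r) z / norm z powr eb)) \<partial>lborel) < \<infinity>" .
qed measurable

lemma integrable_powr_tail:
  assumes r: "r > 0"
  shows "integrable lborel (\<lambda>y::real^'n. indicator (- ball x r) y / norm (x - y) powr eb)"
proof -
  have "integrable lborel (\<lambda>y::real^'n. indicator (- ball 0 r) ((-x) + y) / norm ((-x) + y) powr eb)"
    using integrable_powr_tail_0[OF r] by (subst integrable_translation_iff) measurable
  then show ?thesis
    by (simp add: indicator_def dist_norm norm_minus_commute)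
qed

text \<open>The fractional Laplacian up to the factor \<open>frac_const\<close>.\<close>

definition flap :: "(real^'n \<Rightarrow> real) \<Rightarrow> real^'n \<Rightarrow> real \<Rightarrow> bool" where
  "flap w x L \<longleftrightarrow> pv_int (\<lambda>y. (w x - w y) / norm (x - y) powr eb) x L"

lemma flap_add: "flap f x A \<Longrightarrow> flap g x B \<Longrightarrow> flap (\<lambda>y. f y + g y) x (A + B)"
  unfolding flap_def by (drule (1) pv_int_add) (simp add: add_divide_distrib[symmetric] algebra_simps)

lemma flap_cmult: "flap f x A \<Longrightarrow> flap (\<lambda>y. c * f y) x (c * A)"
  unfolding flap_def by (drule pv_int_cmult[of _ _ _ c]) (simp add: right_diff_distrib)

lemma flap_near:
  assumes "lip_at w x"
  obtains d M where "d > 0"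
    "\<And>y. y \<noteq> x \<Longrightarrow> dist x y < d \<Longrightarrow> \<bar>(w x - w y) / norm (x - y) powr eb\<bar> \<le> M * dist x y powr (1 - eb)"
proof -
  obtain M d where d: "d > 0" "\<And>y. dist x y < d \<Longrightarrow> \<bar>w x - w y\<bar> \<le> M * dist x y"
    using assms unfolding lip_at_def by blast
  show ?thesis
  proof (rule that[of d M])
    fix y assume y: "y \<noteq> x" "dist x y < d"
    have "\<bar>(w x - w y) / norm (x - y) powr eb\<bar> = \<bar>w x - w y\<bar> / dist x y powr eb" by (simp add: dist_norm)
    also have "\<dots> \<le> M * dist x y / dist x y powr eb" using d(2)[OF y(2)] by (intro divide_right_mono) auto
    also have "\<dots> = M * dist x y powr (1 - eb)" using y by (simp add: powr_diff)
    finally show "\<bar>(w x - w y) / norm (x - y) powr eb\<bar> \<le> M * dist x y powr (1 - eb)" .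
  qed fact
qed

text \<open>Up to a factor this is the fundamental solution of the operator, and also the Kelvin
  transform of the constant 1. At the origin \<open>powr\<close> gives it the value 0.\<close>

definition riesz :: "real^'n \<Rightarrow> real" where "riesz z = norm z powr - ea"

lemma lip_at_riesz: "x \<noteq> 0 \<Longrightarrow> lip_at riesz x"
proof -
  assume x: "x \<noteq> 0"
  have eq: "riesz = (\<lambda>z. (z \<bullet> z) powr (- ea / 2))"
  proof
    fix z :: "real^'n"
    have "(z \<bullet> z) powr (- ea / 2) = (norm z powr 2) powr (- ea / 2)"
      by (simp add: dot_square_norm)
    then show "riesz z = (z \<bullet> z) powr (- ea / 2)" unfolding powr_powr by (simp add: riesz_def)
  qed
  have "(\<lambda>z::real^'n. (z \<bullet> z) powr (- ea / 2)) differentiable (at x)"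
    using x by (intro differentiableI[OF has_derivative_powr[OF has_derivative_inner[OF has_derivative_ident has_derivative_ident] has_derivative_const]]) auto
  then show ?thesis unfolding eq differentiable_def using has_derivative_imp_lip_at by blast
qed

definition kelvin :: "real \<Rightarrow> (real^'n \<Rightarrow> real) \<Rightarrow> real^'n \<Rightarrow> real" where
  "kelvin l u y = (l / norm y) powr ea * u (inversion l y)"

lemma kelvin_kelvin: "l > 0 \<Longrightarrow> y \<noteq> 0 \<Longrightarrow> kelvin l (kelvin l u) y = u y"
  by (simp add: kelvin_def inversion_inversion norm_inversion powr_mult[symmetric] power2_eq_square flip: mult.assoc)

text \<open>The term with the Riesz kernel is what separates the Kelvin transform from a plain change of
  variables; its principal value integral vanishes.\<close>

lemma kelvin_integrand:
  fixes u :: "real^'n \<Rightarrow> real"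
  assumes l: "l > 0" and x: "x \<noteq> 0" and z: "z \<noteq> 0"
  defines "w \<equiv> (\<lambda>y. u y + (- u (inversion l x) * norm (inversion l x) powr ea) * riesz y)"
  shows "(l / norm z) ^ (2 * CARD('n)) * ((kelvin l u x - kelvin l u (inversion l z)) / norm (x - inversion l z) powr eb)
    = (l / norm x) powr eb * ((w (inversion l x) - w z) / norm (inversion l x - z) powr eb)"
proof -
  define m t D A B where "m = norm x" and "t = norm z" and "D = norm (inversion l x - z)"
    and "A = u (inversion l x)" and "B = u z"
  have pos: "m > 0" "t > 0" "D \<ge> 0" using x z by (auto simp: m_def t_def D_def)
  have X0: "inversion l x \<noteq> 0" using l x by (simp add: inversion_eq_0_iff)
  have nX: "norm (inversion l x) = l\<^sup>2 / m" and nZ: "norm (inversion l z) = l\<^sup>2 / t"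
    by (simp_all add: norm_inversion m_def t_def)
  have "norm (x - inversion l z) = norm (inversion l (inversion l x) - inversion l z)"
    using l x by (simp add: inversion_inversion)
  also have "\<dots> = l\<^sup>2 * D / ((l\<^sup>2 / m) * t)"
    unfolding norm_inversion_diff[OF X0 z] D_def[symmetric] nX t_def[symmetric] ..
  also have "\<dots> = m * D / t" using l pos by (simp add: field_simps)
  finally have d: "norm (x - inversion l z) = m * D / t" .
  have k1: "kelvin l u x = (l / m) powr ea * A" by (simp add: kelvin_def m_def A_def)
  have k2: "kelvin l u (inversion l z) = (t / l) powr ea * B"
    using l z pos by (simp add: kelvin_def inversion_inversion nZ B_def power2_eq_square)
  \<comment> \<open>The coefficient of \<open>riesz\<close> in \<open>w\<close> makes
    \<open>w\<close> vanish at \<open>inversion l x\<close>.\<close>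
  have w: "w (inversion l x) - w z = A * (l\<^sup>2 / m) powr ea * t powr - ea - B"
    using l pos by (simp add: w_def riesz_def nX powr_minus A_def[symmetric] B_def[symmetric] t_def[symmetric] algebra_simps)
  have jac: "(l / t) ^ (2 * CARD('n)) = (l powr ea * l powr eb) / (t powr ea * t powr eb)"
    using l pos ea_eb by (simp add: powr_realpow[symmetric] powr_divide powr_add[symmetric])
  \<comment> \<open>With the powers replaced by positive unknowns the claim is an identity of
    rational functions.\<close>
  define la lb ma mb ta tb E where "la = l powr ea" and "lb = l powr eb" and "ma = m powr ea"
    and "mb = m powr eb" and "ta = t powr ea" and "tb = t powr eb" and "E = D powr eb"
  have P: "la > 0" "lb > 0" "ma > 0" "mb > 0" "ta > 0" "tb > 0"
    using l pos by (auto simp: la_def lb_def ma_def mb_def ta_def tb_def)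
  have "(la / ma) * A - (ta / la) * B = (ta / la) * (A * (la * la / ma) * (1 / ta) - B)"
    using P by (simp add: field_simps)
  then have "(la * lb) / (ta * tb) * (((la / ma) * A - (ta / la) * B) / (mb * E / tb))
      = lb / mb * ((A * (la * la / ma) * (1 / ta) - B) / E)"
    using P by simp
  moreover have "(m * D / t) powr eb = mb * E / tb" "(l\<^sup>2 / m) powr ea = la * la / ma" "t powr - ea = 1 / ta"
    by (simp_all add: powr_divide powr_mult powr_minus_divide power2_eq_square mb_def E_def tb_def la_def ma_def ta_def)
  ultimately show ?thesis
    unfolding k1 k2 d w jac t_def[symmetric] m_def[symmetric] D_def[symmetric] powr_divide
    by (simp only: la_def lb_def ma_def mb_def ta_def tb_def E_def)
qed

lemma vimage_inversion_borel [measurable, intro]: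
  "S \<in> sets borel \<Longrightarrow> inversion l -` S \<in> sets (borel :: (real^'n) measure)"
  using measurable_sets[OF borel_measurable_inversion, of S l] by simp

lemma transport_integral:
  fixes f g :: "real^'n \<Rightarrow> real"
  assumes l: "l > 0" and c: "c \<noteq> 0"
    and [measurable]: "f \<in> borel_measurable borel" "g \<in> borel_measurable borel" "S \<in> sets borel"
    and tr: "\<And>z. z \<noteq> 0 \<Longrightarrow> (l / norm z) ^ (2 * CARD('n)) * f (inversion l z) = c * g z"
  shows "integrable_over S f \<longleftrightarrow> integrable_over (inversion l -` S) g"
    and "integral_over S f = c * integral_over (inversion l -` S) g"
proof -
  have ae: "AE z in lborel. (l / norm z) ^ (2 * CARD('n)) * (indicator S (inversion l z) * f (inversion l z))
      = c * (indicator (inversion l -` S) z * g z)"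
  proof -
    have "AE z::real^'n in lborel. z \<noteq> 0" by (rule AE_lborel_singleton)
    then show ?thesis
      by eventually_elim (use tr in \<open>auto simp: indicator_def\<close>)
  qed
  have "integrable_over S f \<longleftrightarrow>
      integrable lborel (\<lambda>z. (l / norm z) ^ (2 * CARD('n)) * (indicator S (inversion l z) * f (inversion l z)))"
    by (subst integrable_inversion_iff[OF l, of "\<lambda>y. indicator S y * f y"]) measurable
  also have "\<dots> \<longleftrightarrow> integrable lborel (\<lambda>z. c * (indicator (inversion l -` S) z * g z))"
    by (rule integrable_cong_AE) (use ae in measurable)
  also have "\<dots> \<longleftrightarrow> integrable_over (inversion l -` S) g"
    using c by simp
  finally show "integrable_over S f \<longleftrightarrow> integrable_over (inversion l -` S) g" .
  have "integral_over S f
      = (\<integral>z. (l / norm z) ^ (2 * CARD('n)) * (indicator S (inversion l z) * f (inversion l z)) \<partial>lborel)"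
    by (rule integral_inversion[OF l, symmetric]) measurable
  also have "\<dots> = (\<integral>z. c * (indicator (inversion l -` S) z * g z) \<partial>lborel)"
    by (rule integral_cong_AE) (use ae in measurable)
  finally show "integral_over S f = c * integral_over (inversion l -` S) g"
    by simp
qed

lemma integrable_indicator_mono:
  fixes g :: "real^'n \<Rightarrow> real"
  assumes "integrable_over A g" "B \<subseteq> A" "B \<in> sets borel"
  shows "integrable_over B g"
proof -
  have "(\<lambda>y. indicator B y * g y) = (\<lambda>y. (indicator A y * g y) * indicator B y)"
    using assms(2) by (auto simp: fun_eq_iff indicator_def)
  then show ?thesis using integrable_real_mult_indicator[OF _ assms(1), of B] assms(3) by simp
qed

text \<open>Excluding the preimage of a small ball instead of a ball does not change the principal value.\<close>

lemma transport_difference: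
  fixes g :: "real^'n \<Rightarrow> real"
  assumes l: "l > 0" and x: "x \<noteq> 0"
    and int: "\<And>\<epsilon>. \<epsilon> > 0 \<Longrightarrow> integrable_over (- ball (inversion l x) \<epsilon>) g"
    and near: "d > 0" "\<And>y. y \<noteq> inversion l x \<Longrightarrow> dist (inversion l x) y < d \<Longrightarrow>
        \<bar>g y\<bar> \<le> M * dist (inversion l x) y powr (1 - eb)"
  defines "\<rho> \<equiv> (l / norm x)\<^sup>2" and "C \<equiv> 2 / norm x"
  shows "((\<lambda>\<epsilon>. integral_over (inversion l -` (- ball x \<epsilon>)) g
      - integral_over (- ball (inversion l x) (\<rho> * \<epsilon> * (1 - C * \<epsilon>))) g) \<longlongrightarrow> 0) (at_right 0)"
  unfolding vimage_Compl
proof (rule pv_domain_difference[OF int near])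
  have "norm x > 0" using x by simp
  then show "C > 0" "\<rho> > 0" "norm x / 2 > 0" using l by (auto simp: C_def \<rho>_def)
  fix \<epsilon> :: real assume "0 < \<epsilon>" "\<epsilon> < norm x / 2"
  then show "inversion l -` ball x \<epsilon> \<in> sets borel \<and>
      ball (inversion l x) (\<rho> * \<epsilon> * (1 - C * \<epsilon>)) \<subseteq> inversion l -` ball x \<epsilon> \<and>
      inversion l -` ball x \<epsilon> \<subseteq> ball (inversion l x) (\<rho> * \<epsilon> * (1 + C * \<epsilon>))"
    using inversion_vimage_ball[OF l x] by (auto simp: \<rho>_def C_def)
qed

text \<open>The change of variables replaces the excluded ball about \<open>x\<close> by its
  preimage. By \<open>transport_difference\<close> that preimage may be exchanged for a genuine
  ball, whose radius tends to 0 together with \<epsilon>.\<close>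

lemma transport_pv:
  fixes f g :: "real^'n \<Rightarrow> real"
  assumes l: "l > 0" and x: "x \<noteq> 0" and c: "c \<noteq> 0" and meas: "f \<in> borel_measurable borel" "g \<in> borel_measurable borel"
    and tr: "\<And>z. z \<noteq> 0 \<Longrightarrow> (l / norm z) ^ (2 * CARD('n)) * f (inversion l z) = c * g z"
    and pv: "pv_int g (inversion l x) L"
    and near: "d > 0" "\<And>y. y \<noteq> inversion l x \<Longrightarrow> dist (inversion l x) y < d \<Longrightarrow>
        \<bar>g y\<bar> \<le> M * dist (inversion l x) y powr (1 - eb)"
  shows "pv_int f x (c * L)"
proof -
  define \<rho> C where "\<rho> = (l / norm x)\<^sup>2" and "C = 2 / norm x"
  have pos: "C > 0" "\<rho> > 0" "norm x > 0" using l x by (auto simp: C_def \<rho>_def)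
  have int: "integrable_over (- ball (inversion l x) \<epsilon>) g" if "\<epsilon> > 0" for \<epsilon>
    using pv that by (simp add: pv_int_def)
  show ?thesis unfolding pv_int_def
  proof (intro conjI allI impI)
    fix \<epsilon> :: real assume e: "\<epsilon> > 0"
    \<comment> \<open>The inclusion of balls is available for small radii only; integrability
      outside a larger ball follows by restriction.\<close>
    define e1 where "e1 = min \<epsilon> (norm x / 4)"
    have e1: "e1 > 0" "e1 \<le> \<epsilon>" "e1 < norm x / 2" using e pos by (auto simp: e1_def min_def)
    have "C * e1 < 1" using e1 pos by (simp add: C_def field_simps)
    then have r: "\<rho> * e1 * (1 - C * e1) > 0" using e1 pos by simp
    have "integrable_over (inversion l -` (- ball x e1)) g"
      by (rule integrable_indicator_mono[OF int[OF r]])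
        (use inversion_vimage_ball(1)[OF l x e1(1,3)] in \<open>auto simp: \<rho>_def C_def\<close>)
    then have "integrable_over (- ball x e1) f"
      by (subst transport_integral(1)[OF l c meas _ tr]) auto
    then show "integrable_over (- ball x \<epsilon>) f"
      by (rule integrable_indicator_mono) (use e1 in auto)
  next
    have "filterlim (\<lambda>\<epsilon>. \<rho> * \<epsilon> * (1 - C * \<epsilon>)) (at_right 0) (at_right 0)"
      using pos by real_asymp
    then have "((\<lambda>\<epsilon>. integral_over (- ball (inversion l x) (\<rho> * \<epsilon> * (1 - C * \<epsilon>))) g) \<longlongrightarrow> L) (at_right 0)"
      using pv unfolding pv_int_def by (auto intro: filterlim_compose)
    from tendsto_mult[OF tendsto_const[of c] tendsto_add[OF transport_difference[OF l x int near, folded \<rho>_def C_def] this]]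
    have "((\<lambda>\<epsilon>. c * integral_over (inversion l -` (- ball x \<epsilon>)) g) \<longlongrightarrow> c * L) (at_right 0)"
      by simp
    moreover have "integral_over (- ball x \<epsilon>) f = c * integral_over (inversion l -` (- ball x \<epsilon>)) g" for \<epsilon>
      by (rule transport_integral(2)[OF l c meas _ tr]) auto
    ultimately show "((\<lambda>\<epsilon>. integral_over (- ball x \<epsilon>) f) \<longlongrightarrow> c * L) (at_right 0)" by simp
  qed
qed

lemma borel_measurable_riesz [measurable]: "riesz \<in> borel_measurable borel"
  unfolding riesz_def[abs_def] by measurable

lemma borel_measurable_kelvin [measurable]:
  assumes [measurable]: "u \<in> borel_measurable borel"
  shows "kelvin l u \<in> borel_measurable borel"
  unfolding kelvin_def[abs_def] by measurable

text \<open>Inversion in the sphere through \<open>x\<close> maps the singular integral to its negative.\<close>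

lemma flap_riesz:
  assumes x: "x \<noteq> 0"
  shows "flap riesz x 0"
proof -
  define l where "l = norm x"
  have l: "l > 0" using x by (simp add: l_def)
  have Jx: "inversion l x = x" using x by (simp add: inversion_def l_def)
  define g where "g y = (riesz x - riesz y) / norm (x - y) powr eb" for y
  have [measurable]: "g \<in> borel_measurable borel" unfolding g_def by measurable
  have K: "kelvin l (\<lambda>_. 1) y = l powr ea * riesz y" for y
    by (simp add: kelvin_def riesz_def powr_divide powr_minus_divide)
  \<comment> \<open>This is \<open>kelvin_integrand\<close> for the constant 1 and the sphere
    through \<open>x\<close>: \<open>inversion l\<close> fixes \<open>x\<close>, and the coefficient
    of \<open>riesz\<close> is negative, which produces the sign.\<close>
  have tr: "(l / norm z) ^ (2 * CARD('n)) * g (inversion l z) = (- 1) * g z" if z: "z \<noteq> 0" for z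
  proof -
    have "l powr ea * ((l / norm z) ^ (2 * CARD('n)) * g (inversion l z)) = l powr ea * ((- 1) * g z)"
      using kelvin_integrand[OF l x z, of "\<lambda>_. 1"] l unfolding K Jx g_def
      by (simp add: l_def[symmetric] algebra_simps diff_divide_distrib)
    then show ?thesis using l by (subst (asm) mult_cancel_left) auto
  qed
  \<comment> \<open>Inversion exchanges the product of \<open>riesz\<close> and the kernel with the
    kernel alone, whose integrability away from \<open>x\<close> is known.\<close>
  have tr': "(l / norm z) ^ (2 * CARD('n)) * (riesz (inversion l z) / norm (x - inversion l z) powr eb)
     = l powr - ea * (1 / norm (x - z) powr eb)" if z: "z \<noteq> 0" for z
  proof -
    have t: "norm z > 0" using z by simp
    have "norm (x - inversion l z) = l * norm (x - z) / norm z"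
      using norm_inversion_diff[OF x z, of l] l by (simp add: Jx l_def[symmetric] power2_eq_square)
    moreover have "(l / norm z) ^ (2 * CARD('n)) = (l / norm z) powr ea * (l / norm z) powr eb"
      using l t ea_eb by (simp add: powr_realpow[symmetric] powr_add[symmetric])
    ultimately show ?thesis
      using l t by (simp add: riesz_def norm_inversion powr_minus_divide powr_mult powr_divide power2_eq_square)
  qed
  have int: "integrable_over (- ball x \<epsilon>) g" if e: "\<epsilon> > 0" for \<epsilon>
  proof -
    define e1 where "e1 = min \<epsilon> (norm x / 4)"
    have e1: "e1 > 0" "e1 \<le> \<epsilon>" "e1 < norm x / 2" using e x by (auto simp: e1_def min_def)
    have "2 / norm x * e1 < 1" using e1 x by (simp add: field_simps)
    then have r: "(l / norm x)\<^sup>2 * e1 * (1 - 2 / norm x * e1) > 0" (is "?r > 0") using e1 x l by simp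
    have k: "integrable lborel (\<lambda>y. indicator (- ball x s) y * (1 / norm (x - y) powr eb))" if "s > 0" for s
      using integrable_powr_tail[OF that, of x] by simp
    have "integrable lborel (\<lambda>z. indicator (inversion l -` (- ball x e1)) z * (1 / norm (x - z) powr eb))"
      by (rule integrable_indicator_mono[OF k[OF r]])
        (use inversion_vimage_ball(1)[OF l x e1(1,3), unfolded Jx] in auto)
    then have "integrable lborel (\<lambda>y. indicator (- ball x e1) y * (riesz y / norm (x - y) powr eb))"
      by (subst transport_integral(1)[OF l _ _ _ _ tr']) (use l in simp_all)
    from Bochner_Integration.integrable_diff[OF integrable_mult_right[OF k[OF e1(1)], of "riesz x"] this]
    have "integrable_over (- ball x e1) g"
      by (rule Bochner_Integration.integrable_cong[THEN iffD1, rotated -1]) (auto simp: g_def diff_divide_distrib algebra_simps)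
    then show ?thesis by (rule integrable_indicator_mono) (use e1 in auto)
  qed
  obtain d M where near: "d > 0" "\<And>y. y \<noteq> x \<Longrightarrow> dist x y < d \<Longrightarrow> \<bar>g y\<bar> \<le> M * dist x y powr (1 - eb)"
    using flap_near[OF lip_at_riesz[OF x]] unfolding g_def by blast
  define F where "F \<epsilon> = integral_over (- ball x \<epsilon>) g" for \<epsilon>
  define G where "G \<epsilon> = integral_over (inversion l -` (- ball x \<epsilon>)) g" for \<epsilon>
  define C where "C = 2 / norm x"
  have FG: "F \<epsilon> = (- 1) * G \<epsilon>" for \<epsilon>
    unfolding F_def G_def by (rule transport_integral(2)[OF l _ _ _ _ tr]) auto
  have rho: "(l / norm x)\<^sup>2 = 1" using x by (simp add: l_def)
  have 1: "((\<lambda>\<epsilon>. G \<epsilon> - F (1 * \<epsilon> * (1 - C * \<epsilon>))) \<longlongrightarrow> 0) (at_right 0)"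
    using transport_difference[OF l x, of g, unfolded Jx rho, OF int near] unfolding G_def F_def C_def .
  have 2: "((\<lambda>\<epsilon>. F \<epsilon> - F (1 * \<epsilon> * (1 - C * \<epsilon>))) \<longlongrightarrow> 0) (at_right 0)"
    unfolding F_def
  proof (rule pv_domain_difference[OF int near, where \<rho> = 1 and E = "ball x" and ?e0.0 = 1])
    show "C > 0" "(1::real) > 0" using x by (auto simp: C_def)
    then show "ball x \<epsilon> \<in> sets borel \<and> ball x (1 * \<epsilon> * (1 - C * \<epsilon>)) \<subseteq> ball x \<epsilon> \<and> ball x \<epsilon> \<subseteq> ball x (1 * \<epsilon> * (1 + C * \<epsilon>))"
      if "0 < \<epsilon>" for \<epsilon>
      using that by (intro conjI subset_ball) (auto intro!: mult_left_le simp: distrib_left)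
  qed auto
  \<comment> \<open>\<open>F\<close> and \<open>G\<close> are asymptotic to the same shifted
    \<open>F\<close>, so their difference tends to 0; since also \<open>F = - G\<close> exactly,
    both tend to 0.\<close>
  have "((\<lambda>\<epsilon>. ((F \<epsilon> - F (1 * \<epsilon> * (1 - C * \<epsilon>))) - (G \<epsilon> - F (1 * \<epsilon> * (1 - C * \<epsilon>)))) / 2) \<longlongrightarrow> (0 - 0) / 2) (at_right 0)"
    by (intro tendsto_divide tendsto_diff 1 2 tendsto_const) auto
  moreover have "F = (\<lambda>\<epsilon>. - G \<epsilon>)" by (simp add: FG fun_eq_iff)
  ultimately have "(F \<longlongrightarrow> 0) (at_right 0)" by (simp add: FG)
  then show ?thesis
    using int unfolding flap_def pv_int_def F_def g_def by blast
qed

text \<open>By \<open>kelvin_integrand\<close> the difference quotients of the Kelvin transform are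
  transported from those of \<open>u\<close> plus a multiple of \<open>riesz\<close>. The added term
  has fractional Laplacian 0 at the image point, so only the value for \<open>u\<close>
  remains.\<close>

theorem flap_kelvin:
  assumes l: "l > 0" and x: "x \<noteq> 0" and [measurable]: "u \<in> borel_measurable borel"
    and lip: "lip_at u (inversion l x)" and L: "flap u (inversion l x) L"
  shows "flap (kelvin l u) x ((l / norm x) powr eb * L)"
proof -
  let ?X = "inversion l x"
  have X0: "?X \<noteq> 0" using l x by (simp add: inversion_eq_0_iff)
  define c where "c = - u ?X * norm ?X powr ea"
  define w where "w y = u y + c * riesz y" for y
  have [measurable]: "w \<in> borel_measurable borel" unfolding w_def[abs_def] by measurable
  have fw: "flap w ?X L"
    using flap_add[OF L flap_cmult[OF flap_riesz[OF X0], of c]] by (simp add: w_def[abs_def])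
  have lw: "lip_at w ?X"
    unfolding w_def[abs_def] by (intro lip_at_add lip_at_cmult lip lip_at_riesz X0)
  from flap_near[OF lw] obtain d M where near: "d > 0"
    "\<And>y. y \<noteq> ?X \<Longrightarrow> dist ?X y < d \<Longrightarrow> \<bar>(w ?X - w y) / norm (?X - y) powr eb\<bar> \<le> M * dist ?X y powr (1 - eb)"
    by blast
  show ?thesis
    unfolding flap_def
    by (rule transport_pv[OF l x _ _ _ _ fw[unfolded flap_def] near])
      (use l x in simp, measurable, use kelvin_integrand[OF l x, of _ u] in \<open>simp add: w_def c_def\<close>)
qed

end

section \<open>Maximum principles\<close>

lemma pv_int_integrable:
  assumes h: "integrable lborel h"
  shows "pv_int h x (integral\<^sup>L lborel h)"
  unfolding pv_int_def
proof (intro conjI allI impI)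
  show "integrable_over (- ball x \<epsilon>) h" for \<epsilon>
    using integrable_real_mult_indicator[of "- ball x \<epsilon>" lborel h] h by (simp add: mult.commute)
  have [measurable]: "h \<in> borel_measurable borel" using h by auto
  show "((\<lambda>\<epsilon>. integral_over (- ball x \<epsilon>) h) \<longlongrightarrow> integral\<^sup>L lborel h) (at_right 0)"
  proof (rule tendsto_at_right_sequentially[of 0 1])
    fix S :: "nat \<Rightarrow> real" assume S: "\<And>n. 0 < S n" "S \<longlonglongrightarrow> 0"
    show "(\<lambda>n. integral_over (- ball x (S n)) h) \<longlonglongrightarrow> integral\<^sup>L lborel h"
    proof (rule integral_dominated_convergence[where w = "\<lambda>y. \<bar>h y\<bar>"])
      have "AE y in lborel. y \<noteq> x" by (rule AE_lborel_singleton)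
      then show "AE y in lborel. (\<lambda>n. indicator (- ball x (S n)) y * h y) \<longlonglongrightarrow> h y"
      proof eventually_elim
        fix y assume "y \<noteq> x"
        then have "\<forall>\<^sub>F n in sequentially. S n < dist x y"
          using order_tendstoD(2)[OF S(2), of "dist x y"] by simp
        then have "\<forall>\<^sub>F n in sequentially. indicator (- ball x (S n)) y * h y = h y"
          by eventually_elim auto
        then show "(\<lambda>n. indicator (- ball x (S n)) y * h y) \<longlonglongrightarrow> h y"
          by (rule tendsto_eventually)
      qed
    qed (use h in \<open>auto simp: indicator_def\<close>)
  qed simp
qed

text \<open>The maximum principle in quantitative form: once the integrand has a sign, any set
  \<open>T\<close> away from the singularity yields an upper bound, and the rest may be
  dropped.\<close>

lemma pv_int_upper:
  assumes g: "pv_int g x L" and neg: "\<And>y. y \<noteq> x \<Longrightarrow> g y \<le> 0"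
    and T: "T \<in> sets borel" "emeasure lborel T < \<infinity>" "\<delta> > 0" "T \<inter> ball x \<delta> = {}" "\<And>y. y \<in> T \<Longrightarrow> g y \<le> - \<kappa>"
  shows "L \<le> - \<kappa> * measure lborel T"
proof (rule tendsto_upperbound)
  show "((\<lambda>\<epsilon>. integral_over (- ball x \<epsilon>) g) \<longlongrightarrow> L) (at_right 0)"
    using g by (simp add: pv_int_def)
  show "\<forall>\<^sub>F \<epsilon> in at_right 0. integral_over (- ball x \<epsilon>) g \<le> - \<kappa> * measure lborel T"
    unfolding eventually_at_right_field
  proof (intro exI[of _ \<delta>] conjI allI impI T)
    fix \<epsilon> assume e: "0 < \<epsilon>" "\<epsilon> < \<delta>"
    have "integral_over (- ball x \<epsilon>) g \<le> (\<integral>y. - \<kappa> * indicator T y \<partial>lborel)"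
    proof (rule integral_mono)
      show "integrable_over (- ball x \<epsilon>) g"
        using g e by (simp add: pv_int_def)
      show "integrable lborel (\<lambda>y. - \<kappa> * indicator T y)"
        using T by (intro integrable_mult_right integrable_real_indicator) auto
      fix y
      have "indicator (- ball x \<epsilon>) y * g y \<le> 0" using neg[of y] e by (cases "y = x") (auto simp: indicator_def)
      moreover have "y \<notin> ball x \<epsilon>" if "y \<in> T" using T(4) e that by auto
      ultimately show "indicator (- ball x \<epsilon>) y * g y \<le> - \<kappa> * indicator T y"
        using T(5)[of y] by (auto simp: indicator_def)
    qed
    then show "integral_over (- ball x \<epsilon>) g \<le> - \<kappa> * measure lborel T" by simp
  qed
qed simp

text \<open>Distance from \<open>x\<close> to \<open>inversion l z\<close>, rescaled so that it is symmetric and agrees with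
  \<open>norm (x - z)\<close> on the sphere.\<close>

definition rdist :: "real \<Rightarrow> 'a::real_inner \<Rightarrow> 'a \<Rightarrow> real" where
  "rdist l x z = norm z * norm (x - inversion l z) / l"

text \<open>Outside the sphere both factors of the last term are positive. Hence reflection
  increases distances, and the reflected kernel is smaller than the direct one; the exterior maximum
  principles rest on this sign.\<close>

lemma rdist_square:
  assumes "l > 0" "z \<noteq> 0"
  shows "(rdist l x z)\<^sup>2 = (norm (x - z))\<^sup>2 + ((norm x)\<^sup>2 - l\<^sup>2) * ((norm z)\<^sup>2 - l\<^sup>2) / l\<^sup>2"
proof -
  define t where "t = norm z"
  have t: "t > 0" using assms by (simp add: t_def)
  have e: "norm (x - z) ^ 2 = norm x ^ 2 - 2 * (x \<bullet> z) + t ^ 2"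
    by (simp add: power2_norm_eq_inner inner_diff inner_commute algebra_simps t_def)
  have "norm (x - inversion l z) ^ 2 = norm x ^ 2 - 2 * (x \<bullet> inversion l z) + norm (inversion l z) ^ 2"
    by (simp add: power2_norm_eq_inner inner_diff inner_commute algebra_simps)
  also have "\<dots> = norm x ^ 2 - 2 * ((l / t)\<^sup>2 * (x \<bullet> z)) + (l\<^sup>2 / t)\<^sup>2"
    by (simp add: norm_inversion) (simp add: inversion_def t_def)
  finally have f: "norm (x - inversion l z) ^ 2 = norm x ^ 2 - 2 * ((l / t)\<^sup>2 * (x \<bullet> z)) + (l\<^sup>2 / t)\<^sup>2" .
  have "t\<^sup>2 * (X - 2 * ((l / t)\<^sup>2 * P) + (l\<^sup>2 / t)\<^sup>2) / l\<^sup>2 = X - 2 * P + t\<^sup>2 + (X - l\<^sup>2) * (t\<^sup>2 - l\<^sup>2) / l\<^sup>2" for X P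
    using t assms(1) by (simp add: field_simps eval_nat_numeral)
  then show ?thesis
    unfolding rdist_def power_divide[of "_ * _"] power_mult_distrib e f t_def[symmetric] .
qed

lemma rdist_nonneg: "l > 0 \<Longrightarrow> rdist l x z \<ge> 0"
  by (simp add: rdist_def)

lemma rdist_greater:
  assumes "l > 0" "norm x > l" "norm z > l"
  shows "norm (x - z) < rdist l x z"
proof -
  have z: "z \<noteq> 0" using assms by auto
  have "(norm x)\<^sup>2 > l\<^sup>2" "(norm z)\<^sup>2 > l\<^sup>2" using assms by (auto intro: power_strict_mono)
  then have "(norm (x - z))\<^sup>2 < (rdist l x z)\<^sup>2" using assms z by (simp add: rdist_square)
  then show ?thesis using rdist_nonneg[OF assms(1)] power_less_imp_less_base by blast
qed

lemma rdist_continuous: "l > 0 \<Longrightarrow> 0 \<notin> A \<Longrightarrow> continuous_on A (rdist l x)"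
  unfolding rdist_def[abs_def] inversion_def[abs_def] by (intro continuous_intros) auto

lemma norm_inversion_less: "norm y > l \<Longrightarrow> l > 0 \<Longrightarrow> norm (inversion l y) < l"
  by (subst norm_inversion, subst pos_divide_less_eq) (auto simp: power2_eq_square)

context fractional
begin

section \<open>Antisymmetric functions outside a sphere\<close>

definition antisym :: "real \<Rightarrow> (real^'n \<Rightarrow> real) \<Rightarrow> bool" where
  "antisym l g \<longleftrightarrow> (\<forall>y. y \<noteq> 0 \<longrightarrow> kelvin l g y = - g y)"

lemma antisym_diff_kelvin:
  assumes "l > 0" shows "antisym l (\<lambda>y. u y - kelvin l u y)"
proof -
  have "kelvin l (\<lambda>y. u y - kelvin l u y) y = kelvin l u y - kelvin l (kelvin l u) y" for y
    by (simp add: kelvin_def algebra_simps)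
  then show ?thesis using assms by (simp add: antisym_def kelvin_kelvin)
qed

lemma antisym_lincomb:
  "antisym l f \<Longrightarrow> antisym l g \<Longrightarrow> antisym l (\<lambda>y. f y + c * g y)"
proof -
  have "kelvin l (\<lambda>y. f y + c * g y) y = kelvin l f y + c * kelvin l g y" for y
    by (simp add: kelvin_def algebra_simps)
  then show "antisym l f \<Longrightarrow> antisym l g \<Longrightarrow> antisym l (\<lambda>y. f y + c * g y)" by (simp add: antisym_def)
qed

text \<open>Folding the interior of the ball onto the exterior turns the singular integral of an
  antisymmetric function into one over the exterior.\<close>

lemma antisym_fold:
  assumes l: "l > 0" and x: "norm x > l" and [measurable]: "g \<in> borel_measurable borel"
    and anti: "antisym l g" and L: "flap g x L"
  shows "pv_int (\<lambda>y. indicator (- ball 0 l) y * ((g x - g y) / norm (x - y) powr eb)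
    + indicator (inversion l -` ball 0 l) y * (((l / norm y) powr ea * g x + g y) / rdist l x y powr eb)) x L"
proof -
  define q where "q y = (g x - g y) / norm (x - y) powr eb" for y
  define p where "p y = ((l / norm y) powr ea * g x + g y) / rdist l x y powr eb" for y
  have [measurable]: "q \<in> borel_measurable borel" unfolding q_def[abs_def] by measurable
  have [measurable]: "p \<in> borel_measurable borel" unfolding p_def[abs_def] rdist_def by measurable
  have tr: "(l / norm z) ^ (2 * CARD('n)) * q (inversion l z) = 1 * p z" if z: "z \<noteq> 0" for z
  proof -
    have t: "norm z > 0" using z by simp
    define s c m where "s = (l / norm z) powr ea" and "c = (l / norm z) powr eb"
      and "m = norm (x - inversion l z) powr eb"
    have "s * g (inversion l z) = - g z"
      using anti z by (simp add: antisym_def kelvin_def s_def)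
    moreover have "(l / norm z) ^ (2 * CARD('n)) = s * c"
      using l t ea_eb by (simp add: powr_realpow[symmetric] powr_add[symmetric] s_def c_def)
    moreover have "c / m = 1 / rdist l x z powr eb"
      by (simp add: rdist_def powr_divide powr_mult c_def m_def)
    moreover have "s * c * ((g x - g (inversion l z)) / m) = (c / m) * (s * g x - s * g (inversion l z))"
      by (simp add: algebra_simps diff_divide_distrib)
    ultimately show ?thesis by (simp add: q_def p_def s_def[symmetric] m_def[symmetric])
  qed
  have pv: "pv_int q x L" using L unfolding flap_def q_def .
  have sub: "ball 0 l \<subseteq> - ball x (norm x - l)"
  proof
    fix y :: "real^'n" assume "y \<in> ball 0 l"
    then show "y \<in> - ball x (norm x - l)"
      using norm_triangle_ineq2[of x y] by (auto simp: dist_norm)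
  qed
  have "integrable_over (- ball x (norm x - l)) q"
    using pv x by (simp add: pv_int_def)
  then have i1: "integrable_over (ball 0 l) q"
    by (rule integrable_indicator_mono[OF _ sub]) auto
  then have i2: "integrable_over (inversion l -` ball 0 l) p"
    by (subst (asm) transport_integral(1)[OF l _ _ _ _ tr]) auto
  have eq: "integral_over (ball 0 l) q = 1 * integral_over (inversion l -` ball 0 l) p"
    by (rule transport_integral(2)[OF l _ _ _ _ tr]) auto
  \<comment> \<open>As \<open>x\<close> lies outside the sphere, the integral over the inner ball is
    an ordinary one. It is subtracted and then added back in transported form.\<close>
  from pv_int_add[OF pv_int_add[OF pv pv_int_cmult[OF pv_int_integrable[OF i1], of "-1"]] pv_int_integrable[OF i2]]
  have "pv_int (\<lambda>y. q y + - 1 * (indicator (ball 0 l) y * q y) + indicator (inversion l -` ball 0 l) y * p y) x L"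
    unfolding eq by simp
  then show ?thesis
    unfolding q_def[symmetric] p_def[symmetric] by (rule pv_int_cong) (auto simp: indicator_def)
qed

text \<open>At an exterior minimum with nonpositive value, the folded integrand is dominated by two
  nonpositive contributions: the increments of \<open>g\<close> weighted with the gap between direct
  and reflected kernel, and \<open>g x\<close> weighted with the reflected kernel. Later
  applications exploit one or the other through the choice of \<open>T\<close> and \<kappa>.\<close>

lemma antisym_max:
  assumes l: "l > 0" and x: "norm x > l" and g: "g \<in> borel_measurable borel"
    and anti: "antisym l g" and L: "flap g x L"
    and gx: "g x \<le> 0" "\<And>z. norm z > l \<Longrightarrow> g x \<le> g z"
    and T: "T \<in> sets borel" "emeasure lborel T < \<infinity>" "\<delta> > 0" "T \<inter> ball x \<delta> = {}" "\<And>z. z \<in> T \<Longrightarrow> norm z > l"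
    and \<kappa>: "\<And>z. z \<in> T \<Longrightarrow> \<kappa> \<le> (g z - g x) * (1 / norm (x - z) powr eb - 1 / rdist l x z powr eb) - g x / rdist l x z powr eb"
  shows "L \<le> - \<kappa> * measure lborel T"
proof (rule pv_int_upper[OF antisym_fold[OF l x g anti L] _ T(1-4)])
  let ?Q = "\<lambda>y. indicator (- ball 0 l) y * ((g x - g y) / norm (x - y) powr eb)
    + indicator (inversion l -` ball 0 l) y * (((l / norm y) powr ea * g x + g y) / rdist l x y powr eb)"
  have out: "?Q y \<le> - ((g y - g x) * (1 / norm (x - y) powr eb - 1 / rdist l x y powr eb) - g x / rdist l x y powr eb)"
    if y: "norm y > l" for y
  proof -
    have "norm (inversion l y) < l" using y l by (rule norm_inversion_less)
    then have Q: "?Q y = (g x - g y) * (1 / norm (x - y) powr eb) + ((l / norm y) powr ea * g x + g y) * (1 / rdist l x y powr eb)"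
      using y by (simp add: indicator_def)
    have "0 \<le> (l / norm y) powr ea * (- g x)" using gx by (intro mult_nonneg_nonneg) auto
    then have "((l / norm y) powr ea * g x + g y) * (1 / rdist l x y powr eb) \<le> g y * (1 / rdist l x y powr eb)"
      by (intro mult_right_mono) auto
    moreover define A B where "A = 1 / norm (x - y) powr eb" and "B = 1 / rdist l x y powr eb"
    moreover have "g x / rdist l x y powr eb = g x * B" by (simp add: B_def)
    ultimately show ?thesis
      unfolding Q A_def[symmetric] B_def[symmetric] by (simp add: algebra_simps)
  qed
  show "?Q y \<le> - \<kappa>" if "y \<in> T" for y
    using out[OF T(5)[OF that]] \<kappa>[OF that] by linarith
  show "?Q y \<le> 0" if "y \<noteq> x" for y
  proof -
    consider "norm y > l" | "norm y = l" | "norm y < l" "y \<noteq> 0" | "y = 0" by linarith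
    then show ?thesis
    proof cases
      case 1
      have "norm (x - y) > 0" using that by simp
      then have "1 / rdist l x y powr eb \<le> 1 / norm (x - y) powr eb"
        using rdist_greater[OF l x 1] eb_pos by (intro divide_left_mono powr_mono2 mult_pos_pos) auto
      then have "0 \<le> (g y - g x) * (1 / norm (x - y) powr eb - 1 / rdist l x y powr eb)"
        using gx(2)[OF 1] by (intro mult_nonneg_nonneg) auto
      moreover have "g x / rdist l x y powr eb \<le> 0" using gx by (intro divide_nonpos_nonneg) auto
      ultimately show ?thesis using out[OF 1] by linarith
    next
      case 2
      have "y \<noteq> 0" using 2 l by auto
      then have "kelvin l g y = - g y" using anti by (simp add: antisym_def)
      moreover have "inversion l y = y" using 2 l by (auto simp: inversion_def)
      moreover have "l / norm y = 1" using 2 l by simp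
      ultimately have "g y = 0" by (simp add: kelvin_def)
      moreover have "norm (inversion l y) = l" using 2 l \<open>inversion l y = y\<close> by simp
      ultimately show ?thesis using 2 gx by (simp add: indicator_def divide_nonpos_nonneg)
    next
      case 3
      then have "norm (inversion l y) > l" using l by (simp add: norm_inversion power2_eq_square field_simps)
      then show ?thesis using 3 by (simp add: indicator_def)
    next
      \<comment> \<open>Because \<open>inversion l 0 = 0\<close>, the preimage of the ball contains
        the origin. There \<open>rdist\<close> is 0, and division by zero makes the integrand
        0.\<close>
      case 4
      then show ?thesis using l by (simp add: indicator_def rdist_def)
    qed
  qed
qed

lemma kernel_gap:
  assumes l: "l > 0" and "norm x > l" "norm z > l" "x \<noteq> z"
  shows "1 / rdist l x z powr eb < 1 / norm (x - z) powr eb"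
proof -
  have "norm (x - z) > 0" using assms by simp
  then show ?thesis
    using rdist_greater[OF assms(1-3)] eb_pos by (intro divide_strict_left_mono powr_less_mono2 mult_pos_pos) auto
qed

text \<open>Only the contribution of \<open>g x\<close> is kept. The test set is a ball of radius
  \<delta> placed radially beyond \<open>x\<close> at distance \<open>2 * \<delta>\<close>, so that
  it stays outside the sphere and away from \<open>x\<close>.\<close>

lemma antisym_ball:
  assumes l: "l > 0" and x: "norm x > l" and g: "g \<in> borel_measurable borel"
    and anti: "antisym l g" and L: "flap g x L"
    and gx: "g x \<le> 0" "\<And>z. norm z > l \<Longrightarrow> g x \<le> g z"
    and \<delta>: "\<delta> > 0" and R: "\<And>z. norm x + \<delta> < norm z \<Longrightarrow> norm z < norm x + 3 * \<delta> \<Longrightarrow> norm (x - z) < 3 * \<delta> \<Longrightarrow> rdist l x z \<le> R"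
  shows "L \<le> g x / R powr eb * (unit_ball_vol (real CARD('n)) * \<delta> ^ CARD('n))"
proof -
  define p where "p = (1 + 2 * \<delta> / norm x) *\<^sub>R x"
  have x0: "norm x > 0" using x l by auto
  have np: "norm p = norm x + 2 * \<delta>" using x0 \<delta> by (simp add: p_def field_simps)
  have xp: "norm (x - p) = 2 * \<delta>" using x0 \<delta> by (simp add: p_def algebra_simps)
  have T: "norm x + \<delta> < norm z" "norm z < norm x + 3 * \<delta>" "norm (x - z) < 3 * \<delta>" "\<delta> < norm (x - z)"
    if "z \<in> ball p \<delta>" for z
  proof -
    have d: "norm (p - z) < \<delta>" using that by (simp add: dist_norm)
    show "norm x + \<delta> < norm z" using norm_triangle_ineq2[of p z] d np by linarith
    show "norm z < norm x + 3 * \<delta>" using norm_triangle_ineq2[of z p] d np by (simp add: norm_minus_commute)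
    show "norm (x - z) < 3 * \<delta>" using norm_triangle_ineq[of "x - p" "p - z"] d xp by simp
    show "\<delta> < norm (x - z)" using norm_triangle_ineq[of "x - z" "z - p"] d xp by (simp add: norm_minus_commute)
  qed
  have "L \<le> - (- g x / R powr eb) * measure lborel (ball p \<delta>)"
  proof (rule antisym_max[OF l x g anti L gx])
    show "ball p \<delta> \<inter> ball x \<delta> = {}" using T(4) by (force simp: dist_norm)
    fix z assume z: "z \<in> ball p \<delta>"
    show nz: "norm z > l" using T(1)[OF z] x \<delta> by linarith
    have "z \<noteq> x" using T(4)[OF z] \<delta> by auto
    then have "1 / rdist l x z powr eb < 1 / norm (x - z) powr eb" by (intro kernel_gap[OF l x nz]) auto
    then have "0 \<le> (g z - g x) * (1 / norm (x - z) powr eb - 1 / rdist l x z powr eb)"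
      using gx(2)[OF nz] by (intro mult_nonneg_nonneg) auto
    moreover have "- g x / R powr eb \<le> - g x / rdist l x z powr eb"
    proof (rule divide_left_mono)
      have "0 < rdist l x z" using rdist_greater[OF l x nz] \<open>z \<noteq> x\<close> by (smt (verit) norm_ge_zero)
      moreover have "rdist l x z \<le> R" using R T z by auto
      ultimately show "rdist l x z powr eb \<le> R powr eb" "0 < R powr eb * rdist l x z powr eb"
        using eb_pos by (auto intro!: powr_mono2 mult_pos_pos)
    qed (use gx in simp)
    ultimately show "- g x / R powr eb \<le> (g z - g x) * (1 / norm (x - z) powr eb - 1 / rdist l x z powr eb) - g x / rdist l x z powr eb"
      by simp
  qed (use \<delta> emeasure_lborel_ball_finite in auto)
  then show ?thesis using \<delta> by (simp add: content_ball)
qed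

text \<open>If \<open>x\<close> is within \<delta> of the sphere, the reflected distance to the test
  ball is itself of order \<delta>. The volume of the ball against the kernel then leaves
  \<open>\<delta> powr (- 2 * \<sigma>)\<close>, which exceeds any Lipschitz constant once \<delta>
  is small.\<close>

lemma antisym_narrow:
  assumes l: "l > 0" and x: "norm x > l" and g: "g \<in> borel_measurable borel"
    and anti: "antisym l g" and L: "flap g x L"
    and gx: "g x \<le> 0" "\<And>z. norm z > l \<Longrightarrow> g x \<le> g z"
    and \<delta>: "0 < \<delta>" "\<delta> \<le> l" "norm x < l + \<delta>"
  shows "L \<le> g x * (unit_ball_vol (real CARD('n)) / 9 powr eb * \<delta> powr (- 2 * \<sigma>))"
proof -
  have "L \<le> g x / (9 * \<delta>) powr eb * (unit_ball_vol (real CARD('n)) * \<delta> ^ CARD('n))"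
  proof (rule antisym_ball[OF l x g anti L gx \<delta>(1)])
    fix z assume z: "norm x + \<delta> < norm z" "norm z < norm x + 3 * \<delta>" "norm (x - z) < 3 * \<delta>"
    have z0: "z \<noteq> 0" using z x l \<delta> by auto
    have "((norm x)\<^sup>2 - l\<^sup>2) * ((norm z)\<^sup>2 - l\<^sup>2) / l\<^sup>2 \<le> (3 * \<delta> * l) * (24 * \<delta> * l) / l\<^sup>2"
    proof (intro divide_right_mono mult_mono)
      have "(norm x)\<^sup>2 \<le> (l + \<delta>)\<^sup>2" using \<delta> by (intro power_mono) auto
      also have "\<dots> \<le> l\<^sup>2 + 3 * \<delta> * l"
        using mult_left_mono[OF \<delta>(2), of \<delta>] \<delta> by (simp add: power2_eq_square algebra_simps)
      finally show "(norm x)\<^sup>2 - l\<^sup>2 \<le> 3 * \<delta> * l" by simp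
      have "(norm z)\<^sup>2 \<le> (l + 4 * \<delta>)\<^sup>2" using \<delta> z by (intro power_mono) auto
      also have "\<dots> \<le> l\<^sup>2 + 24 * \<delta> * l"
        using mult_left_mono[OF \<delta>(2), of \<delta>] \<delta> by (simp add: power2_eq_square algebra_simps)
      finally show "(norm z)\<^sup>2 - l\<^sup>2 \<le> 24 * \<delta> * l" by simp
      show "0 \<le> (norm z)\<^sup>2 - l\<^sup>2" using z x l \<delta> by (simp add: power_mono)
    qed (use \<delta> l in auto)
    also have "\<dots> = 72 * \<delta>\<^sup>2" using l by (simp add: power2_eq_square)
    finally have "(rdist l x z)\<^sup>2 \<le> (norm (x - z))\<^sup>2 + 72 * \<delta>\<^sup>2" by (simp add: rdist_square[OF l z0])
    also have "(norm (x - z))\<^sup>2 \<le> (3 * \<delta>)\<^sup>2" using z by (intro power_mono) auto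
    \<comment> \<open>The constant 9 comes from \<open>3 ^ 2 + 72 = 9 ^ 2\<close>.\<close>
    finally have "(rdist l x z)\<^sup>2 \<le> (9 * \<delta>)\<^sup>2" by (simp add: power_mult_distrib)
    then show "rdist l x z \<le> 9 * \<delta>" by (rule power2_le_imp_le) (use \<delta> in simp)
  qed
  also have "\<dots> = g x * (unit_ball_vol (real CARD('n)) / 9 powr eb * (\<delta> ^ CARD('n) / \<delta> powr eb))"
    by (simp add: powr_mult)
  also have "\<delta> ^ CARD('n) / \<delta> powr eb = \<delta> powr (- 2 * \<sigma>)"
    using \<delta> by (simp add: powr_realpow[symmetric] powr_diff[symmetric] eb_def)
  finally show ?thesis .
qed

lemma antisym_neg:
  assumes l: "l > 0" and x: "norm x > l" and g: "g \<in> borel_measurable borel"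
    and anti: "antisym l g" and L: "flap g x L"
    and gx: "g x < 0" "\<And>z. norm z > l \<Longrightarrow> g x \<le> g z"
  shows "L < 0"
proof -
  \<comment> \<open>With \<delta> = 1 the test points have norm below \<open>norm x + 3\<close>, and
    their images lie inside the sphere.\<close>
  define R where "R = (norm x + 3) * (norm x + l) / l"
  have R: "R > 0" unfolding R_def using l by (intro divide_pos_pos mult_pos_pos) (auto simp: add_nonneg_pos)
  have "L \<le> g x / R powr eb * (unit_ball_vol (real CARD('n)) * 1 ^ CARD('n))"
  proof (rule antisym_ball[OF l x g anti L less_imp_le[OF gx(1)] gx(2)])
    fix z :: "real^'n" assume z: "norm x + 1 < norm z" "norm z < norm x + 3 * 1"
    have "norm (x - inversion l z) \<le> norm x + norm (inversion l z)" by (rule norm_triangle_ineq4)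
    also have "\<dots> \<le> norm x + l" using norm_inversion_less[of l z] z x l by auto
    finally show "rdist l x z \<le> R"
      unfolding rdist_def R_def using z l by (intro divide_right_mono mult_mono) auto
  qed auto
  also have "\<dots> < 0"
    using gx R by (intro mult_neg_pos divide_neg_pos) auto
  finally show ?thesis .
qed

text \<open>At a zero of \<open>g\<close> the term with \<open>g x\<close> gives nothing. Strictness
  comes from the kernel gap instead: on a small closed ball about \<open>z\<close> the gap has a
  positive minimum by compactness and \<open>g\<close> is bounded below by continuity.\<close>

lemma antisym_strict:
  assumes l: "l > 0" and x: "norm x > l" and g: "g \<in> borel_measurable borel"
    and anti: "antisym l g" and L: "flap g x L"
    and gx: "g x = 0" "\<And>z. norm z > l \<Longrightarrow> 0 \<le> g z"
    and z: "norm z > l" "g z > 0" and cont: "isCont g z"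
  shows "L < 0"
proof -
  have xz: "x \<noteq> z" using gx z by auto
  obtain d where d: "d > 0" "\<And>y. dist z y < d \<Longrightarrow> g z / 2 < g y"
  proof -
    have "\<forall>\<^sub>F y in nhds z. g z / 2 < g y"
      using cont z by (intro order_tendstoD(1)[of g "g z"]) (auto simp: continuous_at tendsto_at_iff_tendsto_nhds)
    then show ?thesis using that unfolding eventually_nhds_metric by (metis dist_commute)
  qed
  define r where "r = min (d / 2) (min ((norm z - l) / 2) (dist x z / 2))"
  have r: "r > 0" "r < d" "r < norm z - l" "r < dist x z" "2 * r \<le> dist x z" using d z xz by (auto simp: r_def min_def)
  define G where "G y = 1 / norm (x - y) powr eb - 1 / rdist l x y powr eb" for y
  have nl: "norm y > l" if "y \<in> cball z r" for y
    using that r norm_triangle_ineq2[of z y] by (auto simp: dist_norm)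
  have xy: "x \<noteq> y" if "y \<in> cball z r" for y
    using that r by (auto simp: dist_commute)
  have rp: "rdist l x y > 0" if "y \<in> cball z r" for y
    using rdist_greater[OF l x nl[OF that]] by (smt (verit) norm_ge_zero)
  have "0 \<notin> cball z r" using nl[of 0] l by auto
  moreover have "\<forall>y\<in>cball z r. rdist l x y \<noteq> 0 \<and> rdist l x y powr eb \<noteq> 0 \<and> norm (x - y) \<noteq> 0 \<and> norm (x - y) powr eb \<noteq> 0"
    using rp xy by fastforce
  ultimately have "continuous_on (cball z r) G"
    unfolding G_def by (intro continuous_intros rdist_continuous[OF l]) auto
  then obtain y0 where y0: "y0 \<in> cball z r" "\<And>y. y \<in> cball z r \<Longrightarrow> G y0 \<le> G y"
    using continuous_attains_inf[of "cball z r" G] r by auto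
  have G0: "G y0 > 0" unfolding G_def using kernel_gap[OF l x nl xy] y0(1) by force
  have "L \<le> - (g z / 2 * G y0) * measure lborel (ball z r)"
  proof (rule antisym_max[OF l x g anti L])
    show "ball z r \<inter> ball x r = {}"
    proof -
      have False if "dist z w < r" "dist x w < r" for w
        using dist_triangle2[of x z w] that r by simp
      then show ?thesis by auto
    qed
    fix y assume "y \<in> ball z r"
    then have y: "y \<in> cball z r" "dist z y < r" by auto
    show "norm y > l" by (rule nl[OF y(1)])
    have "g z / 2 * G y0 \<le> g y * G y"
      using d(2)[of y] y y0 G0 z r by (intro mult_mono) auto
    then show "g z / 2 * G y0 \<le> (g y - g x) * (1 / norm (x - y) powr eb - 1 / rdist l x y powr eb) - g x / rdist l x y powr eb"
      using gx by (simp add: G_def)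
  qed (use gx r emeasure_lborel_ball_finite in auto)
  also have "\<dots> < 0" using z G0 r by (intro mult_neg_pos) auto
  finally show ?thesis .
qed

subsection \<open>Lower bounds at infinity\<close>

text \<open>A perturbation that vanishes at \<open>x\<close> enters through an ordinary integral.
  Mass added away from \<open>x\<close> lowers the value at \<open>x\<close>, which is how barriers
  are given their sign.\<close>

lemma flap_perturb:
  assumes w: "flap w x L" and h: "integrable lborel (\<lambda>y. h y / norm (x - y) powr eb)" "h x = 0"
  shows "flap (\<lambda>y. w y + h y) x (L - (\<integral>y. h y / norm (x - y) powr eb \<partial>lborel))"
proof -
  from pv_int_add[OF w[unfolded flap_def] pv_int_cmult[OF pv_int_integrable[OF h(1)], of "-1"]]
  show ?thesis
    unfolding flap_def using h(2) by (simp add: diff_divide_distrib algebra_simps add_divide_distrib)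
qed

lemma flap_zero: "flap (\<lambda>_. 0) x 0"
  by (simp add: flap_def pv_int_def)

lemma lip_at_locally_zero:
  fixes f :: "'a::metric_space \<Rightarrow> real"
  assumes "d > 0" "\<And>y. dist x y < d \<Longrightarrow> f y = 0"
  shows "lip_at f x"
  unfolding lip_at_def using assms by (intro exI[where x = 0] exI[where x = d]) auto

lemma riesz_pos: "y \<noteq> 0 \<Longrightarrow> riesz y > 0" and riesz_nonneg: "riesz y \<ge> 0"
  by (auto simp: riesz_def)

lemma riesz_antimono: "0 < r \<Longrightarrow> r \<le> norm y \<Longrightarrow> riesz y \<le> r powr - ea"
  unfolding riesz_def using ea_pos by (intro powr_mono2') auto

lemma riesz_continuous: "0 \<notin> A \<Longrightarrow> continuous_on A riesz"
  unfolding riesz_def[abs_def] by (intro continuous_intros) auto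

text \<open>Inversion in the sphere of radius \<open>r\<close> exchanges the singularity of
  \<open>riesz\<close> at the origin with the tail of the kernel at infinity.\<close>

lemma integrable_riesz_ball:
  assumes r: "r > 0"
  shows "integrable_over (ball 0 r) riesz"
proof -
  have tr: "(r / norm z) ^ (2 * CARD('n)) * riesz (inversion r z) = r powr (eb - ea) * (1 / norm z powr eb)"
    if z: "z \<noteq> 0" for z
  proof -
    have t: "norm z > 0" using z by simp
    have "(r / norm z) ^ (2 * CARD('n)) = (r / norm z) powr ea * (r / norm z) powr eb"
      using r t ea_eb by (simp add: powr_realpow[symmetric] powr_add[symmetric])
    then show ?thesis
      using r t by (simp add: riesz_def norm_inversion powr_minus_divide powr_mult powr_divide power2_eq_square powr_diff)
  qed
  have "integrable lborel (\<lambda>z::real^'n. indicator (- ball 0 r) z * (1 / norm z powr eb))"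
    using integrable_powr_tail_0[OF r] by simp
  \<comment> \<open>The preimage of the ball consists of the exterior and the origin, and at the
    origin the integrand is \<open>1 / 0 = 0\<close>.\<close>
  then have "integrable lborel (\<lambda>z::real^'n. indicator (inversion r -` ball 0 r \<inter> - ball 0 r) z * (1 / norm z powr eb))"
    by (rule integrable_indicator_mono) auto
  also have "(\<lambda>z::real^'n. indicator (inversion r -` ball 0 r \<inter> - ball 0 r) z * (1 / norm z powr eb))
      = (\<lambda>z. indicator (inversion r -` ball 0 r) z * (1 / norm z powr eb))"
  proof
    fix z :: "real^'n"
    show "indicator (inversion r -` ball 0 r \<inter> - ball 0 r) z * (1 / norm z powr eb)
        = indicator (inversion r -` ball 0 r) z * (1 / norm z powr eb)"
    proof (cases "norm z < r \<and> z \<noteq> 0")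
      case True
      then have "r * r / norm z > r" using r by (subst pos_less_divide_eq) auto
      then show ?thesis using True by (simp add: indicator_def norm_inversion power2_eq_square)
    qed (auto simp: indicator_def)
  qed
  finally show ?thesis
    by (subst transport_integral(1)[OF r _ _ _ _ tr]) (use r in auto)
qed

lemma far_kernel:
  fixes x y :: "real^'n"
  assumes "norm y \<le> norm x / 2" "x \<noteq> 0"
  shows "1 / norm (x - y) powr eb \<le> (norm x / 2) powr - eb"
proof -
  have "norm x / 2 \<le> norm (x - y)" using norm_triangle_ineq2[of x y] assms by simp
  then show ?thesis using assms eb_pos by (subst powr_minus_divide[symmetric]) (intro powr_mono2', auto)
qed

lemma integrable_far:
  fixes h :: "real^'n \<Rightarrow> real"
  assumes h: "integrable lborel h" "\<And>y. norm y \<ge> R \<Longrightarrow> h y = 0" and x: "norm x \<ge> 2 * R" "x \<noteq> 0"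
  shows "integrable lborel (\<lambda>y. h y / norm (x - y) powr eb)"
proof (rule Bochner_Integration.integrable_bound[OF integrable_mult_right[OF h(1), of "(norm x / 2) powr - eb"]])
  have [measurable]: "h \<in> borel_measurable borel" using h by auto
  show "(\<lambda>y. h y / norm (x - y) powr eb) \<in> borel_measurable lborel" by measurable
  show "AE y in lborel. norm (h y / norm (x - y) powr eb) \<le> norm ((norm x / 2) powr - eb * h y)"
  proof (rule always_eventually, rule allI)
    fix y show "norm (h y / norm (x - y) powr eb) \<le> norm ((norm x / 2) powr - eb * h y)"
    proof (cases "norm y < R")
      case True
      then show ?thesis
        using mult_right_mono[OF far_kernel[of y x], of "\<bar>h y\<bar>"] x by (simp add: abs_mult)
    qed (use h in auto)
  qed
qed

text \<open>The lower bound tends to 0 at infinity, so values below \<open>W x1 < 0\<close> can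
  occur only in a bounded region, where compactness applies.\<close>

lemma exterior_minimum:
  fixes W :: "real^'n \<Rightarrow> real"
  assumes cont: "continuous_on {y. r \<le> norm y} W" and r: "r > 0"
    and low: "\<And>y. norm y \<ge> r \<Longrightarrow> W y \<ge> - c * riesz y" and c: "c > 0"
    and x1: "norm x1 \<ge> r" "W x1 < 0"
  obtains x0 where "norm x0 \<ge> r" "W x0 < 0" "\<And>y. norm y \<ge> r \<Longrightarrow> W x0 \<le> W y"
proof -
  \<comment> \<open>Beyond this radius \<open>c * riesz\<close> is at most
    \<open>- W x1\<close>.\<close>
  define R where "R = max (norm x1) ((c / (- W x1)) powr (1 / ea))"
  have R: "R \<ge> norm x1" "R > 0" "R \<ge> (c / (- W x1)) powr (1 / ea)" using x1 r by (auto simp: R_def)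
  let ?S = "cball (0::real^'n) R \<inter> {y. r \<le> norm y}"
  have cl: "closed {y::real^'n. r \<le> norm y}" by (intro closed_Collect_le continuous_intros)
  have "compact ?S" by (intro compact_Int_closed compact_cball cl)
  moreover have "x1 \<in> ?S" using R x1 by auto
  moreover have "continuous_on ?S W" using cont by (rule continuous_on_subset) auto
  ultimately have "\<exists>x\<in>?S. \<forall>y\<in>?S. W x \<le> W y"
    by (intro continuous_attains_inf) blast+
  then obtain x0 where x0: "x0 \<in> ?S" "\<And>y. y \<in> ?S \<Longrightarrow> W x0 \<le> W y"
    by blast
  have W01: "W x0 \<le> W x1" using x0(2) \<open>x1 \<in> ?S\<close> by auto
  show ?thesis
  proof (rule that[of x0])
    show "norm x0 \<ge> r" using x0 by auto
    show "W x0 < 0" using W01 x1 by simp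
    fix y :: "real^'n" assume y: "norm y \<ge> r"
    show "W x0 \<le> W y"
    proof (cases "norm y \<le> R")
      case True
      then show ?thesis using x0 y by auto
    next
      case False
      have "c / (- W x1) = ((c / (- W x1)) powr (1 / ea)) powr ea"
        using c x1 ea_pos by (simp add: powr_powr)
      also have "\<dots> \<le> R powr ea" using R ea_pos by (intro powr_mono2) auto
      finally have "c / (- W x1) \<le> R powr ea" .
      then have "c * R powr - ea \<le> - W x1"
        using x1 R by (simp add: powr_minus_divide field_simps)
      moreover have "c * riesz y \<le> c * R powr - ea"
        using c R False by (intro mult_left_mono riesz_antimono) auto
      ultimately show ?thesis using low[OF y] W01 by simp
    qed
  qed
qed

text \<open>The barrier \<phi> equals \<open>riesz\<close> outside the unit ball and a constant
  \<open>A\<close> inside. Replacing the unbounded part of \<open>riesz\<close> loses mass, but a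
  large \<open>A\<close> overcompensates for this and makes \<phi> a subsolution where
  \<open>norm x \<ge> 2\<close>. A negative exterior minimum of \<open>u\<close> minus a multiple of
  \<phi> is then impossible.\<close>

theorem superharmonic_lower_bound:
  fixes u :: "real^'n \<Rightarrow> real"
  assumes cont: "continuous_on UNIV u" and pos: "\<And>x. u x > 0" and sup: "\<And>x. \<exists>L\<ge>0. flap u x L"
  shows "\<exists>c>0. \<forall>x. 1 \<le> norm x \<longrightarrow> c * riesz x \<le> u x"
proof -
  define V where "V = measure lborel (ball (0::real^'n) 1)"
  have V: "V > 0" unfolding V_def by simp
  define R0 where "R0 = integral_over (ball 0 1) riesz"
  have i0: "integrable_over (ball 0 1) riesz" by (rule integrable_riesz_ball) simp
  have R0: "R0 \<ge> 0" unfolding R0_def by (intro integral_nonneg_AE) (auto simp: riesz_nonneg)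
  \<comment> \<open>For \<open>norm x \<ge> 2\<close> and \<open>norm y < 1\<close> the distance
    from \<open>x\<close> to \<open>y\<close> lies between one and three times
    \<open>norm x / 2\<close>. The factor \<open>3 powr eb\<close> is the resulting ratio of
    kernels.\<close>
  define A where "A = 3 powr eb * R0 / V + 1"
  have A: "A \<ge> 1" using V R0 by (simp add: A_def)
  define h where "h y = indicator (ball 0 1) y * A - indicator (ball 0 1) y * riesz y" for y
  define \<phi> where "\<phi> y = riesz y + h y" for y
  have i1: "integrable lborel (\<lambda>y::real^'n. indicator (ball 0 1) y * A)"
    using emeasure_lborel_ball_finite by (intro integrable_mult_left integrable_real_indicator) auto
  have ih: "integrable lborel h" unfolding h_def[abs_def] using i0 i1 by simp
  have sub: "\<exists>L\<le>0. flap \<phi> x L" if x: "norm x \<ge> 2" for x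
  proof -
    have x0: "x \<noteq> 0" using x by auto
    have ik: "integrable lborel (\<lambda>y. h y / norm (x - y) powr eb)"
      by (rule integrable_far[OF ih, of 1]) (use x in \<open>auto simp: h_def\<close>)
    have fl: "flap \<phi> x (0 - (\<integral>y. h y / norm (x - y) powr eb \<partial>lborel))"
      unfolding \<phi>_def by (rule flap_perturb[OF flap_riesz[OF x0] ik]) (use x in \<open>simp add: h_def\<close>)
    have "0 \<le> (norm x / 2) powr - eb * (A * V / 3 powr eb - R0)"
    proof -
      have "R0 \<le> A * V / 3 powr eb" using V by (simp add: A_def field_simps)
      then show ?thesis by simp
    qed
    also have "\<dots> = (\<integral>y. (norm x / 2) powr - eb * (indicator (ball 0 1) y * A / 3 powr eb - indicator (ball 0 1) y * riesz y) \<partial>lborel)"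
      using i0 i1 by (simp add: R0_def V_def mult.commute)
    also have "\<dots> \<le> (\<integral>y. h y / norm (x - y) powr eb \<partial>lborel)"
    proof (rule integral_mono[OF _ ik])
      show "integrable lborel (\<lambda>y. (norm x / 2) powr - eb * (indicator (ball 0 1) y * A / 3 powr eb - indicator (ball 0 1) y * riesz y))"
        using i0 i1 by simp
      fix y :: "real^'n"
      show "(norm x / 2) powr - eb * (indicator (ball 0 1) y * A / 3 powr eb - indicator (ball 0 1) y * riesz y) \<le> h y / norm (x - y) powr eb"
      proof (cases "norm y < 1")
        case True
        have n1: "norm (x - y) \<le> 3 * (norm x / 2)" using norm_triangle_ineq4[of x y] True x by simp
        have n2: "norm (x - y) > 0" using True x by auto
        have "(norm x / 2) powr - eb / 3 powr eb = 1 / (3 * (norm x / 2)) powr eb"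
          by (simp only: powr_mult powr_minus_divide) simp
        also have "\<dots> \<le> 1 / norm (x - y) powr eb"
          using n1 n2 eb_pos x by (intro divide_left_mono powr_mono2 mult_pos_pos) auto
        finally have k1: "A * ((norm x / 2) powr - eb / 3 powr eb) \<le> A * (1 / norm (x - y) powr eb)"
          using A by (intro mult_left_mono) auto
        have k2: "riesz y * (1 / norm (x - y) powr eb) \<le> riesz y * (norm x / 2) powr - eb"
          using far_kernel[of y x] True x x0 by (intro mult_left_mono riesz_nonneg) auto
        show ?thesis using True k1 k2 by (simp add: h_def diff_divide_distrib algebra_simps)
      qed (simp add: h_def)
    qed
    finally show ?thesis using fl by (intro exI[of _ "0 - (\<integral>y. h y / norm (x - y) powr eb \<partial>lborel)"]) simp
  qed
  obtain m where m: "m > 0" "\<And>y. norm y \<le> 2 \<Longrightarrow> m \<le> u y"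
  proof -
    have "\<exists>y0\<in>cball 0 2. \<forall>y\<in>cball 0 2. u y0 \<le> u y"
      by (intro continuous_attains_inf continuous_on_subset[OF cont]) auto
    then obtain y0 where "\<forall>y\<in>cball 0 2. u y0 \<le> u y" by blast
    then show ?thesis using that[of "u y0"] pos by auto
  qed
  define c where "c = m / A"
  have c: "c > 0" using m A by (simp add: c_def)
  have \<phi>A: "\<phi> y \<le> A" for y
    using riesz_antimono[of 1 y] A by (cases "norm y < 1") (auto simp: \<phi>_def h_def)
  have in2: "c * \<phi> y \<le> u y" if "norm y \<le> 2" for y
  proof -
    have "c * \<phi> y \<le> c * A" using \<phi>A c by (intro mult_left_mono) auto
    also have "\<dots> = m" using A by (simp add: c_def)
    finally show ?thesis using m(2)[OF that] by simp
  qed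
  define W where "W y = u y + (- c) * \<phi> y" for y
  have \<phi>1: "\<phi> y = riesz y" if "norm y \<ge> 1" for y using that by (simp add: \<phi>_def h_def)
  have nonneg: "W y \<ge> 0" if y2: "norm y \<ge> 2" for y
  proof (rule ccontr)
    assume "\<not> W y \<ge> 0"
    then have Wy: "W y < 0" by simp
    have "continuous_on {y. 2 \<le> norm y} (\<lambda>y. u y + (- c) * riesz y)"
      by (intro continuous_intros riesz_continuous continuous_on_subset[OF cont]) auto
    then have cW: "continuous_on {y. 2 \<le> norm y} W"
      by (rule continuous_on_eq) (auto simp: W_def \<phi>1)
    obtain x0 where x0: "norm x0 \<ge> 2" "W x0 < 0" "\<And>y. norm y \<ge> 2 \<Longrightarrow> W x0 \<le> W y"
    proof (rule exterior_minimum[OF cW _ _ c y2 Wy])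
      show "- c * riesz z \<le> W z" if "norm z \<ge> 2" for z
        using that pos[of z] by (simp add: W_def \<phi>1 less_imp_le)
    qed auto
    have W2: "W z \<ge> 0" if "norm z \<le> 2" for z using in2[OF that] by (simp add: W_def)
    \<comment> \<open>Since \<open>W\<close> is nonnegative on the ball of radius 2, the exterior
      minimum is a global one, and the maximum principle applies directly, without folding.\<close>
    then have gmin: "W x0 \<le> W z" for z
      using x0 by (cases "norm z \<le> 2") (force, auto)
    obtain L1 L2 where L: "L1 \<ge> 0" "flap u x0 L1" "L2 \<le> 0" "flap \<phi> x0 L2" using sup sub[OF x0(1)] by blast
    have fW: "flap W x0 (L1 + (- c) * L2)"
      unfolding W_def[abs_def] by (intro flap_add flap_cmult L)
    define \<kappa> where "\<kappa> = - W x0 / (norm x0 + 1) powr eb"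
    have "L1 + (- c) * L2 \<le> - \<kappa> * measure lborel (ball (0::real^'n) 1)"
    proof (rule pv_int_upper[OF fW[unfolded flap_def]])
      show "(W x0 - W y) / norm (x0 - y) powr eb \<le> 0" for y
        using gmin by (intro divide_nonpos_nonneg) auto
      show "ball (0::real^'n) 1 \<inter> ball x0 1 = {}"
      proof -
        have False if "norm z < 1" "dist x0 z < 1" for z
          using that norm_triangle_ineq2[of x0 z] x0 by (simp add: dist_norm)
        then show ?thesis by auto
      qed
      fix y :: "real^'n" assume "y \<in> ball 0 1"
      then have y: "norm y < 1" by simp
      have "- W x0 / (norm x0 + 1) powr eb \<le> (W y - W x0) / norm (x0 - y) powr eb"
      proof (rule frac_le)
        show "- W x0 \<le> W y - W x0" "0 \<le> W y - W x0" using W2[of y] y x0(2) by auto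
        have "norm (x0 - y) > 0" using y x0 by auto
        then show "0 < norm (x0 - y) powr eb" by simp
        show "norm (x0 - y) powr eb \<le> (norm x0 + 1) powr eb"
          using norm_triangle_ineq4[of x0 y] y eb_pos by (intro powr_mono2) auto
      qed
      then show "(W x0 - W y) / norm (x0 - y) powr eb \<le> - \<kappa>"
        by (simp add: \<kappa>_def diff_divide_distrib)
    qed (use emeasure_lborel_ball_finite in auto)
    moreover have "\<kappa> > 0" unfolding \<kappa>_def using x0 by (intro divide_pos_pos) auto
    then have "- \<kappa> * measure lborel (ball (0::real^'n) 1) < 0"
      using V by (intro mult_neg_pos) (auto simp: V_def)
    moreover have "0 \<le> L1 + (- c) * L2" using L c mult_nonneg_nonpos[of c L2] by simp
    ultimately show False by linarith
  qed
  have "c * riesz y \<le> u y" if "norm y \<ge> 1" for y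
    using nonneg[of y] in2[of y] \<phi>1[OF that] by (cases "norm y \<le> 2") (auto simp: W_def)
  then show ?thesis using c by blast
qed

lemma rdist_symmetric:
  assumes l: "l > 0" and "x \<noteq> 0" "z \<noteq> 0"
  shows "rdist l x z = norm x * norm (inversion l x - z) / l"
proof -
  have "norm (inversion l x - z) = norm (inversion l x - inversion l (inversion l z))"
    using assms by (simp add: inversion_inversion)
  also have "\<dots> = l\<^sup>2 * norm (x - inversion l z) / (norm x * norm (inversion l z))"
    using assms by (intro norm_inversion_diff) (auto simp: inversion_eq_0_iff)
  also have "\<dots> = norm z * norm (x - inversion l z) / norm x"
    using assms by (simp add: norm_inversion)
  finally show ?thesis using assms by (simp add: rdist_def)
qed

text \<open>As \<open>x\<close> tends to infinity, the reflected distance to a point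
  \<open>y\<close> of an annulus off the sphere exceeds the direct one by a fixed ratio, so the gap
  remains a fixed fraction of the kernel itself.\<close>

lemma kernel_gap_far:
  assumes l: "l > 0" and \<mu>: "\<mu> > l"
  obtains \<theta> where "\<theta> > 0" "\<And>x y :: real^'n. norm x \<ge> 4 * \<mu> \<Longrightarrow> norm y \<ge> \<mu> \<Longrightarrow> norm y \<le> 2 * \<mu> \<Longrightarrow>
     \<theta> * norm x powr - eb \<le> 1 / norm (x - y) powr eb - 1 / rdist l x y powr eb"
proof -
  \<comment> \<open>The 8 comes from \<open>d\<^sup>2 \<le> 4 * (norm x)\<^sup>2\<close> together
    with \<open>l\<^sup>2 \<le> (norm x)\<^sup>2 / 2\<close>.\<close>
  define \<eta> where "\<eta> = (\<mu>\<^sup>2 - l\<^sup>2) / (8 * l\<^sup>2)"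
  have \<eta>: "\<eta> > 0" using l \<mu> by (simp add: \<eta>_def power_strict_mono)
  define q where "q = (1 + \<eta>) powr (- eb / 2)"
  have "q < (1 + \<eta>) powr 0" unfolding q_def using \<eta> eb_pos by (intro powr_less_mono) auto
  then have q: "q < 1" using \<eta> by simp
  show ?thesis
  proof (rule that[of "(1 - q) * 2 powr - eb"])
    show "(1 - q) * 2 powr - eb > 0" using q by simp
    fix x y :: "real^'n" assume x: "norm x \<ge> 4 * \<mu>" and y: "norm y \<ge> \<mu>" "norm y \<le> 2 * \<mu>"
    define d where "d = norm (x - y)"
    have pos: "norm x > 0" "y \<noteq> 0" "x \<noteq> y" using x y l \<mu> by auto
    have d: "d > 0" using pos by (simp add: d_def)
    have d2: "d \<le> 2 * norm x" using norm_triangle_ineq4[of x y] x y \<mu> l by (simp add: d_def)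
    have "l\<^sup>2 \<le> (norm x)\<^sup>2 / 2"
    proof -
      have "(2 * l)\<^sup>2 \<le> (norm x)\<^sup>2" using x \<mu> l by (intro power_mono) auto
      then have "4 * l\<^sup>2 \<le> (norm x)\<^sup>2" by (simp add: power_mult_distrib)
      then show ?thesis using zero_le_power2[of l] by linarith
    qed
    moreover have "d\<^sup>2 \<le> (2 * norm x)\<^sup>2" using d2 d by (intro power_mono) auto
    ultimately have "d\<^sup>2 / 8 \<le> (norm x)\<^sup>2 - l\<^sup>2" by (simp add: power_mult_distrib)
    moreover have "\<mu>\<^sup>2 \<le> (norm y)\<^sup>2" using y \<mu> l by (intro power_mono) auto
    ultimately have "(d\<^sup>2 / 8) * (\<mu>\<^sup>2 - l\<^sup>2) \<le> ((norm x)\<^sup>2 - l\<^sup>2) * ((norm y)\<^sup>2 - l\<^sup>2)"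
      using \<mu> l d x by (intro mult_mono) (auto simp: power_mono)
    then have "(d\<^sup>2 / 8) * (\<mu>\<^sup>2 - l\<^sup>2) / l\<^sup>2 \<le> ((norm x)\<^sup>2 - l\<^sup>2) * ((norm y)\<^sup>2 - l\<^sup>2) / l\<^sup>2"
      using l by (intro divide_right_mono) auto
    then have r2: "d\<^sup>2 * (1 + \<eta>) \<le> (rdist l x y)\<^sup>2"
      unfolding rdist_square[OF l pos(2)] d_def[symmetric] \<eta>_def by (simp add: algebra_simps)
    have r0: "rdist l x y \<ge> 0" using l by (rule rdist_nonneg)
    have rp: "rdist l x y > 0"
    proof -
      have "0 < d\<^sup>2 * (1 + \<eta>)" using d \<eta> by simp
      with r2 have "rdist l x y \<noteq> 0" by auto
      with r0 show ?thesis by simp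
    qed
    have "1 / rdist l x y powr eb = ((rdist l x y)\<^sup>2) powr (- eb / 2)"
      using rp by (simp add: powr_minus_divide[symmetric] powr_powr flip: powr_numeral)
    also have "\<dots> \<le> (d\<^sup>2 * (1 + \<eta>)) powr (- eb / 2)"
      using r2 d \<eta> eb_pos by (intro powr_mono2') auto
    also have "\<dots> = (d\<^sup>2) powr (- eb / 2) * q" by (simp add: powr_mult q_def)
    also have "(d\<^sup>2) powr (- eb / 2) = 1 / d powr eb"
      using d by (simp add: powr_minus_divide[symmetric] powr_powr flip: powr_numeral)
    finally have "(1 - q) * (1 / d powr eb) \<le> 1 / d powr eb - 1 / rdist l x y powr eb"
      by (simp add: algebra_simps diff_divide_distrib)
    moreover have "2 powr - eb * norm x powr - eb \<le> 1 / d powr eb"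
    proof -
      have "2 powr - eb * norm x powr - eb = 1 / (2 * norm x) powr eb" by (simp add: powr_mult powr_minus_divide)
      also have "\<dots> \<le> 1 / d powr eb" using d d2 eb_pos by (intro divide_left_mono powr_mono2 mult_pos_pos) auto
      finally show ?thesis .
    qed
    then have "(1 - q) * (2 powr - eb * norm x powr - eb) \<le> (1 - q) * (1 / d powr eb)"
      using q by (intro mult_left_mono) auto
    ultimately show "(1 - q) * 2 powr - eb * norm x powr - eb \<le> 1 / norm (x - y) powr eb - 1 / rdist l x y powr eb"
      unfolding d_def[symmetric] by (simp add: mult.assoc)
  qed
qed

text \<open>An antisymmetric subsolution near infinity: the Riesz kernel outside a ball plus a large bump on an annulus,
  minus its Kelvin transform.\<close>

lemma antisym_barrier:
  assumes l: "l > 0" and \<mu>: "\<mu> > l"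
  obtains \<psi> M where "\<psi> \<in> borel_measurable borel" "M > 0"
    "\<And>y. norm y \<ge> 2 * \<mu> \<Longrightarrow> \<psi> y = riesz y" "\<And>y. norm y < \<mu> \<Longrightarrow> \<psi> y = 0" "\<And>y. \<psi> y \<le> M"
    "\<And>x. norm x \<ge> 4 * \<mu> \<Longrightarrow> \<exists>L\<le>0. flap (\<lambda>y. \<psi> y - kelvin l \<psi> y) x L"
proof -
  define R where "R = 2 * \<mu>"
  have R: "R > 0" "R > \<mu>" "\<mu> > 0" using l \<mu> by (auto simp: R_def)
  define D where "D = (ball 0 R - ball 0 \<mu> :: (real^'n) set)"
  have [measurable]: "D \<in> sets borel" by (simp add: D_def)
  have Dm: "y \<in> D \<longleftrightarrow> \<mu> \<le> norm y \<and> norm y < R" for y by (auto simp: D_def)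
  obtain \<theta> where \<theta>: "\<theta> > 0" "\<And>x y :: real^'n. norm x \<ge> 4 * \<mu> \<Longrightarrow> norm y \<ge> \<mu> \<Longrightarrow> norm y \<le> 2 * \<mu> \<Longrightarrow>
     \<theta> * norm x powr - eb \<le> 1 / norm (x - y) powr eb - 1 / rdist l x y powr eb"
    using kernel_gap_far[OF l \<mu>] by blast
  define V where "V = measure lborel D"
  have V: "V > 0"
  proof -
    have "V = measure lborel (ball (0::real^'n) R) - measure lborel (ball (0::real^'n) \<mu>)"
      unfolding V_def D_def using R emeasure_lborel_ball_finite[of "0::real^'n" R]
      by (intro measure_Diff) auto
    also have "\<dots> = unit_ball_vol (real CARD('n)) * (R ^ CARD('n) - \<mu> ^ CARD('n))"
      using R by (simp add: content_ball algebra_simps)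
    also have "\<dots> > 0" using R by (intro mult_pos_pos) (auto simp: power_strict_mono)
    finally show ?thesis .
  qed
  have Df: "emeasure lborel D < \<infinity>"
    using emeasure_mono[of D "ball 0 R" lborel] emeasure_lborel_ball_finite[of "0::real^'n" R]
    by (auto simp: D_def order_le_less_trans)
  \<comment> \<open>\<open>B1\<close> accounts for the part of \<open>riesz\<close> cut off inside
    the ball, \<open>B2\<close> for the Kelvin image of its tail. These losses and the gain
    \<open>M * \<theta> * V\<close> from the bump all scale like \<open>norm x powr - eb\<close>, so
    one \<open>M\<close> serves every \<open>x\<close>.\<close>
  define B1 where "B1 = 2 powr eb * integral_over (ball 0 R) riesz"
  define B2 where "B2 = (2 * l) powr eb * R powr - ea * (\<integral>(y::real^'n). indicator (- ball 0 R) y / norm y powr eb \<partial>lborel)"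
  have iR: "integrable_over (ball 0 R) riesz" by (rule integrable_riesz_ball[OF R(1)])
  have iT: "integrable lborel (\<lambda>y::real^'n. indicator (- ball 0 R) y / norm y powr eb)" by (rule integrable_powr_tail_0[OF R(1)])
  have iD: "integrable lborel (\<lambda>y::real^'n. indicator D y :: real)" using Df by (intro integrable_real_indicator) auto
  define M where "M = (\<bar>B1\<bar> + \<bar>B2\<bar>) / (\<theta> * V) + R powr - ea"
  have "R powr - ea > 0" using R by simp
  moreover have "(\<bar>B1\<bar> + \<bar>B2\<bar>) / (\<theta> * V) \<ge> 0" using \<theta> V by (intro divide_nonneg_nonneg) auto
  ultimately have M: "M > 0" "R powr - ea \<le> M" by (auto simp: M_def intro: add_nonneg_pos)
  have MB: "B1 + B2 \<le> M * \<theta> * V"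
  proof -
    have k: "\<theta> * V > 0" using \<theta> V by simp
    have "\<bar>B1\<bar> + \<bar>B2\<bar> = (\<bar>B1\<bar> + \<bar>B2\<bar>) / (\<theta> * V) * (\<theta> * V)" using k by (metis less_irrefl nonzero_eq_divide_eq)
    also have "\<dots> \<le> ((\<bar>B1\<bar> + \<bar>B2\<bar>) / (\<theta> * V) + R powr - ea) * (\<theta> * V)"
      using k by (intro mult_right_mono) auto
    finally have "B1 + B2 \<le> ((\<bar>B1\<bar> + \<bar>B2\<bar>) / (\<theta> * V) + R powr - ea) * (\<theta> * V)" by linarith
    then show ?thesis by (simp add: M_def mult.assoc)
  qed
  define \<psi> where "\<psi> y = indicator (- ball 0 R) y * riesz y + M * indicator D y" for y
  define h where "h y = M * indicator D y - indicator (ball 0 R) y * riesz y" for y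
  have [measurable]: "\<psi> \<in> borel_measurable borel" unfolding \<psi>_def[abs_def] by measurable
  have \<psi>h: "\<psi> = (\<lambda>y. riesz y + h y)" by (auto simp: \<psi>_def h_def fun_eq_iff indicator_def)
  have ih: "integrable lborel h" unfolding h_def[abs_def] using iR iD by simp
  have sub: "\<exists>L\<le>0. flap (\<lambda>y. \<psi> y - kelvin l \<psi> y) x L" if x: "norm x \<ge> 4 * \<mu>" for x
  proof -
    let ?X = "inversion l x"
    let ?K = "\<lambda>y. norm (?X - y) powr eb" and ?k = "\<lambda>y. norm (x - y) powr eb" and ?c = "(l / norm x) powr eb"
    let ?T = "\<lambda>y. indicator (- ball 0 R) y / norm y powr eb" and ?B = "\<lambda>y. indicator (ball 0 R) y * riesz y"
    let ?O = "\<lambda>y. indicator (- ball 0 R) y * riesz y" and ?M = "\<lambda>y. M * indicator D y"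
    let ?C2 = "(2 * l) powr eb * R powr - ea"
    have x0: "x \<noteq> 0" "norm x > 0" "norm x \<ge> 2 * R" using x R by (auto simp: R_def)
    have X: "norm ?X < l" using x l \<mu> by (intro norm_inversion_less) auto
    have ik: "integrable lborel (\<lambda>y. h y / ?k y)"
      by (rule integrable_far[OF ih, of R]) (use x0 R in \<open>auto simp: h_def Dm\<close>)
    have f1: "flap \<psi> x (0 - (\<integral>y. h y / ?k y \<partial>lborel))"
      unfolding \<psi>h by (rule flap_perturb[OF flap_riesz[OF x0(1)] ik]) (use x0 R in \<open>auto simp: h_def Dm\<close>)
    have Xfar: "norm y / 2 \<le> norm (?X - y)" if "R \<le> norm y" for y
      using norm_triangle_ineq2[of y ?X] X that \<mu> by (simp add: R_def norm_minus_commute)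
    have Xfar': "\<mu> - l \<le> norm (?X - y)" if "\<mu> \<le> norm y" for y
      using norm_triangle_ineq2[of y ?X] X that by (simp add: norm_minus_commute)
    define Bnd where "Bnd y = 2 powr eb * R powr - ea * ?T y
      + M / (\<mu> - l) powr eb * indicator D y" for y :: "real^'n"
    have \<psi>nn: "\<psi> y \<ge> 0" for y using M by (auto simp: \<psi>_def riesz_nonneg)
    have far: "?O y / ?K y
        \<le> 2 powr eb * R powr - ea * ?T y" for y
    proof (cases "R \<le> norm y")
      case True
      have "1 / ?K y \<le> 1 / (norm y / 2) powr eb"
        using Xfar[OF True] True R eb_pos by (intro divide_left_mono powr_mono2 mult_pos_pos) auto
      also have "\<dots> = 2 powr eb * (1 / norm y powr eb)" by (simp add: powr_divide)
      finally have "riesz y * (1 / ?K y) \<le> R powr - ea * (2 powr eb * (1 / norm y powr eb))"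
        using riesz_antimono[OF R(1) True] by (intro mult_mono) auto
      then show ?thesis using True by (simp add: mult_ac)
    qed (auto simp: indicator_def)
    have near: "?M y / ?K y \<le> M / (\<mu> - l) powr eb * indicator D y" for y
    proof (cases "y \<in> D")
      case True
      then have "M / ?K y \<le> M / (\<mu> - l) powr eb"
        using Xfar'[of y] M \<mu> eb_pos by (intro divide_left_mono powr_mono2 mult_pos_pos) (auto simp: Dm)
      then show ?thesis using True by simp
    qed auto
    have iX: "integrable lborel (\<lambda>y. \<psi> y / ?K y)"
    proof (rule Bochner_Integration.integrable_bound)
      show "integrable lborel Bnd" unfolding Bnd_def[abs_def] using iT iD by (intro Bochner_Integration.integrable_add integrable_mult_right) auto
      show "AE y in lborel. norm (\<psi> y / ?K y) \<le> norm (Bnd y)"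
      proof (rule always_eventually, rule allI)
        fix y
        have "\<psi> y / ?K y \<le> Bnd y"
          using add_mono[OF far[of y] near[of y]] by (simp add: \<psi>_def Bnd_def add_divide_distrib)
        moreover have "0 \<le> \<psi> y / ?K y" using \<psi>nn by simp
        ultimately show "norm (\<psi> y / ?K y) \<le> norm (Bnd y)" by simp
      qed
    qed measurable
    have \<psi>0: "\<psi> y = 0" if "norm y < \<mu>" for y using that R by (auto simp: \<psi>_def Dm)
    \<comment> \<open>The image point lies inside the sphere, where \<psi> vanishes, so \<psi> is
      viewed there as a perturbation of the zero function.\<close>
    have "flap (\<lambda>y. 0 + \<psi> y) ?X (0 - (\<integral>y. \<psi> y / ?K y \<partial>lborel))"
      by (rule flap_perturb[OF flap_zero iX]) (use \<psi>0 X \<mu> in auto)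
    then have f2: "flap \<psi> ?X (0 - (\<integral>y. \<psi> y / ?K y \<partial>lborel))" by simp
    have "lip_at \<psi> ?X"
    proof (rule lip_at_locally_zero[of "\<mu> - norm ?X"])
      show "\<mu> - norm ?X > 0" using X \<mu> by simp
      fix y assume "dist ?X y < \<mu> - norm ?X"
      then show "\<psi> y = 0" using norm_triangle_ineq2[of y ?X] by (intro \<psi>0) (simp add: dist_norm norm_minus_commute)
    qed
    from flap_kelvin[OF l x0(1) _ this f2]
    have f3: "flap (kelvin l \<psi>) x (?c * (0 - (\<integral>y. \<psi> y / ?K y \<partial>lborel)))" by simp
    from flap_add[OF f1 flap_cmult[OF f3, of "-1"]]
    have f4: "flap (\<lambda>y. \<psi> y - kelvin l \<psi> y) x
      (?c * (\<integral>y. \<psi> y / ?K y \<partial>lborel) - (\<integral>y. h y / ?k y \<partial>lborel))"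
      by simp
    have "?c * (\<integral>y. \<psi> y / ?K y \<partial>lborel) - (\<integral>y. h y / ?k y \<partial>lborel)
       = (\<integral>y. ?c * (\<psi> y / ?K y) - h y / ?k y \<partial>lborel)"
      by (simp only: Bochner_Integration.integral_diff[OF integrable_mult_right[OF iX] ik] integral_mult_right_zero)
    also have "\<dots> \<le> (\<integral>y. norm x powr - eb * (2 powr eb * ?B y
       + ?C2 * ?T y - M * \<theta> * indicator D y) \<partial>lborel)"
    proof (rule integral_mono)
      show "integrable lborel (\<lambda>y. ?c * (\<psi> y / ?K y) - h y / ?k y)"
        by (intro Bochner_Integration.integrable_diff integrable_mult_right iX ik)
      show "integrable lborel (\<lambda>y. norm x powr - eb * (2 powr eb * ?B y
       + ?C2 * ?T y - M * \<theta> * indicator D y))"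
        using iR iT iD by (intro Bochner_Integration.integrable_add Bochner_Integration.integrable_diff integrable_mult_right) auto
      fix y
      have e1: "?c * (?O y / ?K y)
         \<le> norm x powr - eb * (?C2 * ?T y)"
        using mult_left_mono[OF far[of y], of "?c"]
        by (simp add: powr_divide powr_mult powr_minus_divide mult_ac)
      \<comment> \<open>On the annulus the Kelvin weight turns the kernel at the image point into
        the reflected kernel at \<open>x\<close>; the bump and its Kelvin image together contribute
        \<open>- M\<close> times the kernel gap.\<close>
      have e2: "?c * (?M y / ?K y) - ?M y / ?k y
         \<le> norm x powr - eb * (- M * \<theta> * indicator D y)"
      proof (cases "y \<in> D")
        case True
        then have y: "\<mu> \<le> norm y" "norm y \<le> 2 * \<mu>" "y \<noteq> 0" using R by (auto simp: Dm R_def)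
        have kr: "?c / ?K y = 1 / rdist l x y powr eb"
          unfolding rdist_symmetric[OF l x0(1) y(3)] by (simp add: powr_divide powr_mult)
        have "?c * (?M y / ?K y)
            = M * (?c / ?K y)"
          using True by simp
        then have eq: "?c * (?M y / ?K y) = M * (1 / rdist l x y powr eb)"
          by (simp only: kr)
        have "M * (\<theta> * norm x powr - eb) \<le> M * (1 / ?k y - 1 / rdist l x y powr eb)"
          using \<theta>(2)[OF x y(1,2)] M by (intro mult_left_mono) auto
        then show ?thesis unfolding eq using True by (simp add: algebra_simps)
      qed auto
      have e3: "indicator (ball 0 R) y * riesz y / ?k y \<le> norm x powr - eb * (2 powr eb * ?B y)"
      proof (cases "norm y < R")
        case True
        have "1 / ?k y \<le> (norm x / 2) powr - eb"
          using True x0 by (intro far_kernel) auto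
        also have "\<dots> = norm x powr - eb * 2 powr eb" by (simp add: powr_divide powr_minus_divide)
        finally have "riesz y * (1 / ?k y) \<le> riesz y * (norm x powr - eb * 2 powr eb)"
          by (intro mult_left_mono riesz_nonneg)
        then show ?thesis using True by (simp add: mult_ac)
      qed auto
      have "?c * (\<psi> y / ?K y) - h y / ?k y
        = ?c * (?O y / ?K y)
          + (?c * (?M y / ?K y) - ?M y / ?k y)
          + indicator (ball 0 R) y * riesz y / ?k y"
        unfolding \<psi>_def h_def add_divide_distrib diff_divide_distrib distrib_left by simp
      also have "\<dots> \<le> norm x powr - eb * (?C2 * ?T y)
          + norm x powr - eb * (- M * \<theta> * indicator D y)
          + norm x powr - eb * (2 powr eb * ?B y)"
        by (intro add_mono e1 e2 e3)
      also have "\<dots> = norm x powr - eb * (2 powr eb * ?B y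
       + ?C2 * ?T y - M * \<theta> * indicator D y)"
        by (simp add: algebra_simps)
      finally show "?c * (\<psi> y / ?K y) - h y / ?k y \<le> \<dots>" .
    qed
    also have "\<dots> = norm x powr - eb * (B1 + B2 - M * \<theta> * V)"
      unfolding integral_mult_right_zero B1_def B2_def V_def
        Bochner_Integration.integral_diff[OF Bochner_Integration.integrable_add[OF integrable_mult_right[OF iR]
          integrable_mult_right[OF iT]] integrable_mult_right[OF iD]]
        Bochner_Integration.integral_add[OF integrable_mult_right[OF iR] integrable_mult_right[OF iT]]
      by simp
    also have "\<dots> \<le> 0" using MB by (intro mult_nonneg_nonpos) auto
    finally show ?thesis using f4 by blast
  qed
  show ?thesis
  proof (rule that[of \<psi> M])
    show "\<psi> y = riesz y" if "norm y \<ge> 2 * \<mu>" for y using that by (simp add: \<psi>_def Dm R_def)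
    show "\<psi> y = 0" if "norm y < \<mu>" for y using that R by (simp add: \<psi>_def Dm R_def)
    show "\<psi> y \<le> M" for y
    proof (cases "R \<le> norm y")
      case True
      then show ?thesis using riesz_antimono[OF R(1) True] M by (simp add: \<psi>_def Dm)
    next
      case False
      then show ?thesis using M by (simp add: \<psi>_def indicator_def)
    qed
  qed (use M sub in auto)
qed

text \<open>Comparison with a multiple of the barrier. The barrier vanishes outside the sphere up to
  radius \<mu>, so \<open>w\<close> may degenerate near the sphere. On the following annulus the
  positive minimum of \<open>w\<close> fixes the multiple, and further out
  \<open>antisym_neg\<close> excludes a negative minimum of the difference.\<close>

theorem antisym_lower_bound:
  assumes l: "l > 0" and [measurable]: "w \<in> borel_measurable borel" and anti: "antisym l w"
    and cont: "\<And>y. norm y > l \<Longrightarrow> isCont w y" and pos: "\<And>y. norm y > l \<Longrightarrow> w y > 0"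
    and sup: "\<And>x. norm x > l \<Longrightarrow> \<exists>L\<ge>0. flap w x L" and \<mu>: "\<mu> > l"
  shows "\<exists>\<kappa>>0. \<forall>y. \<mu> \<le> norm y \<longrightarrow> \<kappa> * riesz y \<le> w y"
proof -
  obtain \<psi> M where \<psi>: "\<psi> \<in> borel_measurable borel" "M > 0"
    "\<And>y. norm y \<ge> 2 * \<mu> \<Longrightarrow> \<psi> y = riesz y" "\<And>y. norm y < \<mu> \<Longrightarrow> \<psi> y = 0" "\<And>y. \<psi> y \<le> M"
    "\<And>x. norm x \<ge> 4 * \<mu> \<Longrightarrow> \<exists>L\<le>0. flap (\<lambda>y. \<psi> y - kelvin l \<psi> y) x L"
    using antisym_barrier[OF l \<mu>] by blast
  note [measurable] = \<psi>(1)
  define \<phi> where "\<phi> y = \<psi> y - kelvin l \<psi> y" for y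
  have \<phi>\<psi>: "\<phi> y = \<psi> y" if "norm y > l" for y
  proof -
    have "\<psi> (inversion l y) = 0" using norm_inversion_less[OF that l] \<mu> by (intro \<psi>(4)) simp
    then show ?thesis by (simp add: \<phi>_def kelvin_def)
  qed
  let ?A = "{y::real^'n. \<mu> \<le> norm y \<and> norm y \<le> 4 * \<mu>}"
  have A: "?A = cball 0 (4 * \<mu>) - ball 0 \<mu>" by auto
  have cA: "compact ?A" unfolding A by (intro compact_diff) auto
  have contw: "continuous_on S w" if "\<And>y. y \<in> S \<Longrightarrow> norm y > l" for S
    using cont that by (intro continuous_at_imp_continuous_on) auto
  obtain m where m: "m > 0" "\<And>y. y \<in> ?A \<Longrightarrow> m \<le> w y"
  proof -
    obtain y1 :: "real^'n" where "norm y1 = \<mu>" using vector_choose_size[of \<mu>] l \<mu> by auto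
    then have "y1 \<in> ?A" using l \<mu> by simp
    then have ne: "?A \<noteq> {}" by blast
    have "continuous_on ?A w" by (rule contw) (use \<mu> in auto)
    then have "\<exists>y0\<in>?A. \<forall>y\<in>?A. w y0 \<le> w y" using cA ne by (intro continuous_attains_inf)
    then obtain y0 where y0: "y0 \<in> ?A" "\<forall>y\<in>?A. w y0 \<le> w y" by blast
    then have "norm y0 > l" using \<mu> by simp
    then show ?thesis using that[of "w y0"] pos[of y0] y0(2) by simp
  qed
  define c where "c = m / M"
  have c: "c > 0" "c * M = m" using m \<psi>(2) by (auto simp: c_def)
  define W where "W y = w y + (- c) * \<phi> y" for y
  have inA: "W y \<ge> 0" if "norm y > l" "norm y \<le> 4 * \<mu>" for y
  proof (cases "norm y < \<mu>")
    case True
    then show ?thesis using pos[OF that(1)] \<psi>(4)[OF True] by (simp add: W_def \<phi>\<psi>[OF that(1)] less_imp_le)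
  next
    case False
    then have "m \<le> w y" using m that by auto
    moreover have "c * \<psi> y \<le> c * M" using c \<psi>(5) by (intro mult_left_mono) auto
    ultimately show ?thesis using c by (simp add: W_def \<phi>\<psi>[OF that(1)])
  qed
  have out: "W y = w y - c * riesz y" if "norm y \<ge> 2 * \<mu>" for y
    using that \<mu> l by (simp add: W_def \<phi>\<psi> \<psi>(3))
  have nonneg: "W y \<ge> 0" if y4: "norm y \<ge> 4 * \<mu>" for y
  proof (rule ccontr)
    assume "\<not> W y \<ge> 0"
    then have Wy: "W y < 0" by simp
    have "continuous_on {y. 4 * \<mu> \<le> norm y} (\<lambda>y. w y - c * riesz y)"
      by (intro continuous_intros riesz_continuous contw) (use \<mu> l in auto)
    then have cW: "continuous_on {y. 4 * \<mu> \<le> norm y} W"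
      by (rule continuous_on_eq) (use \<mu> l in \<open>auto simp: out\<close>)
    have mu4: "4 * \<mu> > 0" using \<mu> l by simp
    have low: "- c * riesz z \<le> W z" if "norm z \<ge> 4 * \<mu>" for z
      using that pos[of z] \<mu> l by (simp add: out less_imp_le)
    obtain x0 where x0: "norm x0 \<ge> 4 * \<mu>" "W x0 < 0" "\<And>y. norm y \<ge> 4 * \<mu> \<Longrightarrow> W x0 \<le> W y"
      using exterior_minimum[OF cW mu4 low c(1) y4 Wy] by blast
    have xl: "norm x0 > l" using x0 \<mu> l by simp
    obtain L1 L2 where L: "L1 \<ge> 0" "flap w x0 L1" "L2 \<le> 0" "flap \<phi> x0 L2"
      using sup[OF xl] \<psi>(6)[OF x0(1)] unfolding \<phi>_def[abs_def] by blast
    have fW: "flap W x0 (L1 + (- c) * L2)"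
      unfolding W_def[abs_def] by (intro flap_add flap_cmult L)
    have "L1 + (- c) * L2 < 0"
    proof (rule antisym_neg[OF l xl _ _ fW x0(2)])
      show "antisym l W" unfolding W_def[abs_def] \<phi>_def by (intro antisym_lincomb anti antisym_diff_kelvin l)
      have "\<phi> \<in> borel_measurable borel" unfolding \<phi>_def[abs_def] by measurable
      then show "W \<in> borel_measurable borel" unfolding W_def[abs_def] by measurable
      show "W x0 \<le> W z" if "l < norm z" for z
        using x0 inA[OF that] by (cases "norm z \<le> 4 * \<mu>") auto
    qed
    moreover have "0 \<le> L1 + (- c) * L2" using L c mult_nonneg_nonpos[of c L2] by simp
    ultimately show False by linarith
  qed
  define \<kappa> where "\<kappa> = min c (m / \<mu> powr - ea)"
  have mp: "\<mu> powr - ea > 0" using \<mu> l by simp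
  have \<kappa>: "\<kappa> > 0" "\<kappa> \<le> c" "\<kappa> * \<mu> powr - ea \<le> m" using c m mp by (auto simp: \<kappa>_def min_def field_simps)
  have "\<kappa> * riesz y \<le> w y" if y: "\<mu> \<le> norm y" for y
  proof (cases "norm y \<le> 4 * \<mu>")
    case True
    have "\<kappa> * riesz y \<le> \<kappa> * \<mu> powr - ea" using \<kappa> y \<mu> l by (intro mult_left_mono riesz_antimono) auto
    moreover have "m \<le> w y" using m(2)[of y] y True by simp
    ultimately show ?thesis using \<kappa>(3) by linarith
  next
    case False
    have "\<kappa> * riesz y \<le> c * riesz y" using \<kappa> by (intro mult_right_mono riesz_nonneg)
    then show ?thesis using nonneg[of y] out[of y] False \<mu> l by simp
  qed
  then show ?thesis using \<kappa> by blast
qed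

end

section \<open>Moving spheres\<close>

text \<open>The derivative of the power is bounded on the interval by its value at one end: at
  \<open>m\<close> for exponents below 1, at \<open>M\<close> otherwise. The sum in the constant
  covers both cases. The one-sided form suits comparison at a minimum, where an upper bound for
  \<open>A' - A\<close> is all that is known.\<close>

lemma powr_one_sided_lipschitz:
  fixes r m M :: real
  assumes r: "r > 0" and m: "0 < m"
  obtains C where "C \<ge> 0" "\<And>A A' e. m \<le> A \<Longrightarrow> A \<le> M \<Longrightarrow> m \<le> A' \<Longrightarrow> A' \<le> M \<Longrightarrow> e \<ge> 0 \<Longrightarrow> A' \<le> A + e \<Longrightarrow>
     A' powr r - A powr r \<le> C * e"
proof (rule that[of "r * (m powr (r - 1) + M powr (r - 1))"])
  show "0 \<le> r * (m powr (r - 1) + M powr (r - 1))" using r by simp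
  fix A A' e assume A: "m \<le> A" "A \<le> M" "m \<le> A'" "A' \<le> M" "e \<ge> (0::real)" "A' \<le> A + e"
  show "A' powr r - A powr r \<le> r * (m powr (r - 1) + M powr (r - 1)) * e"
  proof (cases "A' \<le> A")
    case True
    then have "A' powr r \<le> A powr r" using A m r by (intro powr_mono2) auto
    moreover have "0 \<le> r * (m powr (r - 1) + M powr (r - 1)) * e" using r A by simp
    ultimately show ?thesis by linarith
  next
    case False
    have "\<exists>z. A < z \<and> z < A' \<and> A' powr r - A powr r = (A' - A) * (r * z powr (r - 1))"
      using False A m by (intro MVT2) (auto intro!: derivative_eq_intros)
    then obtain z where z: "A < z" "z < A'" "A' powr r - A powr r = (A' - A) * (r * z powr (r - 1))" by blast
    have "z powr (r - 1) \<le> m powr (r - 1) + M powr (r - 1)"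
    proof (cases "r \<ge> 1")
      case True
      then have "z powr (r - 1) \<le> M powr (r - 1)" using z A m by (intro powr_mono2) auto
      then show ?thesis by (simp add: add_increasing)
    next
      case False
      then have "z powr (r - 1) \<le> m powr (r - 1)" using z A m by (intro powr_mono2') auto
      then show ?thesis by (simp add: add_increasing2)
    qed
    then have "(A' - A) * (r * z powr (r - 1)) \<le> e * (r * (m powr (r - 1) + M powr (r - 1)))"
      using A r False by (intro mult_mono mult_left_mono) auto
    then show ?thesis using z by (simp add: mult.commute)
  qed
qed

context fractional
begin

section \<open>The nonlinearity and the system\<close>

definition nonlin :: "real \<Rightarrow> real \<Rightarrow> real \<Rightarrow> real \<Rightarrow> real" where
  "nonlin \<alpha> \<beta> A B = \<alpha> * A powr (eb / ea) + \<beta> * A powr (2 * \<sigma> / ea) * B powr (real CARD('n) / ea)"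

text \<open>The Lipschitz condition compares arbitrary pairs near a point, because starting the
  spheres compares \<open>u\<close> at two points near the centre, neither of which is the
  centre.\<close>

definition regular :: "(real^'n \<Rightarrow> real) \<Rightarrow> bool" where
  "regular u \<longleftrightarrow> (\<forall>x. u x > 0) \<and> continuous_on UNIV u \<and>
    (\<forall>x. \<exists>d>0. \<exists>M. \<forall>y z. dist x y < d \<longrightarrow> dist x z < d \<longrightarrow> \<bar>u y - u z\<bar> \<le> M * dist y z)"

definition solves :: "real \<Rightarrow> real \<Rightarrow> (real^'n \<Rightarrow> real) \<Rightarrow> (real^'n \<Rightarrow> real) \<Rightarrow> bool" where
  "solves \<alpha> \<beta> u v \<longleftrightarrow> (\<forall>x. flap u x (nonlin \<alpha> \<beta> (u x) (v x)))"

lemma exponents: "2 * \<sigma> / ea > 0" "real CARD('n) / ea > 0" "eb / ea > 0" "eb / ea = 2 * \<sigma> / ea + real CARD('n) / ea"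
proof -
  show "2 * \<sigma> / ea > 0" "real CARD('n) / ea > 0" "eb / ea > 0"
    using \<sigma> dim ea_pos eb_pos by auto
  show "eb / ea = 2 * \<sigma> / ea + real CARD('n) / ea"
    by (simp add: eb_def add_divide_distrib)
qed

text \<open>With \<open>s = (l / norm x) powr ea\<close> the factor becomes
  \<open>(l / norm x) powr eb\<close>, exactly the weight in \<open>flap_kelvin\<close>; the system
  is therefore invariant under Kelvin transforms.\<close>

lemma nonlin_homogeneous:
  assumes "s > 0" "A > 0" "B > 0"
  shows "nonlin \<alpha> \<beta> (s * A) (s * B) = s powr (eb / ea) * nonlin \<alpha> \<beta> A B"
  unfolding nonlin_def using assms
  by (simp add: powr_mult exponents(4) powr_add algebra_simps)

lemma nonlin_mono:
  assumes "\<alpha> \<ge> 0" "\<beta> \<ge> 0" "0 < A" "A \<le> A'" "0 < B" "B \<le> B'"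
  shows "nonlin \<alpha> \<beta> A B \<le> nonlin \<alpha> \<beta> A' B'"
  unfolding nonlin_def using assms exponents
  by (intro add_mono mult_mono powr_mono2) (auto intro!: mult_nonneg_nonneg)

lemma nonlin_pos: "\<alpha> > 0 \<Longrightarrow> \<beta> > 0 \<Longrightarrow> A > 0 \<Longrightarrow> B > 0 \<Longrightarrow> nonlin \<alpha> \<beta> A B > 0"
  unfolding nonlin_def by (intro add_pos_pos mult_pos_pos) auto

lemma nonlin_strict_mono:
  assumes "\<alpha> > 0" "\<beta> > 0" "0 < A" "A \<le> A'" "0 < B" "B < B'"
  shows "nonlin \<alpha> \<beta> A B < nonlin \<alpha> \<beta> A' B'"
  unfolding nonlin_def using assms exponents
  by (intro add_le_less_mono mult_le_less_imp_less mult_mono mult_left_mono powr_mono2 powr_less_mono2) auto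

lemma nonlin_lipschitz:
  assumes m: "0 < m" "\<alpha> > 0" "\<beta> > 0"
  obtains \<Lambda> where "\<Lambda> \<ge> 0"
    "\<And>A A' B B' e. m \<le> A \<Longrightarrow> A \<le> M \<Longrightarrow> m \<le> A' \<Longrightarrow> A' \<le> M \<Longrightarrow> m \<le> B \<Longrightarrow> B \<le> M \<Longrightarrow> m \<le> B' \<Longrightarrow> B' \<le> M \<Longrightarrow>
       e \<ge> 0 \<Longrightarrow> A' \<le> A + e \<Longrightarrow> B' \<le> B + e \<Longrightarrow> nonlin \<alpha> \<beta> A' B' - nonlin \<alpha> \<beta> A B \<le> \<Lambda> * e"
proof -
  let ?p = "eb / ea" and ?q = "2 * \<sigma> / ea" and ?s = "real CARD('n) / ea"
  from powr_one_sided_lipschitz[OF exponents(3) m(1), of M] obtain P where P: "P \<ge> 0" 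
    "\<And>A A' e. m \<le> A \<Longrightarrow> A \<le> M \<Longrightarrow> m \<le> A' \<Longrightarrow> A' \<le> M \<Longrightarrow> e \<ge> 0 \<Longrightarrow> A' \<le> A + e \<Longrightarrow> A' powr ?p - A powr ?p \<le> P * e" by blast
  from powr_one_sided_lipschitz[OF exponents(1) m(1), of M] obtain Q where Q: "Q \<ge> 0" 
    "\<And>A A' e. m \<le> A \<Longrightarrow> A \<le> M \<Longrightarrow> m \<le> A' \<Longrightarrow> A' \<le> M \<Longrightarrow> e \<ge> 0 \<Longrightarrow> A' \<le> A + e \<Longrightarrow> A' powr ?q - A powr ?q \<le> Q * e" by blast
  from powr_one_sided_lipschitz[OF exponents(2) m(1), of M] obtain S where S: "S \<ge> 0" 
    "\<And>A A' e. m \<le> A \<Longrightarrow> A \<le> M \<Longrightarrow> m \<le> A' \<Longrightarrow> A' \<le> M \<Longrightarrow> e \<ge> 0 \<Longrightarrow> A' \<le> A + e \<Longrightarrow> A' powr ?s - A powr ?s \<le> S * e" by blast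
  show ?thesis
  proof (rule that[of "\<alpha> * P + \<beta> * (Q * M powr ?s + M powr ?q * S)"])
    show "0 \<le> \<alpha> * P + \<beta> * (Q * M powr ?s + M powr ?q * S)" using P Q S m by simp
    fix A A' B B' e assume b: "m \<le> A" "A \<le> M" "m \<le> A'" "A' \<le> M" "m \<le> B" "B \<le> M" "m \<le> B'" "B' \<le> M"
      "e \<ge> 0" "A' \<le> A + e" "B' \<le> B + e"
    have "(A' powr ?q - A powr ?q) * B' powr ?s \<le> (Q * e) * B' powr ?s"
      using Q(2)[of A A' e] b by (intro mult_right_mono) auto
    also have "\<dots> \<le> (Q * e) * M powr ?s"
      using b Q m exponents by (intro mult_left_mono powr_mono2) auto
    finally have 1: "(A' powr ?q - A powr ?q) * B' powr ?s \<le> (Q * e) * M powr ?s" .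
    have "A powr ?q * (B' powr ?s - B powr ?s) \<le> A powr ?q * (S * e)"
      using S(2)[of B B' e] b by (intro mult_left_mono) auto
    also have "\<dots> \<le> M powr ?q * (S * e)"
      using b S m exponents by (intro mult_right_mono powr_mono2) auto
    finally have 2: "A powr ?q * (B' powr ?s - B powr ?s) \<le> M powr ?q * (S * e)" .
    have 3: "\<alpha> * (A' powr ?p - A powr ?p) \<le> \<alpha> * (P * e)"
      using P(2)[of A A' e] b m by (intro mult_left_mono) auto
    have 4: "\<beta> * ((A' powr ?q - A powr ?q) * B' powr ?s + A powr ?q * (B' powr ?s - B powr ?s))
       \<le> \<beta> * ((Q * e) * M powr ?s + M powr ?q * (S * e))"
      using 1 2 m by (intro mult_left_mono add_mono) auto
    show "nonlin \<alpha> \<beta> A' B' - nonlin \<alpha> \<beta> A B \<le> (\<alpha> * P + \<beta> * (Q * M powr ?s + M powr ?q * S)) * e"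
      using 3 4 unfolding nonlin_def by (simp add: algebra_simps)
  qed
qed

lemma
  assumes "regular u"
  shows regular_pos: "u x > 0" and regular_cont: "continuous_on S u" and regular_isCont: "isCont u x"
    and regular_lip: "lip_at u x" and regular_borel: "u \<in> borel_measurable borel"
proof -
  show "u x > 0" using assms by (simp add: regular_def)
  have c: "continuous_on UNIV u" using assms by (simp add: regular_def)
  then show "continuous_on S u" by (rule continuous_on_subset) simp
  show "isCont u x" using c by (simp add: continuous_on_eq_continuous_at)
  show "u \<in> borel_measurable borel" using c by (rule borel_measurable_continuous_onI)
  obtain d M where "d > 0" "\<And>y z. dist x y < d \<Longrightarrow> dist x z < d \<Longrightarrow> \<bar>u y - u z\<bar> \<le> M * dist y z"
    using assms unfolding regular_def by blast
  then have "d > 0 \<and> (\<forall>y. dist x y < d \<longrightarrow> \<bar>u x - u y\<bar> \<le> M * dist x y)" by simp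
  then show "lip_at u x" unfolding lip_at_def by blast
qed

lemma kelvin_pos: "regular u \<Longrightarrow> l > 0 \<Longrightarrow> y \<noteq> 0 \<Longrightarrow> kelvin l u y > 0"
  by (simp add: kelvin_def regular_pos)

lemma kelvin_isCont:
  assumes "regular u" "y \<noteq> 0"
  shows "isCont (kelvin l u) y"
proof -
  have "isCont (\<lambda>y. u (inversion l y)) y"
  proof (rule isCont_o2[where g = u and f = "inversion l"])
    show "isCont (inversion l) y" unfolding inversion_def[abs_def] using assms by (intro continuous_intros) auto
    show "isCont u (inversion l y)" by (rule regular_isCont[OF assms(1)])
  qed
  then show ?thesis
    unfolding kelvin_def[abs_def] using assms
    by (cases "l = 0") (auto intro!: continuous_intros)
qed

lemma flap_kelvin_difference:
  assumes u: "regular u" and v: "regular v" and eq: "solves \<alpha> \<beta> u v" and l: "l > 0" and x: "x \<noteq> 0"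
  shows "flap (\<lambda>y. u y - kelvin l u y) x (nonlin \<alpha> \<beta> (u x) (v x) - nonlin \<alpha> \<beta> (kelvin l u x) (kelvin l v x))"
proof -
  let ?s = "(l / norm x) powr ea"
  have s: "?s > 0" using l x by simp
  have k: "nonlin \<alpha> \<beta> (kelvin l u x) (kelvin l v x) = (l / norm x) powr eb * nonlin \<alpha> \<beta> (u (inversion l x)) (v (inversion l x))"
    unfolding kelvin_def using nonlin_homogeneous[OF s, of "u (inversion l x)" "v (inversion l x)" \<alpha> \<beta>]
      regular_pos[OF u] regular_pos[OF v] ea_pos by (simp add: powr_powr)
  have "flap (kelvin l u) x ((l / norm x) powr eb * nonlin \<alpha> \<beta> (u (inversion l x)) (v (inversion l x)))"
    using eq unfolding solves_def
    by (intro flap_kelvin l x regular_borel regular_lip u) auto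
  from flap_add[OF _ flap_cmult[OF this, of "-1"], of u "nonlin \<alpha> \<beta> (u x) (v x)"] show ?thesis
    using eq unfolding solves_def k by simp
qed

section \<open>Small radii and limits of admissible radii\<close>

definition below :: "real \<Rightarrow> (real^'n \<Rightarrow> real) \<Rightarrow> bool" where
  "below l u \<longleftrightarrow> (\<forall>y. l \<le> norm y \<longrightarrow> kelvin l u y \<le> u y)"

text \<open>Near the origin \<open>r powr (ea / 2) * u (r *\<^sub>R \<theta>)\<close> is increasing in \<open>r\<close>;
  far away the lower bound on \<open>u\<close> beats the small factor \<open>l powr ea\<close>.\<close>

lemma below_small:
  assumes u: "regular u" and c: "c > 0" "\<And>y. 1 \<le> norm y \<Longrightarrow> c * riesz y \<le> u y"
  shows "\<exists>l0>0. \<forall>l. 0 < l \<longrightarrow> l \<le> l0 \<longrightarrow> below l u"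
proof -
  obtain d M where d: "d > 0" and lip: "\<And>y z. dist 0 y < d \<Longrightarrow> dist 0 z < d \<Longrightarrow> \<bar>u y - u z\<bar> \<le> M * dist y z"
    using u unfolding regular_def by blast
  obtain m where m: "m > 0" "\<And>y. norm y \<le> 1 \<Longrightarrow> m \<le> u y"
  proof -
    have "\<exists>y0\<in>cball 0 1. \<forall>y\<in>cball 0 1. u y0 \<le> u y"
      by (intro continuous_attains_inf regular_cont[OF u]) auto
    then show ?thesis using that regular_pos[OF u] by (metis mem_cball_0)
  qed
  obtain S where S: "\<And>y. norm y \<le> 1 \<Longrightarrow> u y \<le> S"
  proof -
    have "\<exists>y0\<in>cball 0 1. \<forall>y\<in>cball 0 1. u y \<le> u y0"
      by (intro continuous_attains_sup regular_cont[OF u]) auto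
    then show ?thesis using that by (metis mem_cball_0)
  qed
  have Sm: "S > 0" using S[of 0] regular_pos[OF u, of 0] by simp
  \<comment> \<open>\<open>K\<close> is a Lipschitz constant of \<open>ln u\<close> near the
    origin.\<close>
  define K where "K = \<bar>M\<bar> / m + 1"
  have K: "K > 0" using m by (simp add: K_def add_nonneg_pos)
  \<comment> \<open>Requiring \<open>K * r \<le> ea / 2\<close> lets the growth of the weight outrun
    the possible decrease of \<open>ln u\<close>.\<close>
  define r where "r = min (min (d / 2) 1) (ea / (2 * K))"
  have "r \<le> d / 2" by (simp add: r_def)
  then have r: "r > 0" "r < d" "r \<le> 1" and "r \<le> ea / (2 * K)" using d K ea_pos by (auto simp: r_def)
  then have Kr: "K * r \<le> ea / 2" using K by (simp add: pos_le_divide_eq mult_ac)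
  have lnlip: "ln (u y) - ln (u z) \<le> K * dist y z" if "norm y \<le> r" "norm z \<le> r" for y z
  proof -
    have p: "u y > 0" "u z > 0" "m \<le> u z" using regular_pos[OF u] m(2)[of z] that r by auto
    have "ln (u y) - ln (u z) = ln (u y / u z)" using p by (simp add: ln_div)
    also have "\<dots> \<le> u y / u z - 1" using p by (intro ln_le_minus_one) auto
    also have "\<dots> = (u y - u z) / u z" using p by (simp add: diff_divide_distrib)
    also have "\<dots> \<le> (\<bar>M\<bar> * dist y z) / u z"
    proof (rule divide_right_mono)
      have "\<bar>u y - u z\<bar> \<le> M * dist y z" using lip[of y z] that r by simp
      also have "\<dots> \<le> \<bar>M\<bar> * dist y z" by (intro mult_right_mono) auto
      finally show "u y - u z \<le> \<bar>M\<bar> * dist y z" by simp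
    qed (use p in simp)
    also have "\<dots> \<le> (\<bar>M\<bar> * dist y z) / m" using p m by (intro divide_left_mono) auto
    also have "\<dots> \<le> K * dist y z" by (simp add: K_def distrib_right)
    finally show ?thesis .
  qed
  \<comment> \<open>The lower bound is extended from \<open>norm y \<ge> 1\<close> to
    \<open>norm y \<ge> r\<close> at the price of a smaller constant.\<close>
  define c' where "c' = min c (m * r powr ea)"
  have c': "c' > 0" using c m r by (simp add: c'_def)
  have low: "c' * riesz y \<le> u y" if "r \<le> norm y" for y
  proof (cases "1 \<le> norm y")
    case True
    have "c' * riesz y \<le> c * riesz y" by (intro mult_right_mono riesz_nonneg) (simp add: c'_def)
    then show ?thesis using c(2)[OF True] by simp
  next
    case False
    have "c' * riesz y \<le> (m * r powr ea) * r powr - ea"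
      using that r m by (intro mult_mono riesz_antimono riesz_nonneg) (auto simp: c'_def)
    also have "\<dots> = m" using r by (simp add: powr_minus)
    finally show ?thesis using m(2)[of y] False by simp
  qed
  \<comment> \<open>The bound on \<open>l\<close> makes \<open>l powr ea * S \<le> c'\<close>, so
    the Kelvin transform, at most \<open>l powr ea * S * riesz y\<close>, stays under the lower
    bound.\<close>
  define l0 where "l0 = min 1 ((c' / S) powr (1 / ea))"
  have l0: "l0 > 0" using c' Sm by (simp add: l0_def)
  have "below l u" if l: "0 < l" "l \<le> l0" for l
    unfolding below_def
  proof (intro allI impI)
    fix y :: "real^'n" assume y: "l \<le> norm y"
    define t where "t = norm y"
    have t: "t > 0" "l \<le> t" using l y by (auto simp: t_def)
    have nZ: "norm (inversion l y) = l\<^sup>2 / t" by (simp add: norm_inversion t_def)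
    have Zl: "l\<^sup>2 / t \<le> l" using t l by (simp add: power2_eq_square pos_divide_le_eq)
    show "kelvin l u y \<le> u y"
    proof (cases "t \<le> r")
      case True
      define s where "s = l\<^sup>2 / t"
      have s: "0 < s" "s \<le> t" using l t Zl by (auto simp: s_def)
      have st: "s / t = (l / t)\<^sup>2" by (simp add: s_def power2_eq_square)
      have "y - inversion l y = (1 - (l / t)\<^sup>2) *\<^sub>R y" by (simp add: inversion_def t_def algebra_simps)
      moreover have "(l / t)\<^sup>2 \<le> 1" using s st t by (metis divide_le_eq_1_pos)
      ultimately have "dist (inversion l y) y = (1 - s / t) * t"
        by (simp add: dist_norm norm_minus_commute t_def[symmetric] st)
      then have ds: "dist (inversion l y) y = t - s" using t by (simp add: left_diff_distrib)
      have "ln (u (inversion l y)) - ln (u y) \<le> K * (t - s)"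
        using lnlip[of "inversion l y" y] True s unfolding ds nZ s_def[symmetric] by (simp add: t_def)
      also have "\<dots> = (K * t) * (1 - s / t)" using t by (simp add: algebra_simps)
      also have "\<dots> \<le> (ea / 2) * (1 - s / t)"
      proof (rule mult_right_mono)
        have "K * t \<le> K * r" using K True by (intro mult_left_mono) auto
        then show "K * t \<le> ea / 2" using Kr by simp
      qed (use s t in simp)
      also have "\<dots> \<le> (ea / 2) * (- ln (s / t))"
        using ln_le_minus_one[of "s / t"] s t ea_pos by (intro mult_left_mono) auto
      also have "ln (s / t) = 2 * ln (l / t)" unfolding st using l t by (simp add: ln_realpow)
      finally have "ea * ln (l / t) + ln (u (inversion l y)) \<le> ln (u y)" by simp
      moreover have "ln (kelvin l u y) = ea * ln (l / t) + ln (u (inversion l y))"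
        unfolding kelvin_def t_def[symmetric] using l t regular_pos[OF u, of "inversion l y"]
        by (simp add: ln_mult ln_powr)
      moreover have "kelvin l u y > 0" using kelvin_pos[OF u l(1)] t by (auto simp: t_def)
      ultimately show ?thesis using regular_pos[OF u, of y] by (metis ln_le_cancel_iff)
    next
      case False
      have "kelvin l u y \<le> (l / t) powr ea * S"
        unfolding kelvin_def t_def[symmetric] using S[of "inversion l y"] nZ Zl l
        by (intro mult_left_mono) (auto simp: l0_def)
      also have "\<dots> = (l powr ea * S) * riesz y"
        by (simp add: riesz_def t_def powr_divide powr_minus_divide)
      also have "\<dots> \<le> c' * riesz y"
      proof (intro mult_right_mono riesz_nonneg)
        have "l powr ea \<le> ((c' / S) powr (1 / ea)) powr ea"
          using l ea_pos by (intro powr_mono2) (auto simp: l0_def)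
        also have "\<dots> = c' / S" using c' Sm ea_pos by (simp add: powr_powr)
        finally show "l powr ea * S \<le> c'" using Sm by (simp add: pos_le_divide_eq)
      qed
      also have "\<dots> \<le> u y" using False by (intro low) (simp add: t_def)
      finally show ?thesis .
    qed
  qed
  then show ?thesis using l0 by blast
qed

lemma antisym_eq_0:
  assumes l: "l > 0" and anti: "antisym l w" and out: "\<And>y. norm y > l \<Longrightarrow> w y = 0" and y: "y \<noteq> 0"
  shows "w y = 0"
proof -
  have k: "(l / norm y) powr ea * w (inversion l y) = - w y"
    using anti y by (simp add: antisym_def kelvin_def)
  consider "norm y > l" | "norm y = l" | "norm y < l" by linarith
  then show ?thesis
  proof cases
    case 2
    then have "inversion l y = y" "l / norm y = 1" using l by (auto simp: inversion_def)
    then show ?thesis using k l by simp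
  next
    case 3
    then have "norm (inversion l y) > l"
      using y l by (simp add: norm_inversion power2_eq_square pos_less_divide_eq)
    then show ?thesis using k out by simp
  qed (rule out)
qed

lemma below_closed:
  assumes u: "regular u" and \<tau>: "\<tau> > 0" and b: "\<And>l. 0 < l \<Longrightarrow> l < \<tau> \<Longrightarrow> below l u"
  shows "below \<tau> u"
  unfolding below_def
proof (intro allI impI)
  fix y :: "real^'n" assume y: "\<tau> \<le> norm y"
  then have y0: "y \<noteq> 0" using \<tau> by auto
  have "isCont (\<lambda>l. u (inversion l y)) \<tau>"
  proof (rule isCont_o2[where g = u])
    show "isCont (\<lambda>l. inversion l y) \<tau>"
      unfolding inversion_def by (intro continuous_intros) (use y0 in auto)
  qed (rule regular_isCont[OF u])
  then have "isCont (\<lambda>l. kelvin l u y) \<tau>"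
    unfolding kelvin_def using \<tau> y0 by (intro continuous_intros) auto
  then have "((\<lambda>l. kelvin l u y) \<longlongrightarrow> kelvin \<tau> u y) (at_left \<tau>)"
    unfolding isCont_def by (rule filterlim_mono) (auto intro: at_le)
  moreover have "\<forall>\<^sub>F l in at_left \<tau>. kelvin l u y \<le> u y"
    unfolding eventually_at_left_field
    by (rule exI[of _ 0]) (use \<tau> b y in \<open>auto simp: below_def\<close>)
  ultimately show "kelvin \<tau> u y \<le> u y"
    by (intro tendsto_upperbound[of _ _ "at_left \<tau>"]) auto
qed

section \<open>At the critical radius and beyond it\<close>

lemma borel_difference: "regular u \<Longrightarrow> (\<lambda>y. u y - kelvin l u y) \<in> borel_measurable borel"
  using regular_borel[of u] by measurable

text \<open>Strong maximum principle: at a zero of the difference outside the sphere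
  \<open>antisym_strict\<close> forces a negative value of the operator, whereas monotonicity of the
  nonlinearity makes it nonnegative.\<close>

lemma positive_or_zero:
  assumes u: "regular u" and v: "regular v" and eq: "solves \<alpha> \<beta> u v" and pos: "\<alpha> > 0" "\<beta> > 0" and l: "l > 0"
    and b: "below l u" "below l v" and z: "norm z > l" "u z - kelvin l u z > 0" and x: "norm x > l"
  shows "u x - kelvin l u x > 0"
proof (rule ccontr)
  assume "\<not> ?thesis"
  moreover have "kelvin l u x \<le> u x" using b x by (simp add: below_def)
  ultimately have x0: "u x - kelvin l u x = 0" by linarith
  have nz: "x \<noteq> 0" "z \<noteq> 0" using x z l by auto
  have "isCont (\<lambda>y. u y - kelvin l u y) z"
    by (intro continuous_intros regular_isCont kelvin_isCont u nz)
  from antisym_strict[OF l x borel_difference[OF u] antisym_diff_kelvin[OF l]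
      flap_kelvin_difference[OF u v eq l nz(1)] x0 _ z this]
  have "nonlin \<alpha> \<beta> (u x) (v x) - nonlin \<alpha> \<beta> (kelvin l u x) (kelvin l v x) < 0"
    using b by (auto simp: below_def)
  moreover have "nonlin \<alpha> \<beta> (kelvin l u x) (kelvin l v x) \<le> nonlin \<alpha> \<beta> (u x) (v x)"
    using b x pos kelvin_pos[OF u l nz(1)] kelvin_pos[OF v l nz(1)] by (intro nonlin_mono) (auto simp: below_def)
  ultimately show False by simp
qed

text \<open>The coupling carries strictness over: where \<open>v\<close> touched its transform, the
  positive term with \<open>u\<close> would make the operator strictly positive, against the sign at
  a minimum.\<close>

lemma positive_propagates:
  assumes u: "regular u" and v: "regular v" and eq: "solves \<alpha> \<beta> v u" and pos: "\<alpha> > 0" "\<beta> > 0" and l: "l > 0"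
    and b: "below l v" and up: "\<And>y. norm y > l \<Longrightarrow> u y - kelvin l u y > 0" and x: "norm x > l"
  shows "v x - kelvin l v x > 0"
proof (rule ccontr)
  assume "\<not> ?thesis"
  moreover have "kelvin l v x \<le> v x" using b x by (simp add: below_def)
  ultimately have x0: "v x - kelvin l v x = 0" by linarith
  have nz: "x \<noteq> 0" using x l by auto
  \<comment> \<open>Only the sign is wanted here, hence the empty test set.\<close>
  have "nonlin \<alpha> \<beta> (v x) (u x) - nonlin \<alpha> \<beta> (kelvin l v x) (kelvin l u x) \<le> - 0 * measure lborel ({} :: (real^'n) set)"
    by (rule antisym_max[OF l x borel_difference[OF v] antisym_diff_kelvin[OF l]
      flap_kelvin_difference[OF v u eq l nz], of "{}" 1 0]) (use x0 b in \<open>auto simp: below_def\<close>)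
  moreover have "nonlin \<alpha> \<beta> (kelvin l v x) (kelvin l u x) < nonlin \<alpha> \<beta> (v x) (u x)"
    using x0 up[OF x] pos kelvin_pos[OF u l nz] kelvin_pos[OF v l nz] by (intro nonlin_strict_mono) auto
  ultimately show False by simp
qed

text \<open>Divided by \<open>riesz y\<close>, the Kelvin transform is a function \<open>G\<close>
  of the radius and of the point \<open>y\<close> inverted in the unit sphere, continuous up to
  infinity. Its uniform continuity on a compact set keeps the change below the margin \<kappa> for
  all distant \<open>y\<close> at once.\<close>

lemma far_stable:
  assumes u: "regular u" and l: "\<tau> > 0" and \<mu>: "\<mu> > \<tau>"
    and pos: "\<And>y. norm y > \<tau> \<Longrightarrow> u y - kelvin \<tau> u y > 0"
    and sup: "\<And>x. norm x > \<tau> \<Longrightarrow> \<exists>L\<ge>0. flap (\<lambda>y. u y - kelvin \<tau> u y) x L"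
  shows "\<exists>\<delta>>0. \<forall>l y. \<tau> \<le> l \<longrightarrow> l < \<tau> + \<delta> \<longrightarrow> \<mu> \<le> norm y \<longrightarrow> kelvin l u y < u y"
proof -
  have "\<exists>\<kappa>>0. \<forall>y. \<mu> \<le> norm y \<longrightarrow> \<kappa> * riesz y \<le> u y - kelvin \<tau> u y"
  proof (rule antisym_lower_bound[OF l borel_difference[OF u] antisym_diff_kelvin[OF l] _ pos sup \<mu>])
    fix y :: "real^'n" assume "norm y > \<tau>"
    then show "isCont (\<lambda>y. u y - kelvin \<tau> u y) y"
      using l by (intro continuous_intros regular_isCont kelvin_isCont u) auto
  qed
  then obtain \<kappa> where \<kappa>: "\<kappa> > 0" "\<And>y. \<mu> \<le> norm y \<Longrightarrow> \<kappa> * riesz y \<le> u y - kelvin \<tau> u y" by blast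
  define G where "G p = fst p powr ea * u ((fst p)\<^sup>2 *\<^sub>R snd p)" for p :: "real \<times> (real^'n)"
  let ?C = "{\<tau>..2 * \<tau>} \<times> cball (0::real^'n) (1 / \<mu>)"
  have "continuous_on ?C G"
    unfolding G_def
    by (intro continuous_intros continuous_on_compose2[OF regular_cont[OF u, of UNIV]]) (use l in auto)
  moreover have "compact ?C" by (intro compact_Times compact_cball compact_Icc)
  ultimately have "uniformly_continuous_on ?C G" by (rule compact_uniformly_continuous)
  then obtain d where d: "d > 0" "\<And>p q. p \<in> ?C \<Longrightarrow> q \<in> ?C \<Longrightarrow> dist q p < d \<Longrightarrow> dist (G q) (G p) < \<kappa>"
    unfolding uniformly_continuous_on_def using \<kappa>(1) by metis
  have "kelvin m u y < u y" if m: "\<tau> \<le> m" "m < \<tau> + min d \<tau>" and y: "\<mu> \<le> norm y" for m y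
  proof -
    define z where "z = y /\<^sub>R (norm y)\<^sup>2"
    have y0: "norm y > 0" using y \<mu> l by linarith
    have "norm z = 1 / norm y" using y0 by (simp add: z_def power2_eq_square divide_inverse)
    also have "\<dots> \<le> 1 / \<mu>" using y y0 \<mu> l by (intro divide_left_mono mult_pos_pos) auto
    finally have z: "z \<in> cball 0 (1 / \<mu>)" by simp
    have k: "kelvin t u y = riesz y * G (t, z)" for t
    proof -
      have "inversion t y = t\<^sup>2 *\<^sub>R z" by (simp add: inversion_def z_def divide_inverse power_mult_distrib power_inverse)
      moreover have "(t / norm y) powr ea = norm y powr - ea * t powr ea" by (simp add: powr_divide powr_minus_divide)
      ultimately show ?thesis by (simp add: kelvin_def riesz_def G_def)
    qed
    have "dist (G (m, z)) (G (\<tau>, z)) < \<kappa>"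
      using m z l by (intro d(2)) (auto simp: dist_Pair_Pair dist_real_def)
    then have "G (m, z) < G (\<tau>, z) + \<kappa>" by (simp add: dist_real_def abs_less_iff)
    moreover have "riesz y > 0" using y0 by (intro riesz_pos) auto
    ultimately have "riesz y * G (m, z) < riesz y * (G (\<tau>, z) + \<kappa>)" by simp
    then have "kelvin m u y < kelvin \<tau> u y + \<kappa> * riesz y" unfolding k by (simp add: algebra_simps)
    then show ?thesis using \<kappa>(2)[OF y] by simp
  qed
  then show ?thesis using d l by (intro exI[of _ "min d \<tau>"]) auto
qed

text \<open>Confines all arguments of the nonlinearity near the sphere to one interval away from 0,
  uniformly in the radius. The factor \<open>2 powr - ea\<close> reflects
  \<open>t / norm y \<ge> 1 / 2\<close>.\<close>

lemma kelvin_bounds: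
  assumes u: "regular u" and l: "\<tau> > 0"
  obtains m M where "m > 0" "\<And>t y. \<tau> \<le> t \<Longrightarrow> t \<le> norm y \<Longrightarrow> norm y \<le> 2 * \<tau> \<Longrightarrow>
    m \<le> u y \<and> u y \<le> M \<and> m \<le> kelvin t u y \<and> kelvin t u y \<le> M"
proof -
  let ?B = "cball (0::real^'n) (2 * \<tau>)"
  have ne: "?B \<noteq> {}" using l by simp
  obtain y0 where y0: "\<And>y. y \<in> ?B \<Longrightarrow> u y0 \<le> u y"
    using continuous_attains_inf[OF compact_cball ne regular_cont[OF u]] by blast
  obtain y1 where y1: "\<And>y. y \<in> ?B \<Longrightarrow> u y \<le> u y1"
    using continuous_attains_sup[OF compact_cball ne regular_cont[OF u]] by blast
  show ?thesis
  proof (rule that[of "2 powr - ea * u y0" "u y1"])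
    show "2 powr - ea * u y0 > 0" using regular_pos[OF u] by simp
    fix t :: real and y :: "real^'n" assume t: "\<tau> \<le> t" "t \<le> norm y" "norm y \<le> 2 * \<tau>"
    have y: "y \<in> ?B" using t by simp
    have ny: "norm y > 0" using t l by linarith
    then have "norm (inversion t y) \<le> t"
      using t l by (subst norm_inversion, subst pos_divide_le_eq) (auto simp: power2_eq_square)
    then have J: "inversion t y \<in> ?B" using t by simp
    have h: "1 / 2 \<le> t / norm y" "t / norm y \<le> 1"
      using t l ny by (simp_all add: pos_le_divide_eq pos_divide_le_eq)
    have "2 powr - ea = (1 / 2) powr ea" by (simp add: powr_divide powr_minus_divide)
    also have "\<dots> \<le> (t / norm y) powr ea" using h ea_pos by (intro powr_mono2) auto
    finally have h1: "2 powr - ea \<le> (t / norm y) powr ea" .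
    have h2: "(t / norm y) powr ea \<le> 1"
      using powr_mono2[of ea "t / norm y" 1] h t l ea_pos by simp
    have "2 powr - ea * u y0 \<le> (t / norm y) powr ea * u (inversion t y)"
      using h1 y0[OF J] regular_pos[OF u] by (intro mult_mono) (auto simp: less_imp_le)
    moreover have "(t / norm y) powr ea * u (inversion t y) \<le> 1 * u y1"
      using h2 y1[OF J] regular_pos[OF u] by (intro mult_mono) (auto simp: less_imp_le)
    moreover have "2 powr - ea * u y0 \<le> 1 * u y"
      using h1 h2 y0[OF y] regular_pos[OF u] by (intro mult_mono) (auto simp: less_imp_le)
    ultimately show "2 powr - ea * u y0 \<le> u y \<and> u y \<le> u y1 \<and> 2 powr - ea * u y0 \<le> kelvin t u y \<and> kelvin t u y \<le> u y1"
      using y1[OF y] by (simp add: kelvin_def)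
  qed
qed

text \<open>At the minimum \<open>- e\<close> the thin annulus pushes the operator below
  \<open>- e\<close> times a large constant, while the Lipschitz bound keeps the difference of the
  right-hand sides above \<open>- \<Lambda> * e\<close>.\<close>

lemma narrow_contradiction:
  assumes u: "regular u" and v: "regular v" and eq: "solves \<alpha> \<beta> u v" and l: "l > 0"
    and \<delta>: "0 < \<delta>" "\<delta> \<le> l" and x: "l < norm x" "norm x < l + \<delta>"
    and e: "e > 0" "u x - kelvin l u x = - e" "\<And>z. norm z > l \<Longrightarrow> - e \<le> u z - kelvin l u z" "- e \<le> v x - kelvin l v x"
    and lip: "nonlin \<alpha> \<beta> (kelvin l u x) (kelvin l v x) - nonlin \<alpha> \<beta> (u x) (v x) \<le> \<Lambda> * e"
    and big: "\<Lambda> < unit_ball_vol (real CARD('n)) / 9 powr eb * \<delta> powr (- 2 * \<sigma>)"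
  shows False
proof -
  have x0: "x \<noteq> 0" using x l by auto
  have "nonlin \<alpha> \<beta> (u x) (v x) - nonlin \<alpha> \<beta> (kelvin l u x) (kelvin l v x)
      \<le> (u x - kelvin l u x) * (unit_ball_vol (real CARD('n)) / 9 powr eb * \<delta> powr (- 2 * \<sigma>))"
    by (rule antisym_narrow[OF l x(1) borel_difference[OF u] antisym_diff_kelvin[OF l]
      flap_kelvin_difference[OF u v eq l x0] _ _ \<delta> x(2)]) (use e in auto)
  then have "e * (unit_ball_vol (real CARD('n)) / 9 powr eb * \<delta> powr (- 2 * \<sigma>)) \<le> \<Lambda> * e"
    using lip unfolding e(2) by simp
  moreover have "e * \<Lambda> < e * (unit_ball_vol (real CARD('n)) / 9 powr eb * \<delta> powr (- 2 * \<sigma>))"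
    using big e(1) by (rule mult_strict_left_mono)
  ultimately show False by (simp add: mult.commute)
qed

text \<open>Beyond \<mu> the differences stay positive by \<open>far_stable\<close>. The remaining
  shell between the new sphere and \<mu> has width at most \<delta>, chosen beforehand from the
  Lipschitz constants, and there the thin annulus principle applies.\<close>

lemma move_further:
  assumes u: "regular u" and v: "regular v" and eq: "solves \<alpha>\<^sub>1 \<beta> u v" "solves \<alpha>\<^sub>2 \<beta> v u"
    and pos: "\<alpha>\<^sub>1 > 0" "\<alpha>\<^sub>2 > 0" "\<beta> > 0" and l: "\<tau> > 0"
    and up: "\<And>y. norm y > \<tau> \<Longrightarrow> u y - kelvin \<tau> u y > 0" and vp: "\<And>y. norm y > \<tau> \<Longrightarrow> v y - kelvin \<tau> v y > 0"
  shows "\<exists>\<delta>>0. \<forall>t. \<tau> \<le> t \<longrightarrow> t < \<tau> + \<delta> \<longrightarrow> below t u \<and> below t v"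
proof -
  have sup: "\<exists>L\<ge>0. flap (\<lambda>y. f y - kelvin \<tau> f y) x L"
    if f: "regular f" "regular g" "solves \<alpha> \<beta> f g" "\<alpha> > 0" and x: "norm x > \<tau>"
      "f x - kelvin \<tau> f x > 0" "g x - kelvin \<tau> g x > 0" for f g \<alpha> x
  proof -
    have x0: "x \<noteq> 0" using x l by auto
    have "nonlin \<alpha> \<beta> (kelvin \<tau> f x) (kelvin \<tau> g x) \<le> nonlin \<alpha> \<beta> (f x) (g x)"
      using f pos x kelvin_pos[OF f(1) l x0] kelvin_pos[OF f(2) l x0] by (intro nonlin_mono) auto
    then show ?thesis using flap_kelvin_difference[OF f(1-3) l x0]
      by (intro exI[of _ "nonlin \<alpha> \<beta> (f x) (g x) - nonlin \<alpha> \<beta> (kelvin \<tau> f x) (kelvin \<tau> g x)"]) simp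
  qed
  obtain m1 M1 where b1: "m1 > 0" "\<And>t y. \<tau> \<le> t \<Longrightarrow> t \<le> norm y \<Longrightarrow> norm y \<le> 2 * \<tau> \<Longrightarrow>
    m1 \<le> u y \<and> u y \<le> M1 \<and> m1 \<le> kelvin t u y \<and> kelvin t u y \<le> M1" using kelvin_bounds[OF u l] by blast
  obtain m2 M2 where b2: "m2 > 0" "\<And>t y. \<tau> \<le> t \<Longrightarrow> t \<le> norm y \<Longrightarrow> norm y \<le> 2 * \<tau> \<Longrightarrow>
    m2 \<le> v y \<and> v y \<le> M2 \<and> m2 \<le> kelvin t v y \<and> kelvin t v y \<le> M2" using kelvin_bounds[OF v l] by blast
  define m M where "m = min m1 m2" and "M = max M1 M2"
  have m: "m > 0" using b1 b2 by (simp add: m_def)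
  have bu: "m \<le> u y \<and> u y \<le> M \<and> m \<le> kelvin t u y \<and> kelvin t u y \<le> M"
    and bv: "m \<le> v y \<and> v y \<le> M \<and> m \<le> kelvin t v y \<and> kelvin t v y \<le> M"
    if "\<tau> \<le> t" "t \<le> norm y" "norm y \<le> 2 * \<tau>" for t y
    using b1(2)[OF that] b2(2)[OF that] by (auto simp: m_def M_def)
  obtain \<Lambda>1 where L1: "\<Lambda>1 \<ge> 0"
    "\<And>A A' B B' e. m \<le> A \<Longrightarrow> A \<le> M \<Longrightarrow> m \<le> A' \<Longrightarrow> A' \<le> M \<Longrightarrow> m \<le> B \<Longrightarrow> B \<le> M \<Longrightarrow> m \<le> B' \<Longrightarrow> B' \<le> M \<Longrightarrow>
       e \<ge> 0 \<Longrightarrow> A' \<le> A + e \<Longrightarrow> B' \<le> B + e \<Longrightarrow> nonlin \<alpha>\<^sub>1 \<beta> A' B' - nonlin \<alpha>\<^sub>1 \<beta> A B \<le> \<Lambda>1 * e"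
    using nonlin_lipschitz[OF m pos(1,3), of M] by blast
  obtain \<Lambda>2 where L2: "\<Lambda>2 \<ge> 0"
    "\<And>A A' B B' e. m \<le> A \<Longrightarrow> A \<le> M \<Longrightarrow> m \<le> A' \<Longrightarrow> A' \<le> M \<Longrightarrow> m \<le> B \<Longrightarrow> B \<le> M \<Longrightarrow> m \<le> B' \<Longrightarrow> B' \<le> M \<Longrightarrow>
       e \<ge> 0 \<Longrightarrow> A' \<le> A + e \<Longrightarrow> B' \<le> B + e \<Longrightarrow> nonlin \<alpha>\<^sub>2 \<beta> A' B' - nonlin \<alpha>\<^sub>2 \<beta> A B \<le> \<Lambda>2 * e"
    using nonlin_lipschitz[OF m pos(2,3), of M] by blast
  define C where "C = unit_ball_vol (real CARD('n)) / 9 powr eb"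
  have C: "C > 0" unfolding C_def by simp
  define \<Lambda> where "\<Lambda> = max \<Lambda>1 \<Lambda>2 + 1"
  have \<Lambda>: "\<Lambda> > 0" "\<Lambda>1 < \<Lambda>" "\<Lambda>2 < \<Lambda>" using L1(1) L2(1) by (auto simp: \<Lambda>_def)
  \<comment> \<open>Solves \<open>C * \<delta> powr (- 2 * \<sigma>) = \<Lambda>\<close>, capped at
    \<tau> so that the shell stays within the range of \<open>kelvin_bounds\<close>.\<close>
  define \<delta> where "\<delta> = min \<tau> ((\<Lambda> / C) powr (- 1 / (2 * \<sigma>)))"
  have \<delta>: "0 < \<delta>" "\<delta> \<le> \<tau>" using l \<Lambda> C by (auto simp: \<delta>_def)
  have big: "\<Lambda> \<le> C * \<delta> powr (- 2 * \<sigma>)"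
  proof -
    have "((\<Lambda> / C) powr (- 1 / (2 * \<sigma>))) powr (- 2 * \<sigma>) \<le> \<delta> powr (- 2 * \<sigma>)"
      using \<delta>(1) \<sigma> by (intro powr_mono2') (auto simp: \<delta>_def)
    moreover have "((\<Lambda> / C) powr (- 1 / (2 * \<sigma>))) powr (- 2 * \<sigma>) = \<Lambda> / C"
      using \<Lambda> C \<sigma> by (simp add: powr_powr)
    ultimately show ?thesis using C by (simp add: pos_divide_le_eq mult.commute)
  qed
  define \<mu> where "\<mu> = \<tau> + \<delta>"
  have \<mu>: "\<mu> > \<tau>" "\<mu> \<le> 2 * \<tau>" using \<delta> by (auto simp: \<mu>_def)
  obtain d1 where d1: "d1 > 0" "\<And>t y. \<tau> \<le> t \<Longrightarrow> t < \<tau> + d1 \<Longrightarrow> \<mu> \<le> norm y \<Longrightarrow> kelvin t u y < u y"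
    using far_stable[OF u l \<mu>(1) up sup[OF u v eq(1) pos(1) _ up vp]] by blast
  obtain d2 where d2: "d2 > 0" "\<And>t y. \<tau> \<le> t \<Longrightarrow> t < \<tau> + d2 \<Longrightarrow> \<mu> \<le> norm y \<Longrightarrow> kelvin t v y < v y"
    using far_stable[OF v l \<mu>(1) vp sup[OF v u eq(2) pos(2) _ vp up]] by blast
  have "below t u \<and> below t v" if t: "\<tau> \<le> t" "t < \<tau> + min \<delta> (min d1 d2)" for t
  proof (rule ccontr)
    assume neg: "\<not> (below t u \<and> below t v)"
    have t0: "t > 0" "t < \<mu>" "t < \<tau> + d1" "t < \<tau> + d2" using t l by (auto simp: \<mu>_def)
    \<comment> \<open>Minimising the smaller difference ensures that at the minimum point both
      differences are at least \<open>- e\<close>, so the coupled nonlinearity is controlled by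
      \<open>e\<close> alone.\<close>
    define h where "h y = min (u y - kelvin t u y) (v y - kelvin t v y)" for y
    have far: "h y > 0" if "\<mu> \<le> norm y" for y
      using d1(2)[OF t(1) t0(3) that] d2(2)[OF t(1) t0(4) that] by (simp add: h_def)
    let ?A = "{y::real^'n. t \<le> norm y \<and> norm y \<le> \<mu>}"
    have A: "?A = cball 0 \<mu> - ball 0 t" by auto
    have cA: "compact ?A" unfolding A by (intro compact_diff) auto
    have ch: "continuous_on ?A h"
    proof (rule continuous_at_imp_continuous_on, rule ballI)
      fix y :: "real^'n" assume "y \<in> ?A"
      then have "y \<noteq> 0" using t0 by auto
      then show "isCont h y" unfolding h_def[abs_def]
        by (intro continuous_intros regular_isCont kelvin_isCont u v)
    qed
    obtain y1 where y1: "t \<le> norm y1" "h y1 < 0"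
      using neg unfolding below_def h_def by (force simp: not_le min_less_iff_disj)
    then have y1A: "y1 \<in> ?A" using far[of y1] by force
    have "\<exists>x\<in>?A. \<forall>y\<in>?A. h x \<le> h y"
      using cA ch y1A by (intro continuous_attains_inf) auto
    then obtain x where x: "x \<in> ?A" "\<And>y. y \<in> ?A \<Longrightarrow> h x \<le> h y" by blast
    define e where "e = - h x"
    have e: "e > 0" using x(2)[OF y1A] y1(2) by (simp add: e_def)
    \<comment> \<open>The minimum is attained strictly inside the shell: \<open>h\<close> vanishes
      on the inner sphere and is positive from \<mu> on.\<close>
    have nx: "t < norm x" "norm x < \<mu>"
    proof -
      show "norm x < \<mu>" using x(1) far[of x] e by (force simp: e_def)
      have "h x = 0" if "norm x = t"
      proof -
        have "inversion t x = x" "t / norm x = 1" using that t0 by (auto simp: inversion_def)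
        then show ?thesis using t0 by (simp add: h_def kelvin_def)
      qed
      then show "t < norm x" using x(1) e by (force simp: e_def)
    qed
    have hmin: "- e \<le> h z" if "norm z > t" for z
    proof (cases "norm z \<le> \<mu>")
      case True
      then show ?thesis using x(2)[of z] that by (simp add: e_def)
    next
      case False
      then show ?thesis using far[of z] e by simp
    qed
    have wu: "- e \<le> u z - kelvin t u z" and wv: "- e \<le> v z - kelvin t v z" if "norm z > t" for z
      using hmin[OF that] by (auto simp: h_def)
    have x2: "norm x \<le> 2 * \<tau>" using nx \<mu> by simp
    note bnd = bu[OF t(1) less_imp_le[OF nx(1)] x2] bv[OF t(1) less_imp_le[OF nx(1)] x2]
    have dt: "\<delta> \<le> t" "norm x < t + \<delta>" using \<delta> t nx by (auto simp: \<mu>_def)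
    have le: "kelvin t u x \<le> u x + e" "kelvin t v x \<le> v x + e" using wu[OF nx(1)] wv[OF nx(1)] by auto
    have "h x = u x - kelvin t u x \<or> h x = v x - kelvin t v x" by (auto simp: h_def min_def)
    then show False
    proof
      assume hx: "h x = u x - kelvin t u x"
      show False
      proof (rule narrow_contradiction[OF u v eq(1) t0(1) \<delta>(1) dt(1) nx(1) dt(2) e _ wu wv[OF nx(1)]])
        show "nonlin \<alpha>\<^sub>1 \<beta> (kelvin t u x) (kelvin t v x) - nonlin \<alpha>\<^sub>1 \<beta> (u x) (v x) \<le> \<Lambda>1 * e"
          using bnd le e by (intro L1(2)) auto
      qed (use hx big \<Lambda> in \<open>auto simp: e_def C_def\<close>)
    next
      assume hx: "h x = v x - kelvin t v x"
      show False
      proof (rule narrow_contradiction[OF v u eq(2) t0(1) \<delta>(1) dt(1) nx(1) dt(2) e _ wv wu[OF nx(1)]])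
        show "nonlin \<alpha>\<^sub>2 \<beta> (kelvin t v x) (kelvin t u x) - nonlin \<alpha>\<^sub>2 \<beta> (v x) (u x) \<le> \<Lambda>2 * e"
          using bnd le e by (intro L2(2)) auto
      qed (use hx big \<Lambda> in \<open>auto simp: e_def C_def\<close>)
    qed
  qed
  then show ?thesis using \<delta> d1 d2 by (intro exI[of _ "min \<delta> (min d1 d2)"]) auto
qed

theorem moving_spheres_dichotomy:
  assumes u: "regular u" and v: "regular v" and eq: "solves \<alpha>\<^sub>1 \<beta> u v" "solves \<alpha>\<^sub>2 \<beta> v u"
    and pos: "\<alpha>\<^sub>1 > 0" "\<alpha>\<^sub>2 > 0" "\<beta> > 0"
  shows "(\<forall>l>0. below l u \<and> below l v) \<or>
    (\<exists>l>0. \<forall>y. y \<noteq> 0 \<longrightarrow> kelvin l u y = u y \<and> kelvin l v y = v y)"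
proof (rule disjCI)
  assume no: "\<not> (\<exists>l>0. \<forall>y. y \<noteq> 0 \<longrightarrow> kelvin l u y = u y \<and> kelvin l v y = v y)"
  show "\<forall>l>0. below l u \<and> below l v"
  proof (rule ccontr)
    assume neg: "\<not> ?thesis"
    define B where "B = {l. l > 0 \<and> \<not> (below l u \<and> below l v)}"
    have ne: "B \<noteq> {}" using neg by (auto simp: B_def)
    have sup: "\<exists>L\<ge>0. flap f x L" if "regular f" "regular g" "solves \<alpha> \<beta> f g" "\<alpha> > 0" for f g \<alpha> x
      using that pos(3) nonlin_pos[of \<alpha> \<beta> "f x" "g x"] unfolding solves_def
      by (intro exI[of _ "nonlin \<alpha> \<beta> (f x) (g x)"]) (auto simp: regular_pos less_imp_le)
    obtain c1 where "c1 > 0" "\<And>y. 1 \<le> norm y \<Longrightarrow> c1 * riesz y \<le> u y"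
      using superharmonic_lower_bound[OF regular_cont[OF u] regular_pos[OF u] sup[OF u v eq(1) pos(1)]] by blast
    then obtain l1 where l1: "l1 > 0" "\<And>l. 0 < l \<Longrightarrow> l \<le> l1 \<Longrightarrow> below l u" using below_small[OF u] by blast
    obtain c2 where "c2 > 0" "\<And>y. 1 \<le> norm y \<Longrightarrow> c2 * riesz y \<le> v y"
      using superharmonic_lower_bound[OF regular_cont[OF v] regular_pos[OF v] sup[OF v u eq(2) pos(2)]] by blast
    then obtain l2 where l2: "l2 > 0" "\<And>l. 0 < l \<Longrightarrow> l \<le> l2 \<Longrightarrow> below l v" using below_small[OF v] by blast
    define \<tau> where "\<tau> = Inf B"
    have "min l1 l2 \<le> l" if "l \<in> B" for l
      using that l1(2)[of l] l2(2)[of l] by (force simp: B_def)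
    then have "min l1 l2 \<le> \<tau>" unfolding \<tau>_def by (intro cInf_greatest[OF ne])
    then have \<tau>: "\<tau> > 0" using l1 l2 by (metis min_less_iff_conj less_le_trans)
    have bdd: "bdd_below B" by (rule bdd_belowI[of _ 0]) (auto simp: B_def)
    have small: "below l u \<and> below l v" if "0 < l" "l < \<tau>" for l
    proof (rule ccontr)
      assume "\<not> ?thesis"
      then have "l \<in> B" using that by (simp add: B_def)
      then have "\<tau> \<le> l" unfolding \<tau>_def by (rule cInf_lower[OF _ bdd])
      then show False using that by simp
    qed
    have b: "below \<tau> u" "below \<tau> v" using below_closed[OF u \<tau>] below_closed[OF v \<tau>] small by auto
    have anti: "\<forall>y. y \<noteq> 0 \<longrightarrow> kelvin \<tau> f y = f y"
      if "\<And>y. norm y > \<tau> \<Longrightarrow> f y - kelvin \<tau> f y = 0" for f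
      using antisym_eq_0[OF \<tau> antisym_diff_kelvin[OF \<tau>, of f] that] by auto
    \<comment> \<open>Otherwise both differences vanish outside the sphere, hence by antisymmetry
      everywhere off the origin, which was excluded.\<close>
    have "(\<exists>z. norm z > \<tau> \<and> u z - kelvin \<tau> u z > 0) \<or> (\<exists>z. norm z > \<tau> \<and> v z - kelvin \<tau> v z > 0)"
    proof (rule ccontr)
      assume none: "\<not> ?thesis"
      have "u y - kelvin \<tau> u y = 0 \<and> v y - kelvin \<tau> v y = 0" if y: "norm y > \<tau>" for y
      proof -
        have "kelvin \<tau> u y \<le> u y" "kelvin \<tau> v y \<le> v y" using b y by (auto simp: below_def)
        moreover have "\<not> u y - kelvin \<tau> u y > 0" "\<not> v y - kelvin \<tau> v y > 0" using none y by auto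
        ultimately show ?thesis by linarith
      qed
      then show False using no \<tau> anti[of u] anti[of v] by blast
    qed
    then have "(\<forall>y. norm y > \<tau> \<longrightarrow> u y - kelvin \<tau> u y > 0) \<and> (\<forall>y. norm y > \<tau> \<longrightarrow> v y - kelvin \<tau> v y > 0)"
      using positive_or_zero[OF u v eq(1) pos(1,3) \<tau> b] positive_or_zero[OF v u eq(2) pos(2,3) \<tau> b(2,1)]
        positive_propagates[OF u v eq(2) pos(2,3) \<tau> b(2)] positive_propagates[OF v u eq(1) pos(1,3) \<tau> b(1)]
      by blast
    then obtain \<delta> where \<delta>: "\<delta> > 0" "\<And>t. \<tau> \<le> t \<Longrightarrow> t < \<tau> + \<delta> \<Longrightarrow> below t u \<and> below t v"
      using move_further[OF u v eq pos \<tau>] by blast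
    obtain l where "l \<in> B" "l < \<tau> + \<delta>"
      using cInf_lessD[OF ne, of "\<tau> + \<delta>"] \<delta>(1) unfolding \<tau>_def by auto
    moreover have "\<tau> \<le> l" unfolding \<tau>_def by (rule cInf_lower[OF \<open>l \<in> B\<close> bdd])
    ultimately show False using \<delta>(2)[of l] by (simp add: B_def)
  qed
qed

end

section \<open>Classification\<close>

text \<open>Expanding the functional equation as \<open>y\<close> tends to infinity shows that the derivative of
  \<open>q x - (norm x)\<^sup>2\<close> does not depend on \<open>x\<close>.\<close>

lemma inversion_invariant_is_quadratic:
  fixes q :: "'a::euclidean_space \<Rightarrow> real"
  assumes pos: "\<And>x. q x > 0" and diff: "\<And>x. q differentiable (at x)"
    and inv: "\<And>x y. y \<noteq> 0 \<Longrightarrow> q (x + y) = (norm y)\<^sup>2 / q x * q (x + (q x / (norm y)\<^sup>2) *\<^sub>R y)"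
  shows "\<exists>p C. \<forall>x. q x = (norm (x - p))\<^sup>2 + C"
proof -
  obtain D where D: "\<And>x. (q has_derivative D x) (at x)"
    using diff unfolding differentiable_def by metis
  have lim: "((\<lambda>t. (q (t *\<^sub>R h) - t\<^sup>2 * (norm h)\<^sup>2) / t) \<longlongrightarrow> D x h - 2 * (h \<bullet> x)) at_top" if h: "h \<noteq> 0" for x h
  proof -
    \<comment> \<open>With this choice \<open>x + y t = t *\<^sub>R h\<close> does not depend on
      \<open>x\<close>, while its inverse point \<open>x + z t\<close> tends to
      \<open>x\<close>.\<close>
    define y where "y t = t *\<^sub>R h - x" for t
    define z where "z t = (q x / (norm (y t))\<^sup>2) *\<^sub>R y t" for t
    define R where "R w = (q (x + w) - q x - D x w) / norm w" for w
    have bl: "bounded_linear (D x)" using D has_derivative_bounded_linear by blast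
    interpret Dx: bounded_linear "D x" by (rule bl)
    have ynorm: "((\<lambda>t. norm (y t) / t) \<longlongrightarrow> norm h) at_top"
    proof -
      have "((\<lambda>t::real. h - (1 / t) *\<^sub>R x) \<longlongrightarrow> h - 0 *\<^sub>R x) at_top"
        by (intro tendsto_intros) real_asymp
      then have "((\<lambda>t::real. norm (h - (1 / t) *\<^sub>R x)) \<longlongrightarrow> norm (h - 0 *\<^sub>R x)) at_top" by (rule tendsto_norm)
      moreover have "\<forall>\<^sub>F t in at_top. norm (h - (1 / t) *\<^sub>R x) = norm (y t) / t"
        using eventually_gt_at_top[of "0::real"]
      proof eventually_elim
        fix t :: real assume t: "0 < t"
        have "h - (1 / t) *\<^sub>R x = (1 / t) *\<^sub>R y t" using t by (simp add: y_def scaleR_diff_right)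
        then show "norm (h - (1 / t) *\<^sub>R x) = norm (y t) / t" using t by simp
      qed
      ultimately show ?thesis using Lim_transform_eventually by fastforce
    qed
    have ev: "\<forall>\<^sub>F t in at_top. norm (y t) / t * t = norm (y t)"
      using eventually_gt_at_top[of "0::real"] by eventually_elim simp
    have "filterlim (\<lambda>t. norm (y t) / t * t) at_top at_top"
      by (rule filterlim_tendsto_pos_mult_at_top[OF ynorm _ filterlim_ident]) (use h in simp)
    then have ytop: "filterlim (\<lambda>t. norm (y t)) at_top at_top"
      by (rule filterlim_cong[OF refl refl ev, THEN iffD1])
    have ynz: "\<forall>\<^sub>F t in at_top. y t \<noteq> 0 \<and> t > 0"
      using filterlim_at_top_dense[THEN iffD1, OF ytop, rule_format, of 0] eventually_gt_at_top[of "0::real"]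
      by eventually_elim auto
    have znorm: "norm (z t) = q x / norm (y t)" for t
      using pos[of x] by (simp add: z_def power2_eq_square)
    have "((\<lambda>t. q x / norm (y t)) \<longlongrightarrow> 0) at_top"
      by (rule real_tendsto_divide_at_top[OF tendsto_const ytop])
    then have "((\<lambda>t. norm (z t)) \<longlongrightarrow> 0) at_top" unfolding znorm .
    then have "(z \<longlongrightarrow> 0) at_top" by (rule tendsto_norm_zero_cancel)
    moreover have "\<forall>\<^sub>F t in at_top. z t \<noteq> 0"
      using ynz by eventually_elim (use pos[of x] in \<open>auto simp: z_def\<close>)
    ultimately have zat: "filterlim z (at 0) at_top" by (simp add: filterlim_at)
    have "((\<lambda>w. norm (q (x + w) - q x - D x w) / norm w) \<longlongrightarrow> 0) (at 0)"
      using D[of x] unfolding has_derivative_at by blast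
    then have "((\<lambda>w. \<bar>R w\<bar>) \<longlongrightarrow> 0) (at 0)" by (simp add: R_def)
    then have "(R \<longlongrightarrow> 0) (at 0)" by (rule tendsto_rabs_zero_cancel)
    then have Rz: "((\<lambda>t. R (z t)) \<longlongrightarrow> 0) at_top" using zat by (rule filterlim_compose)
    \<comment> \<open>The point \<open>z t\<close> has norm of order \<open>1 / t\<close>, and the
      equation multiplies \<open>q\<close> there by a factor of order \<open>t\<^sup>2\<close>;
      after division by \<open>t\<close> precisely the first derivative of \<open>q\<close> at
      \<open>x\<close> survives.\<close>
    have t1: "((\<lambda>t. (norm x)\<^sup>2 / t - 2 * (h \<bullet> x) + (D x h - D x x / t) + norm (y t) / t * R (z t))
        \<longlongrightarrow> 0 - 2 * (h \<bullet> x) + (D x h - 0) + norm h * 0) at_top"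
      by (intro tendsto_intros ynorm Rz real_tendsto_divide_at_top[OF tendsto_const] filterlim_ident)
    have "\<forall>\<^sub>F t in at_top. (norm x)\<^sup>2 / t - 2 * (h \<bullet> x) + (D x h - D x x / t) + norm (y t) / t * R (z t)
        = (q (t *\<^sub>R h) - t\<^sup>2 * (norm h)\<^sup>2) / t"
      using ynz
    proof eventually_elim
      fix t assume t: "y t \<noteq> 0 \<and> t > 0"
      define s where "s = norm (y t)"
      have s: "s > 0" using t by (simp add: s_def)
      have qx: "q x > 0" by (rule pos)
      have "q (t *\<^sub>R h) = q (x + y t)" by (simp add: y_def)
      also have "\<dots> = s\<^sup>2 / q x * q (x + z t)" using inv[of "y t" x] t by (simp add: s_def z_def)
      also have "q (x + z t) = q x + D x (z t) + norm (z t) * R (z t)"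
        using znorm[of t] s qx by (simp add: R_def s_def)
      also have "D x (z t) = q x / s\<^sup>2 * D x (y t)" by (simp add: z_def Dx.scaleR s_def)
      also have "norm (z t) = q x / s" unfolding znorm s_def ..
      also have "s\<^sup>2 / q x * (q x + q x / s\<^sup>2 * D x (y t) + q x / s * R (z t)) = s\<^sup>2 + D x (y t) + s * R (z t)"
        using s qx by (simp add: field_simps power2_eq_square)
      also have "D x (y t) = t * D x h - D x x" by (simp add: y_def Dx.diff Dx.scaleR)
      also have "s\<^sup>2 = t\<^sup>2 * (norm h)\<^sup>2 - 2 * t * (h \<bullet> x) + (norm x)\<^sup>2"
        unfolding s_def y_def power2_norm_eq_inner
        by (simp add: inner_diff inner_commute algebra_simps power2_eq_square)
      finally have "q (t *\<^sub>R h) - t\<^sup>2 * (norm h)\<^sup>2 = (norm x)\<^sup>2 - 2 * t * (h \<bullet> x) + (t * D x h - D x x) + s * R (z t)"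
        by simp
      then show "(norm x)\<^sup>2 / t - 2 * (h \<bullet> x) + (D x h - D x x / t) + norm (y t) / t * R (z t)
        = (q (t *\<^sub>R h) - t\<^sup>2 * (norm h)\<^sup>2) / t"
        using t by (simp add: s_def add_divide_distrib diff_divide_distrib)
    qed
    from Lim_transform_eventually[OF t1 this] show ?thesis by simp
  qed
  have D0: "D x h = D 0 h + 2 * (h \<bullet> x)" for x h
  proof (cases "h = 0")
    case True
    then show ?thesis using D has_derivative_bounded_linear linear_0 bounded_linear.linear by (metis add_0 inner_zero_left mult_zero_right)
  next
    case False
    have "D x h - 2 * (h \<bullet> x) = D 0 h - 2 * (h \<bullet> 0)"
      by (rule tendsto_unique[OF _ lim[OF False] lim[OF False]]) simp
    then show ?thesis by simp
  qed
  \<comment> \<open>\<open>p\<close> represents the linear form \<open>D 0\<close> through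
    \<open>- 2 * (h \<bullet> p)\<close>, the derivative at 0 of the squared distance to
    \<open>p\<close>.\<close>
  define p where "p = (- 1 / 2) *\<^sub>R (\<Sum>b\<in>Basis. D 0 b *\<^sub>R b)"
  have lin0: "linear (D 0)" using D has_derivative_linear by blast
  have D0p: "D 0 h = - 2 * (h \<bullet> p)" for h
  proof -
    have "D 0 h = D 0 (\<Sum>b\<in>Basis. (h \<bullet> b) *\<^sub>R b)" by (simp add: euclidean_representation)
    also have "\<dots> = (\<Sum>b\<in>Basis. (h \<bullet> b) * D 0 b)" by (simp add: linear_sum[OF lin0] linear_cmul[OF lin0])
    also have "\<dots> = h \<bullet> (\<Sum>b\<in>Basis. D 0 b *\<^sub>R b)" by (simp add: inner_sum_right mult.commute)
    finally show ?thesis by (simp add: p_def)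
  qed
  have "((\<lambda>x. q x - (x - p) \<bullet> (x - p)) has_derivative (\<lambda>h. 0)) (at x within UNIV)" for x
  proof -
    have "((\<lambda>x. q x - (x - p) \<bullet> (x - p)) has_derivative (\<lambda>h. D x h - ((x - p) \<bullet> h + h \<bullet> (x - p)))) (at x)"
      by (auto intro!: derivative_eq_intros D)
    then show ?thesis
      by (rule has_derivative_eq_rhs) (auto simp: D0[of x] D0p fun_eq_iff inner_diff inner_commute algebra_simps)
  qed
  then obtain C where "\<And>x. q x - (x - p) \<bullet> (x - p) = C"
    using has_derivative_zero_constant[of UNIV "\<lambda>x. q x - (x - p) \<bullet> (x - p)"] by auto
  then have "q x = (norm (x - p))\<^sup>2 + C" for x by (metis add.commute diff_add_cancel power2_norm_eq_inner)
  then show ?thesis by blast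
qed

context fractional
begin

section \<open>Consequences of admissible radii and of spheres of symmetry\<close>

lemma flap_unique: "flap w x A \<Longrightarrow> flap w x B \<Longrightarrow> A = B"
  unfolding flap_def pv_int_def by (auto intro: tendsto_unique[of "at_right (0::real)"])

lemma regular_translate:
  assumes "regular u"
  shows "regular (\<lambda>y. u (x + y))"
  unfolding regular_def
proof (intro conjI allI)
  show "0 < u (x + y)" for y by (rule regular_pos[OF assms])
  show "continuous_on UNIV (\<lambda>y. u (x + y))"
    by (rule continuous_on_compose2[OF regular_cont[OF assms, of UNIV]]) (auto intro: continuous_intros)
  fix z
  obtain d M where d: "d > 0" "\<And>a b. dist (x + z) a < d \<Longrightarrow> dist (x + z) b < d \<Longrightarrow> \<bar>u a - u b\<bar> \<le> M * dist a b"
    using assms unfolding regular_def by blast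
  have "\<bar>u (x + a) - u (x + b)\<bar> \<le> M * dist a b" if "dist z a < d" "dist z b < d" for a b
    using d(2)[of "x + a" "x + b"] that by simp
  then show "\<exists>d>0. \<exists>M. \<forall>a b. dist z a < d \<longrightarrow> dist z b < d \<longrightarrow> \<bar>u (x + a) - u (x + b)\<bar> \<le> M * dist a b"
    using d(1) by blast
qed

lemma flap_translate:
  assumes [measurable]: "u \<in> borel_measurable borel" and L: "flap u (x + y) L"
  shows "flap (\<lambda>y. u (x + y)) y L"
proof -
  let ?f = "\<lambda>\<epsilon> z. indicator (- ball (x + y) \<epsilon>) z * ((u (x + y) - u z) / norm (x + y - z) powr eb)"
  have eq: "?f \<epsilon> (x + z) = indicator (- ball y \<epsilon>) z * ((u (x + y) - u (x + z)) / norm (y - z) powr eb)" for \<epsilon> z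
    by (simp add: indicator_def)
  have [measurable]: "?f \<epsilon> \<in> borel_measurable borel" for \<epsilon> by measurable
  have "integrable lborel (\<lambda>z. ?f \<epsilon> (x + z)) \<longleftrightarrow> integrable lborel (?f \<epsilon>)" for \<epsilon>
    by (rule integrable_translation_iff) measurable
  moreover have "(\<integral>z. ?f \<epsilon> (x + z) \<partial>lborel) = integral\<^sup>L lborel (?f \<epsilon>)" for \<epsilon>
    by (rule integral_translation) measurable
  ultimately show ?thesis using L unfolding flap_def pv_int_def eq by simp
qed

lemma solves_translate:
  assumes "regular u" "solves \<alpha> \<beta> u v"
  shows "solves \<alpha> \<beta> (\<lambda>y. u (x + y)) (\<lambda>y. v (x + y))"
  using assms unfolding solves_def by (auto intro: flap_translate regular_borel)

text \<open>Any \<open>y\<close> can be inverted to any other point \<open>z\<close> in a sphere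
  whose centre lies on their line, beyond \<open>z\<close>. As the centre moves to infinity the
  Kelvin weight tends to 1, leaving \<open>u z \<le> u y\<close>; exchanging the points gives
  equality.\<close>

lemma below_all_imp_constant:
  assumes b: "\<And>x l. l > 0 \<Longrightarrow> below l (\<lambda>y. u (x + y))"
  shows "u y = u z"
proof -
  have le: "u z \<le> u y" for y z
  proof (cases "y = z")
    case False
    define d where "d = norm (y - z)"
    have d: "d > 0" using False by (simp add: d_def)
    have st: "(sqrt (t / (1 + t))) powr ea * u z \<le> u y" if t: "t > 0" for t
    proof -
      define x where "x = z + t *\<^sub>R (z - y)"
      \<comment> \<open>The squared radius is the product of the distances
        \<open>(1 + t) * d\<close> and \<open>t * d\<close> of \<open>y\<close> and \<open>z\<close>
        from the centre.\<close>
      define l where "l = sqrt (t * (1 + t)) * d"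
      have l: "l > 0" using t d by (simp add: l_def)
      have yx: "y - x = (1 + t) *\<^sub>R (y - z)" by (simp add: x_def algebra_simps)
      have n: "norm (y - x) = (1 + t) * d" using t by (simp add: yx d_def)
      have r: "l / norm (y - x) = sqrt (t / (1 + t))"
      proof -
        have "l / norm (y - x) = sqrt (t * (1 + t)) / (1 + t)" using d t unfolding n l_def by simp
        also have "\<dots> = sqrt t * sqrt (1 + t) / (sqrt (1 + t) * sqrt (1 + t))"
          using t by (simp add: real_sqrt_mult)
        also have "\<dots> = sqrt (t / (1 + t))" using t by (subst mult_divide_mult_cancel_right) (auto simp: real_sqrt_divide)
        finally show ?thesis .
      qed
      have "l \<le> norm (y - x)"
      proof -
        have "l / norm (y - x) \<le> 1" unfolding r using t by simp
        then show ?thesis using n d t by (simp add: pos_divide_le_eq)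
      qed
      moreover have "x + inversion l (y - x) = z"
      proof -
        have "inversion l (y - x) = (t / (1 + t)) *\<^sub>R ((1 + t) *\<^sub>R (y - z))"
          unfolding inversion_def r unfolding yx using t by simp
        also have "\<dots> = t *\<^sub>R (y - z)" using t by simp
        finally show ?thesis by (simp add: x_def algebra_simps)
      qed
      ultimately show ?thesis
        using b[OF l, of x] unfolding below_def kelvin_def
        by (metis add.commute diff_add_cancel r)
    qed
    have "\<forall>\<^sub>F t in at_top. (sqrt (t / (1 + t))) powr ea * u z \<le> u y"
      using eventually_gt_at_top[of "0::real"] by eventually_elim (rule st)
    moreover have "((\<lambda>t::real. sqrt (t / (1 + t))) \<longlongrightarrow> 1) at_top" by real_asymp
    then have "((\<lambda>t::real. (sqrt (t / (1 + t))) powr ea * u z) \<longlongrightarrow> 1 powr ea * u z) at_top"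
      by (intro tendsto_intros) auto
    ultimately have "1 powr ea * u z \<le> u y" by (intro tendsto_upperbound[of _ _ at_top]) auto
    then show ?thesis by simp
  qed simp
  show ?thesis using le[of y z] le[of z y] by simp
qed

definition inversion_symmetric :: "(real^'n \<Rightarrow> real) \<Rightarrow> real^'n \<Rightarrow> real \<Rightarrow> bool" where
  "inversion_symmetric u x l \<longleftrightarrow> (\<forall>y. y \<noteq> 0 \<longrightarrow> u (x + y) = (l / norm y) powr ea * u (x + inversion l y))"

lemma regular_bounds_cball:
  assumes u: "regular u"
  obtains m M where "m > 0" "\<And>y. y \<in> cball x 1 \<Longrightarrow> m \<le> u y \<and> u y \<le> M"
proof -
  have ne: "cball x 1 \<noteq> {}" by simp
  obtain y0 where "\<And>y. y \<in> cball x 1 \<Longrightarrow> u y0 \<le> u y"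
    using continuous_attains_inf[OF compact_cball ne regular_cont[OF u]] by blast
  moreover obtain y1 where "\<And>y. y \<in> cball x 1 \<Longrightarrow> u y \<le> u y1"
    using continuous_attains_sup[OF compact_cball ne regular_cont[OF u]] by blast
  ultimately show ?thesis using that[of "u y0" "u y1"] regular_pos[OF u] by blast
qed

text \<open>A sphere of symmetry forces \<open>u\<close> to decay like a fixed multiple of
  \<open>riesz\<close>, while admissibility of \<open>l\<close> about \<open>x\<close> gives a lower
  bound of the same order with the factor \<open>l powr ea\<close>, which is unbounded in
  \<open>l\<close>.\<close>

lemma symmetric_not_below_all:
  assumes u: "regular u" and l0: "l0 > 0" and s: "inversion_symmetric u x0 l0"
    and b: "\<And>l. l > 0 \<Longrightarrow> below l (\<lambda>y. u (x + y))"
  shows False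
proof -
  obtain m M' where m: "m > 0" "\<And>y. y \<in> cball x 1 \<Longrightarrow> m \<le> u y \<and> u y \<le> M'" using regular_bounds_cball[OF u] by blast
  obtain m' M where M: "m' > 0" "\<And>y. y \<in> cball x0 1 \<Longrightarrow> m' \<le> u y \<and> u y \<le> M" using regular_bounds_cball[OF u] by blast
  have bound: "l powr ea \<le> (l0 powr ea * M * 2 powr ea) / m" if l: "l \<ge> 1" for l
  proof -
    \<comment> \<open>Large enough that both inverted points come within distance 1 of their
      centres, and that moving the centre from \<open>x\<close> to \<open>x0\<close> at most halves
      the distance.\<close>
    define r where "r = max (l\<^sup>2) (max (2 * norm (x - x0)) (2 * l0\<^sup>2))"
    have r: "r > 0" "r \<ge> l\<^sup>2" "r \<ge> 2 * norm (x - x0)" "r \<ge> 2 * l0\<^sup>2" using l by (auto simp: r_def max_def)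
    obtain y :: "real^'n" where y: "norm y = r" using vector_choose_size[of r] r by auto
    define w where "w = x + y - x0"
    have nw: "norm w \<ge> r / 2"
      using norm_triangle_ineq2[of y "x0 - x"] y r unfolding w_def by (simp add: norm_minus_commute algebra_simps)
    have w0: "w \<noteq> 0" using nw r by auto
    have lr: "l \<le> r" using r l by (smt (verit) mult_left_le_one_le power2_eq_square mult_le_cancel_left1)
    have "norm (inversion l y) \<le> 1" using r y by (simp add: norm_inversion)
    then have "m \<le> u (x + inversion l y)" using m(2)[of "x + inversion l y"] by (simp add: dist_norm)
    then have "(l / r) powr ea * m \<le> (l / r) powr ea * u (x + inversion l y)" by (intro mult_left_mono) auto
    also have "\<dots> \<le> u (x + y)" using b[of l] l lr y unfolding below_def kelvin_def by auto
    also have "\<dots> = u (x0 + w)" by (simp add: w_def)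
    also have "\<dots> = (l0 / norm w) powr ea * u (x0 + inversion l0 w)"
      using s w0 unfolding inversion_symmetric_def by blast
    also have "\<dots> \<le> (l0 / (r / 2)) powr ea * M"
    proof (rule mult_mono)
      show "(l0 / norm w) powr ea \<le> (l0 / (r / 2)) powr ea"
        using nw r l0 ea_pos by (intro powr_mono2 divide_left_mono mult_pos_pos) auto
      have "norm (inversion l0 w) \<le> 1" using nw r w0 by (simp add: norm_inversion)
      then show "u (x0 + inversion l0 w) \<le> M" using M(2)[of "x0 + inversion l0 w"] by (simp add: dist_norm)
    qed (use regular_pos[OF u] in \<open>auto simp: less_imp_le\<close>)
    finally have "l powr ea * m / r powr ea \<le> (l0 powr ea * M * 2 powr ea) / r powr ea"
      using r l0 by (simp add: powr_divide powr_mult mult_ac)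
    then have "l powr ea * m \<le> l0 powr ea * M * 2 powr ea" using r by (simp add: divide_le_cancel)
    then show ?thesis using m by (simp add: pos_le_divide_eq)
  qed
  have "filterlim (\<lambda>l::real. l powr ea) at_top at_top" using ea_pos by real_asymp
  then have "\<forall>\<^sub>F l::real in at_top. (l0 powr ea * M * 2 powr ea) / m < l powr ea"
    by (simp add: filterlim_at_top_dense)
  then have "\<forall>\<^sub>F l::real in at_top. False"
    using eventually_ge_at_top[of "1::real"] by eventually_elim (use bound in force)
  then show False by simp
qed

text \<open>The limit does not depend on \<open>x\<close>, so it determines the radii of all spheres of symmetry.\<close>

lemma symmetric_limit:
  assumes u: "regular u" and l: "l > 0" and s: "inversion_symmetric u x l" and e: "norm e = 1"
  shows "((\<lambda>t. t powr ea * u (t *\<^sub>R e)) \<longlongrightarrow> l powr ea * u x) at_top"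
proof -
  define y where "y t = t *\<^sub>R e - x" for t
  have low: "t - norm x \<le> norm (y t)" and up: "norm (y t) \<le> t + norm x" if "t > 0" for t
    using norm_triangle_ineq2[of "t *\<^sub>R e" x] norm_triangle_ineq4[of "t *\<^sub>R e" x] e that by (auto simp: y_def)
  have ytop: "filterlim (\<lambda>t. norm (y t)) at_top at_top"
  proof (rule filterlim_at_top_mono)
    show "filterlim (\<lambda>t. t - norm x) at_top at_top" by real_asymp
    show "\<forall>\<^sub>F t in at_top. t - norm x \<le> norm (y t)"
      using eventually_gt_at_top[of "0::real"] by eventually_elim (rule low)
  qed
  have ynz: "\<forall>\<^sub>F t in at_top. y t \<noteq> 0 \<and> t > 0 \<and> t > norm x"
    using filterlim_at_top_dense[THEN iffD1, OF ytop, rule_format, of 0] eventually_gt_at_top[of "0::real"]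
      eventually_gt_at_top[of "norm x"]
    by eventually_elim auto
  have ratio: "((\<lambda>t. t / norm (y t)) \<longlongrightarrow> 1) at_top"
  proof (rule tendsto_sandwich)
    show "((\<lambda>t. t / (t + norm x)) \<longlongrightarrow> 1) at_top" "((\<lambda>t. t / (t - norm x)) \<longlongrightarrow> 1) at_top" by real_asymp+
    show "\<forall>\<^sub>F t in at_top. t / (t + norm x) \<le> t / norm (y t)"
      using ynz by eventually_elim (use up in \<open>auto intro!: divide_left_mono mult_pos_pos add_pos_nonneg\<close>)
    show "\<forall>\<^sub>F t in at_top. t / norm (y t) \<le> t / (t - norm x)"
      using ynz by eventually_elim (use low in \<open>auto intro!: divide_left_mono mult_pos_pos\<close>)
  qed
  have "((\<lambda>t. l\<^sup>2 / norm (y t)) \<longlongrightarrow> 0) at_top" by (rule real_tendsto_divide_at_top[OF tendsto_const ytop])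
  then have "((\<lambda>t. norm (inversion l (y t))) \<longlongrightarrow> 0) at_top" by (simp add: norm_inversion)
  then have "((\<lambda>t. inversion l (y t)) \<longlongrightarrow> 0) at_top" by (rule tendsto_norm_zero_cancel)
  then have "((\<lambda>t. x + inversion l (y t)) \<longlongrightarrow> x + 0) at_top" by (intro tendsto_intros)
  then have "((\<lambda>t. u (x + inversion l (y t))) \<longlongrightarrow> u x) at_top"
    using isCont_tendsto_compose[OF regular_isCont[OF u, of x]] by simp
  then have "((\<lambda>t. l powr ea * (t / norm (y t)) powr ea * u (x + inversion l (y t))) \<longlongrightarrow> l powr ea * 1 powr ea * u x) at_top"
    using ratio by (intro tendsto_intros) auto
  then have lim: "((\<lambda>t. l powr ea * (t / norm (y t)) powr ea * u (x + inversion l (y t))) \<longlongrightarrow> l powr ea * u x) at_top" by simp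
  have "\<forall>\<^sub>F t in at_top. l powr ea * (t / norm (y t)) powr ea * u (x + inversion l (y t)) = t powr ea * u (t *\<^sub>R e)"
    using ynz
  proof eventually_elim
    fix t assume t: "y t \<noteq> 0 \<and> t > 0 \<and> t > norm x"
    have "u (t *\<^sub>R e) = u (x + y t)" by (simp add: y_def)
    also have "\<dots> = (l / norm (y t)) powr ea * u (x + inversion l (y t))"
      using s t unfolding inversion_symmetric_def by blast
    finally show "l powr ea * (t / norm (y t)) powr ea * u (x + inversion l (y t)) = t powr ea * u (t *\<^sub>R e)"
      by (simp add: powr_divide)
  qed
  from Lim_transform_eventually[OF lim this] show ?thesis .
qed

theorem radial_and_proportional:
  assumes u: "regular u" and v: "regular v" and eq: "solves \<alpha>\<^sub>1 \<beta> u v" "solves \<alpha>\<^sub>2 \<beta> v u"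
    and pos: "\<alpha>\<^sub>1 > 0" "\<alpha>\<^sub>2 > 0" "\<beta> > 0" and diff: "\<And>x. u differentiable (at x)"
  shows "\<exists>p \<tau>. radial_about p u \<and> \<tau> > 0 \<and> (\<forall>x. v x = \<tau> * u x)"
proof -
  have dich: "(\<forall>l>0. below l (\<lambda>y. u (x + y)) \<and> below l (\<lambda>y. v (x + y))) \<or>
      (\<exists>l>0. inversion_symmetric u x l \<and> inversion_symmetric v x l)" for x
    using moving_spheres_dichotomy[OF regular_translate[OF u, of x] regular_translate[OF v, of x]
      solves_translate[OF u eq(1)] solves_translate[OF v eq(2)] pos]
    unfolding inversion_symmetric_def kelvin_def by metis
  obtain x0 l0 where l0: "l0 > 0" "inversion_symmetric u x0 l0"
  proof (rule ccontr)
    \<comment> \<open>Then every radius is admissible about every centre and \<open>u\<close> is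
      constant; its fractional Laplacian is 0, but the right-hand side is positive.\<close>
    assume no: "\<not> thesis"
    have "u y = u z" for y z
      by (rule below_all_imp_constant) (use dich no that in blast)
    then have "u = (\<lambda>_. u 0)" by (simp add: fun_eq_iff)
    moreover have "flap (\<lambda>_. u 0) 0 0" by (simp add: flap_def pv_int_def)
    ultimately have "flap u 0 0" by metis
    then have "nonlin \<alpha>\<^sub>1 \<beta> (u 0) (v 0) = 0" using eq(1) flap_unique unfolding solves_def by blast
    then show False using nonlin_pos[OF pos(1,3) regular_pos[OF u, of 0] regular_pos[OF v, of 0]] by simp
  qed
  have "\<exists>l>0. inversion_symmetric u x l \<and> inversion_symmetric v x l" for x
    using dich[of x] symmetric_not_below_all[OF u l0, of x] by blast
  then obtain l where l: "\<And>x. l x > 0" "\<And>x. inversion_symmetric u x (l x)" "\<And>x. inversion_symmetric v x (l x)"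
    by metis
  obtain e :: "real^'n" where e: "norm e = 1" using vector_choose_size[of 1] by auto
  have const: "l x powr ea * f x = l 0 powr ea * f 0" if "regular f" "\<And>x. inversion_symmetric f x (l x)" for f x
    by (rule tendsto_unique[OF _ symmetric_limit[OF that(1) l(1) that(2) e] symmetric_limit[OF that(1) l(1) that(2) e]]) simp
  define c where "c = l 0 powr ea * u 0"
  define c' where "c' = l 0 powr ea * v 0"
  have c: "c > 0" "c' > 0" using l(1)[of 0] regular_pos[OF u] regular_pos[OF v] by (auto simp: c_def c'_def)
  have lu: "l x powr ea * u x = c" for x using const[OF u l(2)] by (simp add: c_def)
  have lv: "l x powr ea * v x = c'" for x using const[OF v l(3)] by (simp add: c'_def)
  have vu: "v x = (c' / c) * u x" for x
  proof -
    have p: "l x powr ea > 0" using l(1)[of x] by simp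
    have "l x powr ea * (v x * c) = l x powr ea * (c' * u x)" using lu[of x] lv[of x] by (metis mult.left_commute mult.commute)
    then have "v x * c = c' * u x" using p by simp
    then show ?thesis using c by (simp add: field_simps)
  qed
  define q where "q x = (l x)\<^sup>2" for x
  \<comment> \<open>Since \<open>l x powr ea * u x\<close> is constant, the squared radius is a
    power of \<open>u\<close>; this supplies its differentiability and turns the symmetry of
    \<open>u\<close> into a functional equation.\<close>
  have ql: "q x = (c / u x) powr (2 / ea)" for x
  proof -
    have "c / u x = l x powr ea" using lu[of x] regular_pos[OF u, of x] by (simp add: field_simps)
    then show ?thesis using l(1)[of x] ea_pos by (simp add: powr_powr q_def)
  qed
  have "\<exists>p C. \<forall>x. q x = (norm (x - p))\<^sup>2 + C"
  proof (rule inversion_invariant_is_quadratic)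
    show "q x > 0" for x using l(1)[of x] by (simp add: q_def)
    show "q differentiable (at x)" for x
    proof -
      obtain D where "(u has_derivative D) (at x)" using diff[of x] unfolding differentiable_def by blast
      then have "(\<lambda>x. (c / u x) powr (2 / ea)) differentiable (at x)"
        using regular_pos[OF u, of x] c
        by (intro differentiableI[OF has_derivative_powr[OF has_derivative_divide[OF has_derivative_const]
          has_derivative_const]]) auto
      then show ?thesis by (simp add: ql[abs_def])
    qed
    fix x y :: "real^'n" assume y: "y \<noteq> 0"
    define w where "w = x + inversion (l x) y"
    have "u (x + y) = (l x / norm y) powr ea * u w"
      using l(2)[of x] y unfolding inversion_symmetric_def w_def by blast
    then have cu: "c / u (x + y) = (norm y / l x) powr ea * (c / u w)"
      by (simp add: powr_divide field_simps)
    have "q (x + y) = ((norm y / l x) powr ea) powr (2 / ea) * q w"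
      unfolding ql cu by (rule powr_mult)
    also have "((norm y / l x) powr ea) powr (2 / ea) = (norm y)\<^sup>2 / q x"
      using y l(1)[of x] ea_pos by (simp add: powr_powr q_def power_divide)
    also have "w = x + (q x / (norm y)\<^sup>2) *\<^sub>R y" by (simp add: w_def inversion_def q_def power_divide)
    finally show "q (x + y) = (norm y)\<^sup>2 / q x * q (x + (q x / (norm y)\<^sup>2) *\<^sub>R y)" .
  qed
  then obtain p C where q: "\<And>x. q x = (norm (x - p))\<^sup>2 + C" by blast
  have "radial_about p u"
    unfolding radial_about_def
  proof (intro allI impI)
    fix x y assume "norm (x - p) = norm (y - p)"
    \<comment> \<open>Points equidistant from \<open>p\<close> have spheres of symmetry of equal
      radius, hence equal values of \<open>u\<close>.\<close>
    then have "(l x)\<^sup>2 = (l y)\<^sup>2" using q[of x] q[of y] by (simp add: q_def)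
    then have "l x = l y" using l(1)[of x] l(1)[of y] by (simp add: power2_eq_iff)
    then show "u x = u y" using lu[of x] lu[of y] l(1)[of y] by (metis mult_cancel_left less_irrefl powr_gt_zero)
  qed
  then show ?thesis using vu c by (intro exI[of _ p] exI[of _ "c' / c"]) auto
qed

end

section \<open>Passage between the original statement and the normalised system\<close>

lemma C2_imp_differentiable: "u \<in> C2 \<Longrightarrow> u differentiable (at x)"
  unfolding C2_def differentiable_def by blast

lemma C2_imp_continuous:
  assumes "u \<in> C2"
  shows "continuous_on UNIV u"
  using C2_imp_differentiable[OF assms] by (intro continuous_at_imp_continuous_on) (auto intro: differentiable_imp_continuous_within)

lemma C2_locally_lipschitz:
  fixes u :: "real^'n \<Rightarrow> real"
  assumes "u \<in> C2"
  shows "\<exists>d>0. \<exists>M. \<forall>y z. dist x y < d \<longrightarrow> dist x z < d \<longrightarrow> \<bar>u y - u z\<bar> \<le> M * dist y z"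
proof -
  obtain u' u'' where u': "\<And>x. (u has_derivative blinfun_apply (u' x)) (at x)"
    and u'': "\<And>x. (u' has_derivative blinfun_apply (u'' x)) (at x)"
    using assms unfolding C2_def by blast
  have "continuous_on (cball x 1) u'"
    using u'' has_derivative_continuous by (intro continuous_at_imp_continuous_on) blast
  then have "bounded (u' ` cball x 1)" by (intro compact_imp_bounded compact_continuous_image) auto
  then obtain B where B: "\<And>y. y \<in> cball x 1 \<Longrightarrow> norm (u' y) \<le> B"
    unfolding bounded_iff by blast
  have "\<bar>u y - u z\<bar> \<le> B * dist y z" if "dist x y < 1" "dist x z < 1" for y z
  proof -
    have "norm (u y - u z) \<le> B * norm (y - z)"
    proof (rule differentiable_bound[of "cball x 1" u "\<lambda>y. blinfun_apply (u' y)"])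
      show "(u has_derivative blinfun_apply (u' w)) (at w within cball x 1)" for w
        using u' has_derivative_at_withinI by blast
      show "onorm (blinfun_apply (u' w)) \<le> B" if "w \<in> cball x 1" for w
        using B[OF that] by (simp add: norm_blinfun.rep_eq)
    qed (use that in auto)
    then show ?thesis by (simp add: dist_norm)
  qed
  then show ?thesis by (intro exI[of _ 1]) auto
qed

lemma C2_cmult:
  fixes u :: "real^'n \<Rightarrow> real"
  assumes "u \<in> C2"
  shows "(\<lambda>x. c * u x) \<in> C2"
proof -
  obtain u' u'' where u': "\<And>x. (u has_derivative blinfun_apply (u' x)) (at x)"
    and u'': "\<And>x. (u' has_derivative blinfun_apply (u'' x)) (at x)" and c: "continuous_on UNIV u''"
    using assms unfolding C2_def by blast
  have "((\<lambda>x. c * u x) has_derivative blinfun_apply (c *\<^sub>R u' x)) (at x)" for x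
    using has_derivative_mult_right[OF u', of c] by (simp add: scaleR_blinfun.rep_eq)
  moreover have "((\<lambda>x. c *\<^sub>R u' x) has_derivative blinfun_apply (c *\<^sub>R u'' x)) (at x)" for x
    using has_derivative_scaleR_right[OF u'', of c] by (simp add: scaleR_blinfun.rep_eq)
  moreover have "continuous_on UNIV (\<lambda>x. c *\<^sub>R u'' x)" by (intro continuous_intros c)
  ultimately show ?thesis
    unfolding C2_def by (intro CollectI exI[of _ "\<lambda>x. c *\<^sub>R u' x"] exI[of _ "\<lambda>x. c *\<^sub>R u'' x"]) auto
qed

lemma L_space_cmult:
  fixes u :: "real^'n \<Rightarrow> real"
  assumes "u \<in> L_space \<sigma>"
  shows "(\<lambda>x. c * u x) \<in> L_space \<sigma>"
proof -
  have "set_integrable lebesgue K (\<lambda>x. c * u x)" if "compact K" for K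
    using assms that unfolding L_space_def L1_loc_def by auto
  moreover have "integrable lebesgue (\<lambda>x. \<bar>c\<bar> * (\<bar>u x\<bar> / (1 + norm x powr (real CARD('n) + 2 * \<sigma>))))"
    using assms unfolding L_space_def by (intro integrable_mult_right) auto
  ultimately show ?thesis unfolding L_space_def L1_loc_def by (simp add: abs_mult)
qed

lemma has_frac_laplacian_cmult:
  assumes "has_frac_laplacian \<sigma> u x L"
  shows "has_frac_laplacian \<sigma> (\<lambda>y. c * u y) x (c * L)"
proof -
  let ?k = "\<lambda>y. norm (x - y) powr (real CARD('a) + 2 * \<sigma>)"
  have eq: "(c * u x - c * u y) / ?k y = c * ((u x - u y) / ?k y)" for y
    by (simp add: right_diff_distrib)
  have "set_integrable lebesgue (UNIV - ball x \<epsilon>) (\<lambda>y. c * ((u x - u y) / ?k y))" if "\<epsilon> > 0" for \<epsilon>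
    using assms that unfolding has_frac_laplacian_def by (intro set_integrable_mult_right) auto
  moreover have "((\<lambda>\<epsilon>. c * (frac_const CARD('a) \<sigma> * (LINT y : (UNIV - ball x \<epsilon>) | lebesgue. (u x - u y) / ?k y))) \<longlongrightarrow> c * L) (at_right 0)"
    using assms unfolding has_frac_laplacian_def by (intro tendsto_mult tendsto_const) auto
  moreover have "(LINT y : S | lebesgue. c * ((u x - u y) / ?k y)) = c * (LINT y : S | lebesgue. (u x - u y) / ?k y)" for S
    unfolding set_lebesgue_integral_def real_scaleR_def mult.left_commute[of _ c] by (rule integral_mult_right_zero)
  ultimately show ?thesis
    unfolding has_frac_laplacian_def eq by (simp only: mult.left_commute[of c]) blast
qed

lemma has_frac_laplacian_unique: "has_frac_laplacian \<sigma> u x A \<Longrightarrow> has_frac_laplacian \<sigma> u x B \<Longrightarrow> A = B"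
  unfolding has_frac_laplacian_def by (auto intro: tendsto_unique[of "at_right (0::real)"])

lemma frac_const_pos: "0 < \<sigma> \<Longrightarrow> \<sigma> < 1 \<Longrightarrow> frac_const n \<sigma> > 0"
  unfolding frac_const_def by (intro divide_pos_pos mult_pos_pos Gamma_real_pos) auto

context fractional
begin

lemma C2_imp_regular: "u \<in> C2 \<Longrightarrow> (\<And>x. u x > 0) \<Longrightarrow> regular u"
  unfolding regular_def using C2_imp_continuous C2_locally_lipschitz by blast

text \<open>Borel measurability of \<open>u\<close> allows the integrals over the completed measure
  to be read as integrals over \<open>lborel\<close>; the normalising constant is positive and can
  be divided out.\<close>

lemma has_frac_laplacian_imp_flap:
  assumes [measurable]: "u \<in> borel_measurable borel" and L: "has_frac_laplacian \<sigma> u x L"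
  shows "flap u x (L / frac_const CARD('n) \<sigma>)"
proof -
  let ?c = "frac_const CARD('n) \<sigma>"
  have c: "?c > 0" using \<sigma> by (intro frac_const_pos)
  let ?g = "\<lambda>y. (u x - u y) / norm (x - y) powr eb"
  let ?f = "\<lambda>\<epsilon> y. indicator (- ball x \<epsilon>) y * ?g y"
  have [measurable]: "?f \<epsilon> \<in> borel_measurable borel" for \<epsilon> by measurable
  have ind: "indicator (UNIV - ball x \<epsilon>) y *\<^sub>R ?g y = ?f \<epsilon> y" for \<epsilon> y by (simp add: Compl_eq_Diff_UNIV)
  have si: "set_integrable lebesgue (UNIV - ball x \<epsilon>) ?g \<longleftrightarrow> integrable lborel (?f \<epsilon>)" for \<epsilon>
    unfolding set_integrable_def ind by (rule integrable_completion) measurable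
  have sl: "(LINT y : (UNIV - ball x \<epsilon>) | lebesgue. ?g y) = integral\<^sup>L lborel (?f \<epsilon>)" for \<epsilon>
    unfolding set_lebesgue_integral_def ind by (rule integral_completion) measurable
  have "((\<lambda>\<epsilon>. ?c * integral\<^sup>L lborel (?f \<epsilon>)) \<longlongrightarrow> L) (at_right 0)"
    using L unfolding has_frac_laplacian_def eb_def[symmetric] sl by blast
  then have "((\<lambda>\<epsilon>. ?c * integral\<^sup>L lborel (?f \<epsilon>) / ?c) \<longlongrightarrow> L / ?c) (at_right 0)"
    using c by (intro tendsto_intros) auto
  then have "((\<lambda>\<epsilon>. integral\<^sup>L lborel (?f \<epsilon>)) \<longlongrightarrow> L / ?c) (at_right 0)" using c by simp
  moreover have "integrable lborel (?f \<epsilon>)" if "\<epsilon> > 0" for \<epsilon>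
    using L that unfolding has_frac_laplacian_def eb_def[symmetric] si by blast
  ultimately show ?thesis unfolding flap_def pv_int_def by blast
qed

lemma has_frac_laplacian_imp_solves:
  assumes "u \<in> borel_measurable borel"
    and "\<And>x. has_frac_laplacian \<sigma> u x (\<alpha> * u x powr (eb / ea) + \<beta> * u x powr (2 * \<sigma> / ea) * v x powr (real CARD('n) / ea))"
  shows "solves (\<alpha> / frac_const CARD('n) \<sigma>) (\<beta> / frac_const CARD('n) \<sigma>) u v"
  unfolding solves_def
proof
  fix x
  show "flap u x (nonlin (\<alpha> / frac_const CARD('n) \<sigma>) (\<beta> / frac_const CARD('n) \<sigma>) (u x) (v x))"
    using has_frac_laplacian_imp_flap[OF assms(1) assms(2)[of x]] by (simp add: nonlin_def add_divide_distrib)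
qed

text \<open>Once \<open>v = \<tau> * u\<close>, both equations have right-hand sides proportional to \<open>u powr (eb / ea)\<close>, and
  \<open>k\<close> normalises the factor to \<open>1\<close>.\<close>

lemma proportional_solution:
  fixes u :: "real^'n \<Rightarrow> real"
  assumes pos: "\<alpha>\<^sub>1 > 0" "\<alpha>\<^sub>2 > 0" "\<beta> > 0" "\<tau> > 0" and u: "u \<in> C2" "u \<in> L_space \<sigma>" "\<And>x. u x > 0"
    and v: "\<And>x. v x = \<tau> * u x"
    and eq1: "\<And>x. has_frac_laplacian \<sigma> u x (\<alpha>\<^sub>1 * u x powr (eb / ea) + \<beta> * u x powr (2 * \<sigma> / ea) * v x powr (real CARD('n) / ea))"
    and eq2: "\<And>x. has_frac_laplacian \<sigma> v x (\<alpha>\<^sub>2 * v x powr (eb / ea) + \<beta> * v x powr (2 * \<sigma> / ea) * u x powr (real CARD('n) / ea))"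
  shows "\<exists>k l U. k > 0 \<and> l > 0 \<and>
    \<alpha>\<^sub>1 * k powr (4 * \<sigma> / ea) + \<beta> * k powr ((4 * \<sigma> - real CARD('n)) / ea) * l powr (real CARD('n) / ea) = 1 \<and>
    \<alpha>\<^sub>2 * l powr (4 * \<sigma> / ea) + \<beta> * l powr ((4 * \<sigma> - real CARD('n)) / ea) * k powr (real CARD('n) / ea) = 1 \<and>
    U \<in> C2 \<inter> L_space \<sigma> \<and> (\<forall>x. U x > 0) \<and> (\<forall>x. has_frac_laplacian \<sigma> U x (U x powr (eb / ea))) \<and>
    (\<forall>x. u x = k * U x) \<and> (\<forall>x. v x = l * U x)"
proof -
  define p q s r where "p = eb / ea" and "q = 2 * \<sigma> / ea" and "s = real CARD('n) / ea" and "r = 4 * \<sigma> / ea"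
  have rs: "(4 * \<sigma> - real CARD('n)) / ea = r - s" by (simp add: r_def s_def diff_divide_distrib)
  have pqs: "p = q + s" using exponents(4) by (simp add: p_def q_def s_def)
  have pr: "p = r + 1"
  proof -
    \<comment> \<open>The critical power exceeds 1 by \<open>r\<close>, so rescaling a solution by
      \<open>k\<close> changes the coefficient by the factor \<open>k powr r\<close>.\<close>
    have "eb = 4 * \<sigma> + ea" by (simp add: ea_def eb_def)
    then show ?thesis using ea_pos by (simp add: p_def r_def add_divide_distrib)
  qed
  have r: "r > 0" using \<sigma> ea_pos by (simp add: r_def)
  define A where "A = \<alpha>\<^sub>1 + \<beta> * \<tau> powr s"
  have A: "A > 0" using pos by (simp add: A_def add_pos_pos)
  have f1: "has_frac_laplacian \<sigma> u x (A * u x powr p)" for x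
    using eq1[of x] u(3)[of x] pos(4)
    unfolding v A_def p_def[symmetric] q_def[symmetric] s_def[symmetric] pqs
    by (simp add: powr_add powr_mult algebra_simps)
  have "has_frac_laplacian \<sigma> v x ((\<alpha>\<^sub>2 * \<tau> powr p + \<beta> * \<tau> powr q) * u x powr p)" for x
    using eq2[of x] u(3)[of x] pos(4)
    unfolding v p_def[symmetric] q_def[symmetric] s_def[symmetric] pqs
    by (simp add: powr_add powr_mult algebra_simps)
  moreover have "has_frac_laplacian \<sigma> v x (\<tau> * (A * u x powr p))" for x
    using has_frac_laplacian_cmult[OF f1[of x], of \<tau>] by (simp add: v[abs_def])
  \<comment> \<open>The operator applied to \<open>v\<close> is computed twice, from the second
    equation and from linearity; uniqueness of the limit yields the relation that makes both
    algebraic equations hold with the same \<open>k\<close>.\<close>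
  ultimately have "(\<alpha>\<^sub>2 * \<tau> powr p + \<beta> * \<tau> powr q) * u 0 powr p = \<tau> * (A * u 0 powr p)"
    using has_frac_laplacian_unique by blast
  then have "(\<alpha>\<^sub>2 * \<tau> powr p + \<beta> * \<tau> powr q) * u 0 powr p = (\<tau> * A) * u 0 powr p" by (simp add: mult.assoc)
  then have A2: "\<alpha>\<^sub>2 * \<tau> powr p + \<beta> * \<tau> powr q = \<tau> * A"
    using u(3)[of 0] by (subst (asm) mult_cancel_right) auto
  \<comment> \<open>Chosen so that \<open>k powr r * A = 1\<close>, that is, so that the rescaled
    equation has coefficient 1.\<close>
  define k where "k = A powr (- 1 / r)"
  have k: "k > 0" using A by (simp add: k_def)
  have kA: "k powr r * A = 1"
  proof -
    have "k powr r = A powr (- 1)" unfolding k_def powr_powr using r by simp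
    then show ?thesis using A by (simp add: powr_minus)
  qed
  define U where "U x = (1 / k) * u x" for x
  have 1: "\<alpha>\<^sub>1 * k powr r + \<beta> * k powr (r - s) * (\<tau> * k) powr s = 1"
  proof -
    have "k powr (r - s) * k powr s = k powr r" by (simp add: powr_add[symmetric])
    then have "\<alpha>\<^sub>1 * k powr r + \<beta> * k powr (r - s) * (\<tau> * k) powr s = k powr r * A"
      by (simp add: A_def powr_mult algebra_simps)
    then show ?thesis using kA by simp
  qed
  have 2: "\<alpha>\<^sub>2 * (\<tau> * k) powr r + \<beta> * (\<tau> * k) powr (r - s) * k powr s = 1"
  proof -
    have "k powr (r - s) * k powr s = k powr r" by (simp add: powr_add[symmetric])
    then have "\<alpha>\<^sub>2 * (\<tau> * k) powr r + \<beta> * (\<tau> * k) powr (r - s) * k powr s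
        = k powr r * (\<alpha>\<^sub>2 * \<tau> powr r + \<beta> * \<tau> powr (r - s))"
      by (simp add: powr_mult algebra_simps)
    also have "\<alpha>\<^sub>2 * \<tau> powr r + \<beta> * \<tau> powr (r - s) = A"
    proof -
      have "\<tau> powr p = \<tau> * \<tau> powr r" using pos(4) by (simp add: pr powr_add)
      moreover have "q = (r - s) + 1" using pqs pr by simp
      then have "\<tau> powr q = \<tau> * \<tau> powr (r - s)" using pos(4) by (simp only: powr_add) simp
      ultimately have "\<tau> * (\<alpha>\<^sub>2 * \<tau> powr r + \<beta> * \<tau> powr (r - s)) = \<tau> * A"
        using A2 by (simp add: algebra_simps)
      then show ?thesis using pos(4) by simp
    qed
    finally show ?thesis using kA by simp
  qed
  have UL: "has_frac_laplacian \<sigma> U x (U x powr p)" for x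
  proof -
    have "has_frac_laplacian \<sigma> U x ((1 / k) * (A * u x powr p))"
      unfolding U_def[abs_def] by (rule has_frac_laplacian_cmult[OF f1])
    moreover have "(1 / k) * (A * u x powr p) = U x powr p"
    proof -
      have "u x = k * U x" using k by (simp add: U_def)
      then have "u x powr p = k powr r * k * U x powr p"
        using k by (simp add: powr_mult) (simp add: pr powr_add)
      then show ?thesis using kA k by (simp add: mult_ac)
    qed
    ultimately show ?thesis by simp
  qed
  have "U \<in> C2 \<inter> L_space \<sigma>" unfolding U_def[abs_def] using C2_cmult[OF u(1)] L_space_cmult[OF u(2)] by blast
  moreover have "\<forall>x. U x > 0" using u(3) k by (simp add: U_def)
  moreover have "\<forall>x. u x = k * U x" "\<forall>x. v x = (\<tau> * k) * U x" using k by (simp_all add: U_def v)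
  ultimately show ?thesis
    using k pos(4) 1 2 UL unfolding rs p_def[symmetric] s_def[symmetric] r_def[symmetric]
    by (intro exI[of _ k] exI[of _ "\<tau> * k"] exI[of _ U]) auto
qed

end

theorem theorem1p1:
  fixes n :: nat and \<sigma> \<alpha>\<^sub>1 \<alpha>\<^sub>2 \<beta> :: real and u v :: "real ^ 'n \<Rightarrow> real"
  assumes "CARD('n) = n" and "n \<ge> 3"
    and "0 < \<sigma>" and "\<sigma> < 1"
    and "\<alpha>\<^sub>1 > 0" and "\<alpha>\<^sub>2 > 0" and "\<beta> > 0"
    and "u \<in> C2 \<inter> L_space \<sigma>" and "v \<in> C2 \<inter> L_space \<sigma>"
    and "\<forall>x. u x > 0" and "\<forall>x. v x > 0"
    and "\<forall>x. has_frac_laplacian \<sigma> u x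
           (\<alpha>\<^sub>1 * u x powr ((n + 2 * \<sigma>) / (n - 2 * \<sigma>))
            + \<beta> * u x powr (2 * \<sigma> / (n - 2 * \<sigma>)) * v x powr (n / (n - 2 * \<sigma>)))"
    and "\<forall>x. has_frac_laplacian \<sigma> v x
           (\<alpha>\<^sub>2 * v x powr ((n + 2 * \<sigma>) / (n - 2 * \<sigma>))
            + \<beta> * v x powr (2 * \<sigma> / (n - 2 * \<sigma>)) * u x powr (n / (n - 2 * \<sigma>)))"
  shows "(\<exists>p. radial_about p u \<and> radial_about p v) \<and>
    (\<exists>(k::real) (l::real) (U :: real ^ 'n \<Rightarrow> real).
       k > 0 \<and> l > 0 \<and>
       \<alpha>\<^sub>1 * k powr (4 * \<sigma> / (n - 2 * \<sigma>))
         + \<beta> * k powr ((4 * \<sigma> - n) / (n - 2 * \<sigma>)) * l powr (n / (n - 2 * \<sigma>)) = 1 \<and>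
       \<alpha>\<^sub>2 * l powr (4 * \<sigma> / (n - 2 * \<sigma>))
         + \<beta> * l powr ((4 * \<sigma> - n) / (n - 2 * \<sigma>)) * k powr (n / (n - 2 * \<sigma>)) = 1 \<and>
       U \<in> C2 \<inter> L_space \<sigma> \<and> (\<forall>x. U x > 0) \<and>
       (\<forall>x. has_frac_laplacian \<sigma> U x (U x powr ((n + 2 * \<sigma>) / (n - 2 * \<sigma>)))) \<and>
       (\<forall>x. u x = k * U x) \<and> (\<forall>x. v x = l * U x))"
proof -
  interpret fractional \<sigma> "TYPE('n)"
    using assms(1-4) by unfold_locales auto
  have ea: "real n - 2 * \<sigma> = ea" and eb: "real n + 2 * \<sigma> = eb" and N: "real n = real CARD('n)"
    using assms(1) by (simp_all add: ea_def eb_def)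
  have u: "u \<in> C2" "u \<in> L_space \<sigma>" "\<And>x. u x > 0" and v: "v \<in> C2" "\<And>x. v x > 0"
    using assms(8-11) by auto
  note eq1 = assms(12)[unfolded ea eb, unfolded N, rule_format]
  note eq2 = assms(13)[unfolded ea eb, unfolded N, rule_format]
  have reg: "regular u" "regular v" using C2_imp_regular u v by auto
  have c: "frac_const CARD('n) \<sigma> > 0" using assms by (intro frac_const_pos)
  have "\<exists>p \<tau>. radial_about p u \<and> \<tau> > 0 \<and> (\<forall>x. v x = \<tau> * u x)"
    by (rule radial_and_proportional[OF reg has_frac_laplacian_imp_solves[OF regular_borel[OF reg(1)] eq1]
      has_frac_laplacian_imp_solves[OF regular_borel[OF reg(2)] eq2]])
      (use assms c C2_imp_differentiable[OF u(1)] in auto)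
  then obtain p \<tau> where p: "radial_about p u" and \<tau>: "\<tau> > 0" "\<And>x. v x = \<tau> * u x" by blast
  have "radial_about p v" using p unfolding radial_about_def \<tau>(2) by metis
  then show ?thesis
    unfolding ea eb unfolding N
    using p proportional_solution[OF assms(5-7) \<tau>(1) u \<tau>(2) eq1 eq2] by blast
qed

end
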